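(* Let $D_1, D_2$ be two bounded strongly pseudoconvex domains in $\mathbf{C}^n$ with $C^2$-smooth boundaries. Let $D_1^k, D_2^k$, $k \ge 1$, be two sequences of domains that converge to $D_1, D_2$ respectively in the $C^2$ topology, and let $d_{D_1^k}, d_{D_2^k}$ denote the Kobayashi metrics (distances) on these domains. Suppose that $f^k : (D_1^k, d_{D_1^k}) \to (D_2^k, d_{D_2^k})$ is a $C^1$-smooth isometry for each $k \ge 1$ and that there is a point $p^1 \in D_1$ such that some subsequence $\{f^{k_j}(p^1)\}$ converges to a point $p^2 \in D_2$. Then there is a uniform constant $C > 0$ (independent of $j$, $p$, $q$) with the property that $$|f^{k_j}(p) - f^{k_j}(q)| \le C |p-q|^{1/2}$$ for all $p, q \in D_1$, where for given $p,q$ the inequality is understood for all large $j$ (a given pair $p,q\in D_1$ lies in $D_1^{k_j}$ for all large $j$, so that $f^{k_j}(p), f^{k_j}(q)$ are defined).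
   Context: The Kobayashi infinitesimal metric of a domain $X$ is $F^K_X(z,\xi)=\inf\{1/\alpha:\alpha>0,\ f\in\mathcal{O}(\Delta,X),\ f(0)=z,\ f'(0)=\alpha\xi\}$ ($\Delta$ the unit disc), and the Kobayashi distance $d_X(p,q)$ is the infimum of $\int_0^1F^K_X(\gamma,\dot\gamma)\,dt$ over piecewise differentiable curves joining $p$ to $q$. A $C^1$-isometry $f:D\to D'$ is a $C^1$-diffeomorphism of $D$ onto $D'$ with $f^*(F^K_{D'})=F^K_D$. Domains $D^k$ converge to a bounded $C^2$-smooth domain $D$ in the $C^2$ topology if there are a neighbourhood $U$ of $\overline{D}$, a $C^2$ defining function $\rho^0$ for $D$ on $U$, and $\rho^k\in C^2(U;\mathbf{R})$ with $D^k=\{z\in U:\rho^k(z)<0\}$ and $\|\rho^k-\rho^0\|_{C^2(U)}\to0$. *)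

theory Defs
  imports "HOL-Complex_Analysis.Complex_Analysis"
begin

definition is_domain :: "'a::topological_space set \<Rightarrow> bool" where
  "is_domain X \<longleftrightarrow> open X \<and> connected X \<and> X \<noteq> {}"


section \<open>Maps of class $C^1$ and $C^2$ on open sets\<close>

text \<open>
  The total (real) derivative as a bounded linear map.  It is meaningful only at points of
  differentiability; every use below is guarded by \<open>C1_on\<close> or \<open>C2_on\<close>.
\<close>
definition total_deriv ::
    "('a::real_normed_vector \<Rightarrow> 'b::real_normed_vector) \<Rightarrow> 'a \<Rightarrow> 'a \<Rightarrow>\<^sub>L 'b" where
  "total_deriv f x = Blinfun (frechet_derivative f (at x))"

definition C1_on :: "'a::real_normed_vector set \<Rightarrow> ('a \<Rightarrow> 'b::real_normed_vector) \<Rightarrow> bool" where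
  "C1_on U f \<longleftrightarrow> (\<forall>x\<in>U. f differentiable (at x)) \<and> continuous_on U (total_deriv f)"

definition C2_on :: "'a::real_normed_vector set \<Rightarrow> ('a \<Rightarrow> 'b::real_normed_vector) \<Rightarrow> bool" where
  "C2_on U f \<longleftrightarrow> C1_on U f \<and> C1_on U (total_deriv f)"

text \<open>
  The $C^2(U)$ norm, with operator norms for the first and second derivatives; it takes the value
  \<open>\<infinity>\<close> when one of them is unbounded on \<open>U\<close>.
\<close>
definition C2_norm :: "'a::real_normed_vector set \<Rightarrow> ('a \<Rightarrow> 'b::real_normed_vector) \<Rightarrow> ennreal" where
  "C2_norm U g =
     (SUP x\<in>U. ennreal (norm (g x))) +
     (SUP x\<in>U. ennreal (norm (total_deriv g x))) +
     (SUP x\<in>U. ennreal (norm (total_deriv (total_deriv g) x)))"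


section \<open>Defining functions, strong pseudoconvexity, convergence of domains\<close>

text \<open>
  Only \<open>frontier D \<subseteq> U\<close> is required here, so that local (collar) and global defining functions
  are both covered; if \<open>closure D \<subseteq> U\<close>, the second clause reads \<open>D = {z \<in> U. \<rho> z < 0}\<close>.
\<close>
definition C2_defining_function ::
    "(complex ^ 'n) set \<Rightarrow> (complex ^ 'n) set \<Rightarrow> (complex ^ 'n \<Rightarrow> real) \<Rightarrow> bool" where
  "C2_defining_function D U \<rho> \<longleftrightarrow>
     open U \<and> frontier D \<subseteq> U \<and> C2_on U \<rho> \<and>
     D \<inter> U = {z \<in> U. \<rho> z < 0} \<and>
     (\<forall>z\<in>frontier D. total_deriv \<rho> z \<noteq> 0)"

text \<open>
  The Wirtinger operators $\partial/\partial z_j = \frac12(\partial/\partial x_j -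
  i\,\partial/\partial y_j)$ and $\partial/\partial\bar z_j = \frac12(\partial/\partial x_j +
  i\,\partial/\partial y_j)$; the directions of $x_j$ and $y_j$ are \<open>axis j 1\<close> and \<open>axis j \<i>\<close>.
\<close>
definition d_z :: "'n \<Rightarrow> (complex ^ 'n \<Rightarrow> complex) \<Rightarrow> complex ^ 'n \<Rightarrow> complex" where
  "d_z j g p =
     (frechet_derivative g (at p) (axis j 1) - \<i> * frechet_derivative g (at p) (axis j \<i>)) / 2"

definition d_zbar :: "'n \<Rightarrow> (complex ^ 'n \<Rightarrow> complex) \<Rightarrow> complex ^ 'n \<Rightarrow> complex" where
  "d_zbar j g p =
     (frechet_derivative g (at p) (axis j 1) + \<i> * frechet_derivative g (at p) (axis j \<i>)) / 2"

definition levi_form ::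
    "(complex ^ 'n \<Rightarrow> real) \<Rightarrow> complex ^ 'n \<Rightarrow> complex ^ 'n \<Rightarrow> complex" where
  "levi_form \<rho> p v =
     (\<Sum>j\<in>UNIV. \<Sum>k\<in>UNIV.
        d_z j (d_zbar k (\<lambda>z. complex_of_real (\<rho> z))) p * v $ j * cnj (v $ k))"

definition complex_tangent_space ::
    "(complex ^ 'n \<Rightarrow> real) \<Rightarrow> complex ^ 'n \<Rightarrow> (complex ^ 'n) set" where
  "complex_tangent_space \<rho> p =
     {v. (\<Sum>j\<in>UNIV. d_z j (\<lambda>z. complex_of_real (\<rho> z)) p * v $ j) = 0}"

text \<open>
  The Levi form of a real \<open>C\<^sup>2\<close> function is Hermitian, so \<open>levi_form \<rho> p v\<close> is a real number and
  \<open>Re\<close> is only a coercion.  Positivity on the complex tangent spaces does not depend on the choice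
  of the defining function.
\<close>
definition strongly_pseudoconvex_domain :: "(complex ^ 'n) set \<Rightarrow> bool" where
  "strongly_pseudoconvex_domain D \<longleftrightarrow>
     is_domain D \<and> bounded D \<and>
     (\<exists>U \<rho>. C2_defining_function D U \<rho> \<and>
        (\<forall>p\<in>frontier D. \<forall>v\<in>complex_tangent_space \<rho> p. v \<noteq> 0 \<longrightarrow> Re (levi_form \<rho> p v) > 0))"

text \<open>The sequence is indexed by \<open>k \<ge> 1\<close>; the set \<open>Dk 0\<close> plays no role.\<close>
definition C2_converges :: "(nat \<Rightarrow> (complex ^ 'n) set) \<Rightarrow> (complex ^ 'n) set \<Rightarrow> bool" where
  "C2_converges Dk D \<longleftrightarrow>
     (\<exists>U \<rho>0 \<rho>. closure D \<subseteq> U \<and> C2_defining_function D U \<rho>0 \<and>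
        (\<forall>k\<ge>1. C2_on U (\<rho> k) \<and> Dk k = {z \<in> U. \<rho> k z < 0}) \<and>
        (\<lambda>k. C2_norm U (\<lambda>z. \<rho> k z - \<rho>0 z)) \<longlonglongrightarrow> 0)"


section \<open>The Kobayashi metric and its isometries\<close>

definition holomorphic_disc :: "(complex ^ 'n) set \<Rightarrow> (complex \<Rightarrow> complex ^ 'n) \<Rightarrow> bool" where
  "holomorphic_disc X \<phi> \<longleftrightarrow>
     (\<forall>i. (\<lambda>t. \<phi> t $ i) holomorphic_on ball 0 1) \<and> \<phi> ` ball 0 1 \<subseteq> X"

definition kobayashi_metric ::
    "(complex ^ 'n) set \<Rightarrow> complex ^ 'n \<Rightarrow> complex ^ 'n \<Rightarrow> real" where
  "kobayashi_metric X z \<xi> =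
     Inf {1 / \<alpha> | \<alpha> \<phi>. \<alpha> > 0 \<and> holomorphic_disc X \<phi> \<and> \<phi> 0 = z \<and>
            (\<chi> i. deriv (\<lambda>t. \<phi> t $ i) 0) = \<alpha> *\<^sub>R \<xi>}"

text \<open>
  For a domain the integrability clause is automatic (the infinitesimal metric is upper
  semicontinuous); it keeps the default value \<open>0\<close> of a non-existing integral out of the infimum.
\<close>
definition kobayashi_lengths :: "(complex ^ 'n) set \<Rightarrow> complex ^ 'n \<Rightarrow> complex ^ 'n \<Rightarrow> real set" where
  "kobayashi_lengths X p q =
     {integral {0..1} (\<lambda>t. kobayashi_metric X (\<gamma> t) (vector_derivative \<gamma> (at t))) | \<gamma>.
        \<gamma> piecewise_C1_differentiable_on {0..1} \<and> \<gamma> ` {0..1} \<subseteq> X \<and> \<gamma> 0 = p \<and> \<gamma> 1 = q \<and>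
        (\<lambda>t. kobayashi_metric X (\<gamma> t) (vector_derivative \<gamma> (at t))) integrable_on {0..1}}"

definition kobayashi_dist :: "(complex ^ 'n) set \<Rightarrow> complex ^ 'n \<Rightarrow> complex ^ 'n \<Rightarrow> real" where
  "kobayashi_dist X p q = Inf (kobayashi_lengths X p q)"

definition C1_diffeomorphism ::
    "'a::real_normed_vector set \<Rightarrow> 'b::real_normed_vector set \<Rightarrow> ('a \<Rightarrow> 'b) \<Rightarrow> bool" where
  "C1_diffeomorphism D D' f \<longleftrightarrow>
     bij_betw f D D' \<and> C1_on D f \<and> C1_on D' (inv_into D f)"

text \<open>
  Isometries are defined by $f^*(F^K_{D'}) = F^K_D$.  They also preserve the integrated distances:
  see \<open>C1_isometry_kobayashi_dist\<close> below.
\<close>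
definition C1_isometry ::
    "(complex ^ 'n) set \<Rightarrow> (complex ^ 'n) set \<Rightarrow> (complex ^ 'n \<Rightarrow> complex ^ 'n) \<Rightarrow> bool" where
  "C1_isometry D D' f \<longleftrightarrow>
     C1_diffeomorphism D D' f \<and>
     (\<forall>z\<in>D. \<forall>\<xi>. kobayashi_metric D' (f z) (blinfun_apply (total_deriv f z) \<xi>)
                  = kobayashi_metric D z \<xi>)"

lemma total_deriv_has_derivative:
  assumes "f differentiable (at x)"
  shows "(f has_derivative blinfun_apply (total_deriv f x)) (at x)"
proof -
  have *: "(f has_derivative frechet_derivative f (at x)) (at x)"
    using assms by (simp add: frechet_derivative_works)
  then show ?thesis
    by (simp add: total_deriv_def bounded_linear_Blinfun_apply[OF has_derivative_bounded_linear[OF *]])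
qed

lemma C1_on_compose_vector_derivative:
  assumes "C1_on D f" "\<gamma> t \<in> D" "(\<gamma> has_vector_derivative v) (at t)"
  shows "((\<lambda>s. f (\<gamma> s)) has_vector_derivative blinfun_apply (total_deriv f (\<gamma> t)) v) (at t)"
proof -
  have "(f has_derivative blinfun_apply (total_deriv f (\<gamma> t))) (at (\<gamma> t))"
    using assms by (intro total_deriv_has_derivative) (auto simp: C1_on_def)
  from vector_derivative_diff_chain_within[OF assms(3) has_derivative_at_withinI[OF this]]
  show ?thesis by (simp add: o_def)
qed

lemma C1_on_imp_continuous_on:
  assumes "C1_on D f"
  shows "continuous_on D f"
  using assms
  by (auto simp: C1_on_def intro!: continuous_at_imp_continuous_on differentiable_imp_continuous_within)

lemma C1_on_compose_piecewise_C1: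
  assumes f: "C1_on D f" and \<gamma>: "\<gamma> piecewise_C1_differentiable_on {0..1}" and sub: "\<gamma> ` {0..1} \<subseteq> D"
  shows "(\<lambda>s. f (\<gamma> s)) piecewise_C1_differentiable_on {0..1}"
    and "\<exists>S. finite S \<and> (\<forall>t\<in>{0..1} - S. vector_derivative (\<lambda>s. f (\<gamma> s)) (at t)
           = blinfun_apply (total_deriv f (\<gamma> t)) (vector_derivative \<gamma> (at t)))"
proof -
  obtain S where cont: "continuous_on {0..1} \<gamma>" and S: "finite S"
    and C1: "\<gamma> C1_differentiable_on ({0..1} - S)"
    using \<gamma> by (auto simp: piecewise_C1_differentiable_on_def)
  obtain g' where g': "\<And>t. t \<in> {0..1} - S \<Longrightarrow> (\<gamma> has_vector_derivative g' t) (at t)"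
    and cont': "continuous_on ({0..1} - S) g'"
    using C1 unfolding C1_differentiable_on_def by blast
  have d: "((\<lambda>s. f (\<gamma> s)) has_vector_derivative blinfun_apply (total_deriv f (\<gamma> t)) (g' t)) (at t)"
    if "t \<in> {0..1} - S" for t
    using that sub by (intro C1_on_compose_vector_derivative[OF f _ g'[OF that]]) auto
  have "continuous_on ({0..1} - S) (\<lambda>t. total_deriv f (\<gamma> t))"
  proof (rule continuous_on_compose2[of D "total_deriv f" _ \<gamma>])
    show "continuous_on D (total_deriv f)" using f by (simp add: C1_on_def)
    show "continuous_on ({0..1} - S) \<gamma>" using cont by (rule continuous_on_subset) auto
    show "\<gamma> ` ({0..1} - S) \<subseteq> D" using sub by auto
  qed
  then have "continuous_on ({0..1} - S) (\<lambda>t. blinfun_apply (total_deriv f (\<gamma> t)) (g' t))"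
    by (rule blinfun.continuous_on[OF _ cont'])
  with d have "(\<lambda>s. f (\<gamma> s)) C1_differentiable_on ({0..1} - S)"
    unfolding C1_differentiable_on_def
    by (intro exI[of _ "\<lambda>t. blinfun_apply (total_deriv f (\<gamma> t)) (g' t)"] conjI ballI)
  moreover have "continuous_on {0..1} (\<lambda>s. f (\<gamma> s))"
    by (rule continuous_on_compose2[OF C1_on_imp_continuous_on[OF f] cont sub])
  ultimately show "(\<lambda>s. f (\<gamma> s)) piecewise_C1_differentiable_on {0..1}"
    using S by (auto simp: piecewise_C1_differentiable_on_def)
  have "\<forall>t\<in>{0..1} - S. vector_derivative (\<lambda>s. f (\<gamma> s)) (at t)
           = blinfun_apply (total_deriv f (\<gamma> t)) (vector_derivative \<gamma> (at t))"
    using vector_derivative_at[OF d] vector_derivative_at[OF g'] by simp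
  with S show "\<exists>S. finite S \<and> (\<forall>t\<in>{0..1} - S. vector_derivative (\<lambda>s. f (\<gamma> s)) (at t)
           = blinfun_apply (total_deriv f (\<gamma> t)) (vector_derivative \<gamma> (at t)))"
    by blast
qed

lemma kobayashi_lengths_subset:
  assumes f: "C1_on D f" and im: "f ` D \<subseteq> D'"
    and iso: "\<And>z \<xi>. z \<in> D \<Longrightarrow>
      kobayashi_metric D' (f z) (blinfun_apply (total_deriv f z) \<xi>) = kobayashi_metric D z \<xi>"
  shows "kobayashi_lengths D p q \<subseteq> kobayashi_lengths D' (f p) (f q)"
proof
  fix l assume "l \<in> kobayashi_lengths D p q"
  then obtain \<gamma> where \<gamma>: "\<gamma> piecewise_C1_differentiable_on {0..1}" "\<gamma> ` {0..1} \<subseteq> D" "\<gamma> 0 = p" "\<gamma> 1 = q"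
    and int: "(\<lambda>t. kobayashi_metric D (\<gamma> t) (vector_derivative \<gamma> (at t))) integrable_on {0..1}"
    and l: "l = integral {0..1} (\<lambda>t. kobayashi_metric D (\<gamma> t) (vector_derivative \<gamma> (at t)))"
    by (auto simp: kobayashi_lengths_def)
  define \<delta> where "\<delta> = (\<lambda>s. f (\<gamma> s))"
  obtain S where S: "finite S"
    and vd: "\<And>t. t \<in> {0..1} - S \<Longrightarrow> vector_derivative \<delta> (at t)
           = blinfun_apply (total_deriv f (\<gamma> t)) (vector_derivative \<gamma> (at t))"
    using C1_on_compose_piecewise_C1(2)[OF f \<gamma>(1,2)] unfolding \<delta>_def by blast
  have eq: "kobayashi_metric D' (\<delta> t) (vector_derivative \<delta> (at t))
      = kobayashi_metric D (\<gamma> t) (vector_derivative \<gamma> (at t))" if "t \<in> {0..1} - S" for t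
  proof -
    have "\<gamma> t \<in> D" using that \<gamma>(2) by auto
    from iso[OF this] show ?thesis by (simp add: vd[OF that]) (simp add: \<delta>_def)
  qed
  have "(\<lambda>t. kobayashi_metric D' (\<delta> t) (vector_derivative \<delta> (at t))) integrable_on {0..1}"
    using integrable_spike_finite[OF S eq int] .
  moreover have "l = integral {0..1} (\<lambda>t. kobayashi_metric D' (\<delta> t) (vector_derivative \<delta> (at t)))"
    unfolding l by (intro integral_spike[OF negligible_finite[OF S] eq])
  moreover have "\<delta> piecewise_C1_differentiable_on {0..1}"
    using C1_on_compose_piecewise_C1(1)[OF f \<gamma>(1,2)] by (simp add: \<delta>_def)
  moreover have "\<delta> ` {0..1} \<subseteq> D'" "\<delta> 0 = f p" "\<delta> 1 = f q"
    using \<gamma> im by (auto simp: \<delta>_def)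
  ultimately show "l \<in> kobayashi_lengths D' (f p) (f q)"
    unfolding kobayashi_lengths_def mem_Collect_eq by (intro exI[of _ \<delta>] conjI)
qed

lemma C1_isometry_kobayashi_dist:
  assumes iso: "C1_isometry D D' f" and dom: "open D" "open D'" and pq: "p \<in> D" "q \<in> D"
  shows "kobayashi_dist D' (f p) (f q) = kobayashi_dist D p q"
proof -
  define g where "g = inv_into D f"
  have bij: "bij_betw f D D'" and f: "C1_on D f" and g: "C1_on D' g"
    and F: "\<And>z \<xi>. z \<in> D \<Longrightarrow>
      kobayashi_metric D' (f z) (blinfun_apply (total_deriv f z) \<xi>) = kobayashi_metric D z \<xi>"
    using iso by (auto simp: C1_isometry_def C1_diffeomorphism_def g_def)
  have gD: "g w \<in> D" and fg: "f (g w) = w" if "w \<in> D'" for w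
    using that bij by (auto simp: g_def bij_betw_def inv_into_into f_inv_into_f)
  have gf: "g (f z) = z" if "z \<in> D" for z
    using that bij by (auto simp: g_def bij_betw_def)
  have G: "kobayashi_metric D (g w) (blinfun_apply (total_deriv g w) \<eta>) = kobayashi_metric D' w \<eta>"
    if w: "w \<in> D'" for w \<eta>
  proof -
    have dg: "(g has_derivative blinfun_apply (total_deriv g w)) (at w)"
      using g w by (intro total_deriv_has_derivative) (auto simp: C1_on_def)
    have df: "(f has_derivative blinfun_apply (total_deriv f (g w))) (at (g w))"
      using f gD[OF w] by (intro total_deriv_has_derivative) (auto simp: C1_on_def)
    have "((\<lambda>x. f (g x)) has_derivative
        (\<lambda>h. blinfun_apply (total_deriv f (g w)) (blinfun_apply (total_deriv g w) h))) (at w)"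
      using has_derivative_compose[OF dg df] .
    then have "((\<lambda>x. x) has_derivative
        (\<lambda>h. blinfun_apply (total_deriv f (g w)) (blinfun_apply (total_deriv g w) h))) (at w)"
      by (rule has_derivative_transform_within_open[OF _ dom(2) w]) (simp add: fg)
    then have "(\<lambda>h. blinfun_apply (total_deriv f (g w)) (blinfun_apply (total_deriv g w) h)) = (\<lambda>h. h)"
      using has_derivative_unique has_derivative_ident by blast
    then have "blinfun_apply (total_deriv f (g w)) (blinfun_apply (total_deriv g w) \<eta>) = \<eta>"
      by meson
    with F[OF gD[OF w], of "blinfun_apply (total_deriv g w) \<eta>"] show ?thesis
      by (simp add: fg w)
  qed
  have "kobayashi_lengths D p q \<subseteq> kobayashi_lengths D' (f p) (f q)"
    using bij by (intro kobayashi_lengths_subset f F) (auto simp: bij_betw_def)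
  moreover have "kobayashi_lengths D' (f p) (f q) \<subseteq> kobayashi_lengths D (g (f p)) (g (f q))"
    using gD by (intro kobayashi_lengths_subset g G) auto
  ultimately show ?thesis
    using pq by (simp add: kobayashi_dist_def gf)
qed

end

theory Submission
  imports Defs
begin

text \<open>
  Write \<open>\<sigma> = -\<rho>\<close> for the defining function of a domain, which is comparable to the distance to the
  boundary, and \<open>F\<close> for its Kobayashi metric. The theorem follows from three estimates whose
  constants are the same for all domains of the two sequences with large index.

  \<^item> \<open>F(z,\<xi>) \<le> C \<bar>\<xi>\<bar> / \<sigma>(z)\<close>, because a ball of radius proportional to \<open>\<sigma>(z)\<close> fits into the domain.
  \<^item> \<open>\<bar>\<xi>\<bar> \<le> C sqrt(\<sigma>(z)) F(z,\<xi>)\<close>, because the domain is strongly pseudoconvex.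
  \<^item> \<open>\<sigma>\<^sub>2(f(z)) \<le> C \<sigma>\<^sub>1(z)\<close> for the isometries \<open>f\<close>.

  Together they bound \<open>\<bar>df(z)\<xi>\<bar>\<close> by \<open>C sqrt(\<sigma>\<^sub>2(f(z))) F\<^sub>2(f(z),df(z)\<xi>) = C sqrt(\<sigma>\<^sub>2(f(z))) F\<^sub>1(z,\<xi>)\<close> and
  hence by \<open>C \<bar>\<xi>\<bar> / sqrt(\<sigma>\<^sub>1(z))\<close>. A gradient that grows at most like the inverse square root of the
  boundary distance integrates to a Hoelder exponent one half (\<open>hoelder_from_gradient\<close>): two points
  at distance \<open>d\<close> are joined by first moving both of them a distance of order \<open>d\<close> away from the
  boundary.

  The third estimate compares Kobayashi distances to a base point. They are
  \<open>1/2 log (1/\<sigma>) + O(1)\<close>, and the factor one half has to be sharp on both sides. The distances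
  themselves are avoided. On the first domain there is the sharp conormal bound
  \<open>\<bar>d\<rho>(z)\<xi>\<bar> \<le> 2\<sigma>(1 + C\<sigma>) F(z,\<xi>)\<close>, which says that \<open>\<Lambda> = 1/2 log (\<sigma>/(1 + C\<sigma>))\<close> is 1-Lipschitz for \<open>F\<close>.
  The isometry transports \<open>\<Lambda>\<close> to a 1-Lipschitz function on the second domain. There such a
  function varies by a bounded amount on compact sets (\<open>chain_bound\<close>) and by at most
  \<open>1/2 log (1/\<sigma>) + C\<close> along an inward normal (\<open>normal_segment_bound\<close>), since the slice of the domain
  in the complex normal direction contains a round disc, whose Poincare metric is explicit.

  The two lower bounds for \<open>F\<close> are statements about holomorphic discs \<open>\<phi>\<close> with \<open>\<phi>(0) = z\<close>. Both come
  from the maximum principle for functions on the unit disc that are touched from below by moduli of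
  holomorphic functions. Let \<open>r = exp(2A\<rho>) - 1\<close>, which is strictly plurisubharmonic near the
  boundary. The first bound (\<open>disc_deriv_norm_bound\<close>) uses \<open>max (r - c\<bar>w - z\<bar>\<^sup>2, const)\<close>. The second
  (\<open>disc_deriv_sharp_bound\<close>) uses the Levi polynomial \<open>P\<close> of \<open>r\<close> at \<open>z\<close>: with \<open>s = -r(z)\<close>, the Cayley
  transform \<open>P/(2s - P)\<close> maps the part of the domain near \<open>z\<close> into the unit disc, and the logarithm
  of its modulus extends to a plurisubharmonic function on the whole domain that is at most of
  order \<open>s\<close>.

  Uniformity of the constants (\<open>uniform_domains\<close>) is a compactness argument near the closure of the
  limit domain. It starts from strong pseudoconvexity with respect to some defining function, which
  has to be carried over to the one in the definition of convergence (\<open>levi_positive_independent\<close>).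
\<close>

section \<open>A maximum principle\<close>


text \<open>
  The form of logarithmic subharmonicity used below: a lower support by the modulus of a holomorphic
  function. It passes to maxima and can be checked piecewise for glued functions.
\<close>
definition holomorphically_supported :: "(complex \<Rightarrow> real) \<Rightarrow> complex \<Rightarrow> bool" where
  "holomorphically_supported U \<zeta> \<longleftrightarrow>
     (\<exists>F e. e > 0 \<and> F holomorphic_on ball \<zeta> e \<and> norm (F \<zeta>) = U \<zeta> \<and>
        (\<forall>w\<in>ball \<zeta> e. norm (F w) \<le> U w))"

lemma holomorphically_supportedI:
  assumes "open S" "\<zeta> \<in> S" "F holomorphic_on S" "norm (F \<zeta>) = U \<zeta>"
    and "\<And>w. w \<in> S \<Longrightarrow> norm (F w) \<le> U w"
  shows "holomorphically_supported U \<zeta>"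
proof -
  obtain e where "e > 0" "ball \<zeta> e \<subseteq> S"
    using assms(1,2) by (auto simp: open_contains_ball)
  then show ?thesis
    unfolding holomorphically_supported_def
    using assms(3-5) holomorphic_on_subset by blast
qed

text \<open>
  At a maximum point the holomorphic support function has a local maximum of its modulus, hence is
  constant, so that the maximum points in the ball form an open set.
\<close>
lemma maximum_principle:
  assumes cont: "continuous_on (cball 0 \<rho>) U" and \<rho>: "\<rho> > 0"
    and supp: "\<And>\<zeta>. \<zeta> \<in> ball 0 \<rho> \<Longrightarrow> holomorphically_supported U \<zeta>"
    and bd: "\<And>\<zeta>. norm \<zeta> = \<rho> \<Longrightarrow> U \<zeta> \<le> m"
  shows "U 0 \<le> m"
proof -
  have ne: "cball (0::complex) \<rho> \<noteq> {}" using \<rho> by auto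
  obtain x where x: "x \<in> cball 0 \<rho>" "\<And>y. y \<in> cball 0 \<rho> \<Longrightarrow> U y \<le> U x"
    using continuous_attains_sup[OF compact_cball ne cont] by blast
  define T where "T = {y \<in> cball 0 \<rho>. U y = U x}"
  have "closed T"
    unfolding T_def using continuous_closed_preimage_constant[OF cont] by (simp add: vimage_def Int_def)
  then have "compact (cball 0 \<rho> \<inter> T)" by (intro compact_Int_closed) auto
  moreover have "cball 0 \<rho> \<inter> T = T" by (auto simp: T_def)
  ultimately have "compact T" by simp
  moreover have "x \<in> T" using x by (simp add: T_def)
  \<comment> \<open>Among all maximum points choose one of largest modulus: it cannot be interior.\<close>
  ultimately obtain y where y: "y \<in> T" "\<And>w. w \<in> T \<Longrightarrow> norm w \<le> norm y"
    using continuous_attains_sup[of T norm] by (auto intro: continuous_intros)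
  have "norm y = \<rho>"
  proof (rule ccontr)
    assume "norm y \<noteq> \<rho>"
    with y have yb: "y \<in> ball 0 \<rho>" by (auto simp: T_def)
    then obtain F e where F: "e > 0" "F holomorphic_on ball y e" "norm (F y) = U y"
      "\<And>w. w \<in> ball y e \<Longrightarrow> norm (F w) \<le> U w"
      using supp unfolding holomorphically_supported_def by blast
    obtain e' where e': "e' > 0" "ball y e' \<subseteq> ball 0 \<rho>"
      using yb open_ball openE by blast
    define d where "d = min e e'"
    have d: "d > 0" "ball y d \<subseteq> ball y e" "ball y d \<subseteq> ball 0 \<rho>" using F(1) e' by (auto simp: d_def)
    have Uy: "U y = U x" using y by (simp add: T_def)
    have "F constant_on ball y d"
    proof (rule maximum_modulus_principle[where U = "ball y d" and \<xi> = y])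
      show "norm (F z) \<le> norm (F y)" if "z \<in> ball y d" for z
      proof -
        have "z \<in> ball y e" "z \<in> cball 0 \<rho>" using that d(2,3) ball_subset_cball by blast+
        then have "norm (F z) \<le> U z" "U z \<le> U x" using F(4) x(2) by auto
        then show ?thesis using F(3) Uy by simp
      qed
    qed (use F d in \<open>auto intro: holomorphic_on_subset\<close>)
    then have const: "F w = F y" if "w \<in> ball y d" for w
      using that d(1) unfolding constant_on_def by (metis centre_in_ball)
    define w where "w = y + of_real (d/2) * (if y = 0 then 1 else sgn y)"
    have nw: "norm w = norm y + d/2"
    proof (cases "y = 0")
      case False
      then have "w = (norm y + d/2) *\<^sub>R sgn y"
        by (auto simp: w_def scaleR_conv_of_real sgn_eq algebra_simps divide_simps)
      with False d(1) show ?thesis by (simp add: norm_sgn)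
    qed (use d(1) in \<open>simp add: w_def norm_mult\<close>)
    have "norm (w - y) = d/2" using d(1) by (auto simp: w_def norm_mult norm_sgn)
    then have wd: "w \<in> ball y d" using d(1) by (simp add: dist_norm norm_minus_commute)
    have wc: "w \<in> cball 0 \<rho>" using wd d(3) ball_subset_cball by blast
    have "U x \<le> U w" using F(4)[of w] wd d(2) const[OF wd] F(3) Uy by auto
    with x(2)[OF wc] wc have "w \<in> T" by (auto simp: T_def)
    from y(2)[OF this] nw d(1) show False by simp
  qed
  then have "U x \<le> m" using bd[of y] y by (simp add: T_def)
  moreover have "U 0 \<le> U x" using x(2) \<rho> by auto
  ultimately show ?thesis by simp
qed

section \<open>Holomorphic discs\<close>

definition quad_poly :: "complex ^ 'n \<Rightarrow> ('n \<Rightarrow> 'n \<Rightarrow> complex) \<Rightarrow> complex ^ 'n \<Rightarrow> complex" where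
  "quad_poly l m h = (\<Sum>i\<in>UNIV. l $ i * h $ i) + (\<Sum>i\<in>UNIV. \<Sum>j\<in>UNIV. m i j * h $ i * h $ j)"

lemma quad_poly_0 [simp]: "quad_poly l m 0 = 0"
  by (simp add: quad_poly_def)

definition herm :: "complex ^ 'n \<Rightarrow> complex ^ 'n \<Rightarrow> complex" where
  "herm x y = (\<Sum>i\<in>UNIV. x $ i * cnj (y $ i))"

lemma norm_smult: "norm (c *s x) = cmod c * norm (x :: complex ^ 'n)"
  by (simp add: norm_vec_def L2_set_def norm_mult power_mult_distrib real_sqrt_mult
      flip: sum_distrib_left)

lemma Re_herm: "Re (herm x y) = x \<bullet> y"
  by (simp add: herm_def inner_vec_def inner_complex_def)

lemma herm_self: "herm x x = of_real ((norm x)\<^sup>2)"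
proof -
  have "herm x x = of_real (\<Sum>i\<in>UNIV. (norm (x $ i))\<^sup>2)"
    unfolding herm_def of_real_sum by (intro sum.cong refl complex_norm_square[symmetric])
  then show ?thesis by (simp add: norm_vec_def L2_set_def real_sqrt_pow2 sum_nonneg)
qed

text \<open>
  The derivative at the origin, in the form in which it occurs in \<open>kobayashi_metric\<close>.
\<close>
definition deriv_vec :: "(complex \<Rightarrow> complex ^ 'n) \<Rightarrow> complex ^ 'n" where
  "deriv_vec \<phi> = (\<chi> i. deriv (\<lambda>t. \<phi> t $ i) 0)"

lemma holomorphic_disc_component:
  "holomorphic_disc X \<phi> \<Longrightarrow> S \<subseteq> ball 0 1 \<Longrightarrow> (\<lambda>t. \<phi> t $ i) holomorphic_on S"
  by (auto simp: holomorphic_disc_def intro: holomorphic_on_subset)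

lemma holomorphic_disc_continuous:
  assumes "holomorphic_disc X \<phi>"
  shows "continuous_on (ball 0 1) \<phi>"
proof -
  have "continuous_on (ball 0 1) (\<lambda>t. \<chi> i. \<phi> t $ i)"
    using assms by (intro continuous_on_vec_lambda) (auto simp: holomorphic_disc_def intro: holomorphic_on_imp_continuous_on)
  then show ?thesis by simp
qed

lemma holomorphic_disc_herm:
  "holomorphic_disc X \<phi> \<Longrightarrow> S \<subseteq> ball 0 1 \<Longrightarrow> (\<lambda>t. herm (\<phi> t - a) b) holomorphic_on S"
  unfolding herm_def by (auto intro!: holomorphic_intros holomorphic_disc_component)

lemma holomorphic_disc_quad_poly:
  "holomorphic_disc X \<phi> \<Longrightarrow> S \<subseteq> ball 0 1 \<Longrightarrow> (\<lambda>t. quad_poly l m (\<phi> t - a)) holomorphic_on S"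
  unfolding quad_poly_def by (auto intro!: holomorphic_intros holomorphic_disc_component)

lemma disc_component_deriv:
  assumes "holomorphic_disc X \<phi>"
  shows "((\<lambda>t. \<phi> t $ i) has_field_derivative deriv_vec \<phi> $ i) (at 0)"
  unfolding deriv_vec_def
  using assms holomorphic_derivI[of "\<lambda>t. \<phi> t $ i" "ball 0 1" 0]
  by (simp add: holomorphic_disc_def)

lemma deriv_herm_disc:
  assumes "holomorphic_disc X \<phi>"
  shows "deriv (\<lambda>t. herm (\<phi> t - a) b) 0 = herm (deriv_vec \<phi>) b"
  unfolding herm_def
  by (rule DERIV_imp_deriv) (auto intro!: derivative_eq_intros disc_component_deriv[OF assms])

lemma deriv_quad_poly_disc:
  assumes "holomorphic_disc X \<phi>"
  shows "((\<lambda>t. quad_poly l m (\<phi> t - \<phi> 0)) has_field_derivative (\<Sum>i\<in>UNIV. l $ i * deriv_vec \<phi> $ i)) (at 0)"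
  unfolding quad_poly_def
  by (auto intro!: derivative_eq_intros disc_component_deriv[OF assms] sum.cong simp: mult.commute)

lemma open_disc_preimage:
  assumes "holomorphic_disc X \<phi>" "open V"
  shows "open {\<zeta> \<in> ball 0 1. \<phi> \<zeta> \<in> V}"
proof -
  have "{\<zeta> \<in> ball 0 1. \<phi> \<zeta> \<in> V} = ball 0 1 \<inter> \<phi> -` V" by auto
  with continuous_open_preimage[OF holomorphic_disc_continuous[OF assms(1)] _ assms(2)]
  show ?thesis by simp
qed

lemma norm_add_sq: "(norm (a + h :: 'a::real_inner))\<^sup>2 = (norm a)\<^sup>2 + 2 * (h \<bullet> a) + (norm h)\<^sup>2"
  by (simp add: power2_norm_eq_inner inner_add inner_commute)

section \<open>Discs in a domain with a strictly plurisubharmonic collar\<close>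

text \<open>
  The last clause is strict plurisubharmonicity in the collar \<open>r > -\<epsilon>\<close>, with a uniform constant and
  on a uniform scale: \<open>r\<close> exceeds the real part of its Levi polynomial at \<open>a\<close> by a definite multiple
  of the squared distance. The linear part of the polynomial has real part \<open>r' a\<close>, the derivative
  of \<open>r\<close> at \<open>a\<close>.
\<close>
definition strictly_psh_collar ::
  "(complex ^ 'n) set \<Rightarrow> (complex ^ 'n \<Rightarrow> real) \<Rightarrow> (complex ^ 'n \<Rightarrow> complex ^ 'n \<Rightarrow> real) \<Rightarrow>
    real \<Rightarrow> real \<Rightarrow> real \<Rightarrow> real \<Rightarrow> bool" where
  "strictly_psh_collar X r r' R \<epsilon> \<tau> c \<longleftrightarrow>
     (\<forall>z\<in>X. \<forall>w\<in>X. norm (z - w) \<le> R) \<and> continuous_on X r \<and> (\<forall>z\<in>X. r z < 0) \<and>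
     (\<forall>a\<in>X. r a > -\<epsilon> \<longrightarrow> (\<exists>l m. (\<forall>h. Re (\<Sum>i\<in>UNIV. l $ i * h $ i) = r' a h) \<and>
        (\<forall>h. norm h < \<tau> \<and> a + h \<in> X \<longrightarrow> r (a + h) \<ge> r a + Re (quad_poly l m h) + c * (norm h)\<^sup>2)))"

text \<open>
  A disc through a point near the boundary has a small derivative: the function
  \<open>v = max (r - c'\<bar>w - z\<bar>\<^sup>2, -\<epsilon>/2)\<close> is plurisubharmonic on all of \<open>X\<close>, so \<open>v \<circ> \<phi>\<close> obeys the maximum
  principle. On the circle of radius \<open>\<rho>\<close> it is at most \<open>-c'\<bar>\<phi> - z\<bar>\<^sup>2\<close>. By convexity of the square
  this is at most \<open>-c' \<rho>\<^sup>2 (2 Re G - \<bar>b\<bar>\<^sup>2)\<close>, where \<open>b = \<phi>'(0)\<close> and \<open>G\<close> is the Hermitian product of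
  \<open>(\<phi> - z)/\<zeta>\<close> with \<open>b\<close>. The last function is harmonic, and its value at the origin is \<open>-c' \<rho>\<^sup>2 \<bar>b\<bar>\<^sup>2\<close>.
\<close>
lemma disc_deriv_norm_bound:
  assumes psc: "strictly_psh_collar X r r' R \<epsilon> \<tau> c" and pos: "\<epsilon> > 0" "\<tau> > 0"
    and c': "0 < c'" "c' \<le> c" "c' * R\<^sup>2 \<le> \<epsilon> / 2"
    and disc: "holomorphic_disc X \<phi>"
  shows "c' * (norm (deriv_vec \<phi>))\<^sup>2 \<le> - r (\<phi> 0)"
proof -
  define z where "z = \<phi> 0"
  define b where "b = deriv_vec \<phi>"
  have diam: "\<And>x y. x \<in> X \<Longrightarrow> y \<in> X \<Longrightarrow> norm (x - y) \<le> R" and cont: "continuous_on X r"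
    and neg: "\<And>x. x \<in> X \<Longrightarrow> r x < 0"
    and supp: "\<And>a. a \<in> X \<Longrightarrow> r a > -\<epsilon> \<Longrightarrow> \<exists>l m.
        \<forall>h. norm h < \<tau> \<and> a + h \<in> X \<longrightarrow> r (a + h) \<ge> r a + Re (quad_poly l m h) + c * (norm h)\<^sup>2"
    using psc unfolding strictly_psh_collar_def by blast+
  have inX: "\<phi> \<zeta> \<in> X" if "\<zeta> \<in> ball 0 1" for \<zeta> using disc that by (auto simp: holomorphic_disc_def)
  have contphi: "continuous_on (ball 0 1) \<phi>" using holomorphic_disc_continuous[OF disc] .
  define H where "H = (\<lambda>\<zeta>. herm (\<phi> \<zeta> - z) b)"
  have "H holomorphic_on ball 0 1" unfolding H_def by (rule holomorphic_disc_herm[OF disc]) simp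
  moreover have "H 0 = 0" by (simp add: H_def z_def herm_def)
  ultimately obtain G where G: "G holomorphic_on ball 0 1" "\<And>\<zeta>. norm \<zeta> < 1 \<Longrightarrow> H \<zeta> = \<zeta> * G \<zeta>"
    "deriv H 0 = G 0"
    using Schwarz3 by metis
  have G0: "G 0 = of_real ((norm b)\<^sup>2)"
    using G(3) deriv_herm_disc[OF disc, of z b] by (simp add: H_def herm_self b_def)
  define v where "v = (\<lambda>w. max (r w - c' * (norm (w - z))\<^sup>2) (-\<epsilon>/2))"
  have contv: "continuous_on X v" unfolding v_def by (intro continuous_intros cont)
  have vz: "r z \<le> v z" by (simp add: v_def)
  have zX: "z \<in> X" using inX[of 0] by (simp add: z_def)
  have vle: "v w \<le> - c' * (norm (w - z))\<^sup>2" if "w \<in> X" for w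
  proof -
    have "(norm (w - z))\<^sup>2 \<le> R\<^sup>2" using diam[OF that zX] by (intro power_mono) auto
    then have "c' * (norm (w - z))\<^sup>2 \<le> c' * R\<^sup>2" using c'(1) by simp
    with c'(3) have "c' * (norm (w - z))\<^sup>2 \<le> \<epsilon> / 2" by linarith
    with neg[OF that] show ?thesis by (simp add: v_def)
  qed
  have main: "c' * \<rho>\<^sup>2 * (norm b)\<^sup>2 \<le> - r z" if \<rho>: "0 < \<rho>" "\<rho> < 1" for \<rho>
  proof -
    define U where "U = (\<lambda>\<zeta>. exp (v (\<phi> \<zeta>) + c' * \<rho>\<^sup>2 * (2 * Re (G \<zeta>) - (norm b)\<^sup>2)))"
    have sub: "cball 0 \<rho> \<subseteq> ball (0::complex) 1" using \<rho> by auto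
    have "U 0 \<le> 1"
    proof (rule maximum_principle[OF _ \<rho>(1)])
      show "continuous_on (cball 0 \<rho>) U"
        unfolding U_def using sub inX
        by (intro continuous_intros continuous_on_compose2[OF contv] continuous_on_subset[OF contphi]
            continuous_on_subset[OF holomorphic_on_imp_continuous_on[OF G(1)]]) auto
      show "U \<zeta> \<le> 1" if "norm \<zeta> = \<rho>" for \<zeta>
      proof -
        have \<zeta>: "norm \<zeta> < 1" using that \<rho> by simp
        have "0 \<le> (norm (\<phi> \<zeta> - z - \<zeta> *s b))\<^sup>2" by simp
        also have "\<dots> = (norm (\<phi> \<zeta> - z))\<^sup>2 - 2 * ((\<phi> \<zeta> - z) \<bullet> (\<zeta> *s b)) + (norm (\<zeta> *s b))\<^sup>2"
          by (simp add: power2_norm_eq_inner inner_diff inner_commute algebra_simps)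
        also have "(norm (\<zeta> *s b))\<^sup>2 = \<rho>\<^sup>2 * (norm b)\<^sup>2"
          by (simp add: norm_smult that power_mult_distrib)
        also have "(\<phi> \<zeta> - z) \<bullet> (\<zeta> *s b) = \<rho>\<^sup>2 * Re (G \<zeta>)"
        proof -
          have "(\<phi> \<zeta> - z) \<bullet> (\<zeta> *s b) = Re (cnj \<zeta> * H \<zeta>)"
            unfolding Re_herm[symmetric] H_def
            by (simp add: herm_def sum_distrib_left algebra_simps)
          also have "cnj \<zeta> * H \<zeta> = of_real (\<rho>\<^sup>2) * G \<zeta>"
            using G(2)[OF \<zeta>] complex_norm_square[of \<zeta>] that by (simp add: algebra_simps)
          finally show ?thesis by simp
        qed
        finally have "\<rho>\<^sup>2 * (2 * Re (G \<zeta>) - (norm b)\<^sup>2) \<le> (norm (\<phi> \<zeta> - z))\<^sup>2"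
          by (simp add: algebra_simps)
        then have "c' * (\<rho>\<^sup>2 * (2 * Re (G \<zeta>) - (norm b)\<^sup>2)) \<le> c' * (norm (\<phi> \<zeta> - z))\<^sup>2"
          using c'(1) by simp
        with vle[OF inX, of \<zeta>] \<zeta> show ?thesis by (simp add: U_def mult.assoc)
      qed
      show "holomorphically_supported U \<zeta>" if "\<zeta> \<in> ball 0 \<rho>" for \<zeta>
      proof -
        have \<zeta>1: "\<zeta> \<in> ball 0 1" using that \<rho> by auto
        define a where "a = \<phi> \<zeta>"
        have aX: "a \<in> X" using inX[OF \<zeta>1] by (simp add: a_def)
        define E where "E = (\<lambda>\<zeta>. of_real (c' * \<rho>\<^sup>2) * (2 * G \<zeta> - of_real ((norm b)\<^sup>2)))"
        have E: "E holomorphic_on ball 0 1" unfolding E_def by (intro holomorphic_intros G(1))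
        have U_eq: "U w = exp (v (\<phi> w) + Re (E w))" for w
          by (simp add: U_def E_def algebra_simps del: of_real_mult of_real_power)
        \<comment> \<open>Where the constant attains the maximum it supports \<open>v\<close> globally. Elsewhere the point lies in
            the collar, and the Levi polynomial supports \<open>r\<close>.\<close>
        show ?thesis
        proof (cases "v a = -\<epsilon>/2")
          case True
          show ?thesis
          proof (rule holomorphically_supportedI[of "ball 0 1" _ "\<lambda>w. exp (of_real (-\<epsilon>/2) + E w)"])
            show "(\<lambda>w. exp (of_real (-\<epsilon>/2) + E w)) holomorphic_on ball 0 1"
              by (intro holomorphic_intros E)
            show "norm (exp (of_real (-\<epsilon>/2) + E \<zeta>)) = U \<zeta>" using True by (simp add: U_eq a_def)
            show "norm (exp (of_real (-\<epsilon>/2) + E w)) \<le> U w" for w by (simp add: U_eq v_def)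
          qed (use \<zeta>1 in auto)
        next
          case False
          then have va: "v a = r a - c' * (norm (a - z))\<^sup>2" "r a - c' * (norm (a - z))\<^sup>2 > -\<epsilon>/2"
            by (auto simp: v_def max_def split: if_splits)
          have "0 \<le> c' * (norm (a - z))\<^sup>2" using c'(1) by simp
          with va(2) pos(1) have "r a > -\<epsilon>" by linarith
          from supp[OF aX this] obtain l m where
            lm: "\<And>h. norm h < \<tau> \<Longrightarrow> a + h \<in> X \<Longrightarrow> r (a + h) \<ge> r a + Re (quad_poly l m h) + c * (norm h)\<^sup>2"
            by blast
          define S where "S = {w \<in> ball 0 1. \<phi> w \<in> ball a \<tau>}"
          define F where "F = (\<lambda>w. exp (of_real (v a) + quad_poly l m (\<phi> w - a)
                - of_real (2 * c') * herm (\<phi> w - a) (a - z) + E w))"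
          show ?thesis
          proof (rule holomorphically_supportedI[of S _ F])
            show "open S" unfolding S_def by (rule open_disc_preimage[OF disc]) auto
            show "\<zeta> \<in> S" using \<zeta>1 pos by (auto simp: S_def a_def)
            have "S \<subseteq> ball 0 1" by (auto simp: S_def)
            then show "F holomorphic_on S" unfolding F_def
              by (intro holomorphic_intros holomorphic_disc_quad_poly[OF disc]
                  holomorphic_disc_herm[OF disc] holomorphic_on_subset[OF E])
            show "norm (F \<zeta>) = U \<zeta>" by (simp add: F_def U_eq a_def herm_def)
            show "norm (F w) \<le> U w" if "w \<in> S" for w
            proof -
              define h where "h = \<phi> w - a"
              have w1: "w \<in> ball 0 1" "norm h < \<tau>" using that by (auto simp: S_def h_def dist_norm norm_minus_commute)
              have ah: "a + h = \<phi> w" by (simp add: h_def)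
              have "r a + Re (quad_poly l m h) + c * (norm h)\<^sup>2 \<le> r (\<phi> w)"
                using lm[of h] w1 inX[of w] ah by auto
              moreover have "c' * (norm (\<phi> w - z))\<^sup>2
                  = c' * (norm (a - z))\<^sup>2 + 2 * c' * (h \<bullet> (a - z)) + c' * (norm h)\<^sup>2"
                using norm_add_sq[of "a - z" h] by (simp add: h_def distrib_left)
              moreover have "c' * (norm h)\<^sup>2 \<le> c * (norm h)\<^sup>2" using c' by (intro mult_right_mono) auto
              ultimately have "v a + Re (quad_poly l m h) - 2 * c' * (h \<bullet> (a - z)) \<le> r (\<phi> w) - c' * (norm (\<phi> w - z))\<^sup>2"
                unfolding va(1) by linarith
              also have "\<dots> \<le> v (\<phi> w)" by (simp add: v_def)
              finally show ?thesis
                by (simp add: F_def U_eq Re_herm flip: h_def)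
            qed
          qed
        qed
      qed
    qed
    then have "v z + c' * \<rho>\<^sup>2 * (norm b)\<^sup>2 \<le> 0"
      by (simp add: U_def G0 z_def flip: of_real_power)
    with vz show ?thesis by linarith
  qed
  have lim: "((\<lambda>\<rho>. c' * \<rho>\<^sup>2 * (norm b)\<^sup>2) \<longlongrightarrow> c' * 1\<^sup>2 * (norm b)\<^sup>2) (at_left 1)"
    by (intro tendsto_intros)
  have ev: "\<forall>\<^sub>F \<rho> in at_left 1. c' * \<rho>\<^sup>2 * (norm b)\<^sup>2 \<le> - r z"
    using eventually_at_left_real[of 0 1] by (auto elim!: eventually_mono intro!: main)
  have "c' * 1\<^sup>2 * (norm b)\<^sup>2 \<le> - r z"
    by (rule tendsto_upperbound[OF lim ev]) auto
  then show ?thesis by (simp add: b_def z_def)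
qed

lemma one_minus_ge_exp:
  fixes t :: real
  assumes "0 \<le> t" "t \<le> 1/2"
  shows "exp (- (2 * t)) \<le> 1 - t"
proof -
  have "1 \<le> (1 - t) * (1 + 2 * t)" using assms by (simp add: algebra_simps mult_left_le)
  also have "\<dots> \<le> (1 - t) * exp (2 * t)" using assms by (intro mult_left_mono exp_ge_add_one_self) auto
  finally show ?thesis by (simp add: exp_minus field_simps)
qed

text \<open>
  \<open>Q \<mapsto> Q/(2s - Q)\<close> maps the half-plane \<open>Re Q < s\<close> onto the unit disc and fixes \<open>0\<close>. At distance at
  least \<open>\<mu>\<close> from the boundary of the half-plane, one minus the squared modulus of the image is at most
  \<open>4s/\<mu>\<close>.
\<close>
lemma cayley_bounds:
  fixes Q :: complex and s \<mu> :: real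
  assumes s: "0 < s" and Q: "Re Q \<le> s"
  shows "2 * of_real s - Q \<noteq> 0" "norm (Q / (2 * of_real s - Q)) \<le> 1"
    and "\<mu> > 0 \<Longrightarrow> \<mu> \<le> s - Re Q \<Longrightarrow> 8 * s \<le> \<mu> \<Longrightarrow> exp (- (4 * s / \<mu>)) \<le> norm (Q / (2 * of_real s - Q))"
proof -
  define N where "N = (norm (2 * of_real s - Q))\<^sup>2"
  have N: "N = (2 * s - Re Q)\<^sup>2 + (Im Q)\<^sup>2" by (simp add: N_def cmod_power2)
  have NQ: "N - (norm Q)\<^sup>2 = 4 * s * (s - Re Q)" unfolding N by (simp add: cmod_power2) algebra
  show ne: "2 * of_real s - Q \<noteq> 0" using s Q by (auto simp: complex_eq_iff)
  then have Npos: "N > 0" by (simp add: N_def)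
  have quot: "(norm (Q / (2 * of_real s - Q)))\<^sup>2 = (norm Q)\<^sup>2 / N" by (simp add: norm_divide power_divide N_def)
  have "(norm Q)\<^sup>2 \<le> N" using NQ s Q mult_nonneg_nonneg[of "4 * s" "s - Re Q"] by linarith
  then have "(norm (Q / (2 * of_real s - Q)))\<^sup>2 \<le> 1\<^sup>2" using Npos by (simp add: quot)
  then show "norm (Q / (2 * of_real s - Q)) \<le> 1" by (rule power2_le_imp_le) simp
  assume \<mu>: "\<mu> > 0" "\<mu> \<le> s - Re Q" "8 * s \<le> \<mu>"
  have "\<mu> * (s - Re Q) \<le> (s - Re Q) * (s - Re Q)" using \<mu> by (intro mult_right_mono) auto
  also have "\<dots> \<le> (2 * s - Re Q)\<^sup>2" unfolding power2_eq_square using \<mu> s by (intro mult_mono) auto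
  also have "\<dots> \<le> N" by (simp add: N)
  finally have "4 * s / \<mu> * (\<mu> * (s - Re Q)) \<le> 4 * s / \<mu> * N" using s \<mu> by (intro mult_left_mono) auto
  then have "N - (norm Q)\<^sup>2 \<le> 4 * s / \<mu> * N" using NQ \<mu>(1) by simp
  then have "1 - 4 * s / \<mu> \<le> (norm Q)\<^sup>2 / N" using Npos by (simp add: field_simps)
  moreover have "exp (- (2 * (4 * s / \<mu>))) \<le> 1 - 4 * s / \<mu>"
    using s \<mu> by (intro one_minus_ge_exp) (auto simp: field_simps)
  ultimately have "(exp (- (4 * s / \<mu>)))\<^sup>2 \<le> (norm (Q / (2 * of_real s - Q)))\<^sup>2"
    unfolding quot by (simp flip: exp_double)
  then show "exp (- (4 * s / \<mu>)) \<le> norm (Q / (2 * of_real s - Q))"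
    by (rule power2_le_imp_le) simp
qed

text \<open>
  The Levi polynomial \<open>Q\<close> at \<open>z = \<phi> 0\<close> satisfies \<open>Re Q < s - c\<bar>w - z\<bar>\<^sup>2\<close> in \<open>X\<close> near \<open>z\<close>. So its Cayley
  transform \<open>\<psi>\<close> takes values in the unit disc there, and away from \<open>z\<close> its modulus is at least
  \<open>exp(-O(s))\<close>. Hence \<open>log \<bar>\<psi>\<bar>\<close> can be glued to \<open>K s (\<bar>w - z\<bar>\<^sup>2 - const)\<close>, and the logarithm of the
  resulting function \<open>S\<close> is plurisubharmonic on \<open>X\<close>, at most of order \<open>s\<close>, and equal to \<open>log \<bar>\<psi>\<bar>\<close>
  near \<open>z\<close>. The maximum principle for \<open>S \<circ> \<phi>\<close>, divided by the modulus of the coordinate, is the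
  Schwarz lemma for \<open>\<psi> \<circ> \<phi>\<close> up to a factor \<open>exp(O(s))\<close>.

  The polynomial is based at the interior point \<open>z\<close> instead of a nearest boundary point, so that its
  derivative at \<open>z\<close> and the value \<open>r z\<close> enter without error terms.
\<close>
lemma disc_deriv_sharp_bound:
  assumes psc: "strictly_psh_collar X r r' R \<epsilon> \<tau> c" and pos: "\<epsilon> > 0" "\<tau> > 0" "c > 0"
    and \<mu>: "\<mu> = c * \<tau>\<^sup>2 / 16" and K: "K = 13 / (\<mu> * \<tau>\<^sup>2)"
    and disc: "holomorphic_disc X \<phi>"
    and small: "- r (\<phi> 0) < \<epsilon>" "8 * (- r (\<phi> 0)) \<le> \<mu>"
  shows "\<bar>r' (\<phi> 0) (deriv_vec \<phi>)\<bar> \<le> 2 * (- r (\<phi> 0)) * exp (K * R\<^sup>2 * (- r (\<phi> 0)))"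
proof -
  define z where "z = \<phi> 0"
  define s where "s = - r z"
  have diam: "\<And>x y. x \<in> X \<Longrightarrow> y \<in> X \<Longrightarrow> norm (x - y) \<le> R"
    and neg: "\<And>x. x \<in> X \<Longrightarrow> r x < 0"
    using psc unfolding strictly_psh_collar_def by blast+
  have inX: "\<phi> \<zeta> \<in> X" if "\<zeta> \<in> ball 0 1" for \<zeta> using disc that by (auto simp: holomorphic_disc_def)
  have contphi: "continuous_on (ball 0 1) \<phi>" using holomorphic_disc_continuous[OF disc] .
  have zX: "z \<in> X" using inX[of 0] by (simp add: z_def)
  have s: "s > 0" "s < \<epsilon>" "8 * s \<le> \<mu>" using neg[OF zX] small by (auto simp: s_def z_def)
  have \<mu>0: "\<mu> > 0" and K0: "K > 0" using pos by (auto simp: \<mu> K)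
  have "r z > -\<epsilon>" using s by (simp add: s_def)
  with psc zX obtain l m where l: "\<And>h. Re (\<Sum>i\<in>UNIV. l $ i * h $ i) = r' z h"
    and lm: "\<And>h. norm h < \<tau> \<Longrightarrow> z + h \<in> X \<Longrightarrow> r (z + h) \<ge> r z + Re (quad_poly l m h) + c * (norm h)\<^sup>2"
    unfolding strictly_psh_collar_def by metis
  define Q where "Q = (\<lambda>w. quad_poly l m (w - z))"
  define \<psi> where "\<psi> = (\<lambda>w. Q w / (2 * of_real s - Q w))"
  \<comment> \<open>The weight is nonnegative for \<open>\<bar>w - z\<bar> \<ge> 3\<tau>/4\<close>, where it has to win, and by the choice of \<open>K\<close>
      it is at most \<open>-4s/\<mu>\<close> for \<open>\<bar>w - z\<bar> \<le> \<tau>/2\<close>, where it has to lose.\<close>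
  define E where "E = (\<lambda>w. K * s * ((norm (w - z))\<^sup>2 - 9 * \<tau>\<^sup>2 / 16))"
  have ReQ: "c * (norm (w - z))\<^sup>2 \<le> s - Re (Q w)" if "w \<in> X" "norm (w - z) < \<tau>" for w
    using lm[of "w - z"] that neg[of w] by (simp add: s_def Q_def)
  have ReQ': "Re (Q w) \<le> s" if "w \<in> X" "norm (w - z) < \<tau>" for w
    using ReQ[OF that] pos(3) zero_le_power2[of "norm (w - z)"]
    by (meson diff_ge_0_iff_ge mult_nonneg_nonneg order.strict_implies_order order_trans)
  have den: "2 * of_real s - Q w \<noteq> 0" and chi1: "norm (\<psi> w) \<le> 1"
    if "w \<in> X" "norm (w - z) < \<tau>" for w
    using cayley_bounds(1,2)[OF s(1) ReQ'[OF that]] by (auto simp: \<psi>_def)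
  have chi_lower: "exp (E w) \<le> norm (\<psi> w)" if w: "w \<in> X" "\<tau> / 4 \<le> norm (w - z)" "norm (w - z) \<le> \<tau> / 2" for w
  proof -
    have wt: "norm (w - z) < \<tau>" using w pos by linarith
    have "(\<tau> / 4)\<^sup>2 \<le> (norm (w - z))\<^sup>2" using w pos by (intro power_mono) auto
    then have "\<mu> \<le> c * (norm (w - z))\<^sup>2" using pos by (simp add: \<mu> power_divide)
    then have "\<mu> \<le> s - Re (Q w)" using ReQ[OF w(1) wt] by linarith
    from cayley_bounds(3)[OF s(1) ReQ'[OF w(1) wt] \<mu>0 this s(3)]
    have 1: "exp (- (4 * s / \<mu>)) \<le> norm (\<psi> w)" by (simp add: \<psi>_def)
    have "(norm (w - z))\<^sup>2 \<le> (\<tau> / 2)\<^sup>2" using w by (intro power_mono) auto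
    then have "(norm (w - z))\<^sup>2 - 9 * \<tau>\<^sup>2 / 16 \<le> - (5 * \<tau>\<^sup>2 / 16)" by (simp add: power_divide)
    then have "E w \<le> K * s * (- (5 * \<tau>\<^sup>2 / 16))" unfolding E_def using K0 s by (intro mult_left_mono) auto
    also have "\<dots> = - (65 / 16 * s / \<mu>)" using pos \<mu>0 by (simp add: K)
    also have "\<dots> \<le> - (4 * s / \<mu>)" using s \<mu>0 by (simp add: field_simps)
    finally show ?thesis using 1 by (meson exp_le_cancel_iff order_trans)
  qed
  have E_ge: "1 \<le> exp (E w)" if "3 * \<tau> / 4 \<le> norm (w - z)" for w
  proof -
    have "(3 * \<tau> / 4)\<^sup>2 \<le> (norm (w - z))\<^sup>2" using that pos by (intro power_mono) auto
    then have "0 \<le> (norm (w - z))\<^sup>2 - 9 * \<tau>\<^sup>2 / 16" by (simp add: power_divide power_mult_distrib)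
    then have "0 \<le> E w" unfolding E_def using K0 s by (intro mult_nonneg_nonneg) auto
    then show ?thesis by simp
  qed
  have E_le: "exp (E w) \<le> exp (K * R\<^sup>2 * s)" if "w \<in> X" for w
  proof -
    have "(norm (w - z))\<^sup>2 \<le> R\<^sup>2" using diam[OF that zX] by (intro power_mono) auto
    then have "(norm (w - z))\<^sup>2 - 9 * \<tau>\<^sup>2 / 16 \<le> R\<^sup>2"
      using zero_le_power2[of \<tau>] by linarith
    then have "E w \<le> K * s * R\<^sup>2" unfolding E_def using K0 s by (intro mult_left_mono) auto
    then show ?thesis by (simp add: mult_ac)
  qed
  define S where "S = (\<lambda>w. if norm (w - z) < \<tau> / 2 then norm (\<psi> w)
      else if norm (w - z) < \<tau> then max (norm (\<psi> w)) (exp (E w)) else exp (E w))"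
  have S1: "exp (E w) \<le> S w" if "w \<in> X" "\<tau> / 4 \<le> norm (w - z)" for w
    using chi_lower[OF that] by (auto simp: S_def)
  have S2: "norm (\<psi> w) \<le> S w" if "w \<in> X" "norm (w - z) < \<tau>" for w
    using that by (auto simp: S_def)
  have S3: "S w = norm (\<psi> w) \<and> norm (w - z) < \<tau> \<or> S w = exp (E w) \<and> norm (w - z) \<ge> \<tau> / 2" for w
    using pos by (auto simp: S_def max_def)
  have S4: "S w \<le> exp (K * R\<^sup>2 * s)" if "w \<in> X" for w
  proof -
    have "1 \<le> exp (K * R\<^sup>2 * s)" using K0 s by simp
    with S3[of w] chi1[OF that] E_le[OF that] show ?thesis by linarith
  qed
  define A where "A = (\<lambda>V. {\<zeta> \<in> ball 0 1. \<phi> \<zeta> \<in> V})"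
  have openA: "open (A V)" if "open V" for V
    unfolding A_def by (rule open_disc_preimage[OF disc that])
  have subA: "A V \<subseteq> ball 0 1" for V by (auto simp: A_def)
  have holQ: "(\<lambda>\<zeta>. Q (\<phi> \<zeta>)) holomorphic_on T" if "T \<subseteq> ball 0 1" for T
    unfolding Q_def by (rule holomorphic_disc_quad_poly[OF disc that])
  have holchi: "(\<lambda>\<zeta>. \<psi> (\<phi> \<zeta>)) holomorphic_on T" if "T \<subseteq> A (ball z \<tau>)" for T
    unfolding \<psi>_def
  proof (intro holomorphic_intros holQ)
    show "T \<subseteq> ball 0 1" "T \<subseteq> ball 0 1" using that subA by blast+
    show "2 * of_real s - Q (\<phi> \<zeta>) \<noteq> 0" if "\<zeta> \<in> T" for \<zeta>
      using den[of "\<phi> \<zeta>"] inX[of \<zeta>] that \<open>T \<subseteq> A (ball z \<tau>)\<close>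
      by (auto simp: A_def dist_norm norm_minus_commute)
  qed
  \<comment> \<open>The quotient of \<open>\<psi> \<circ> \<phi>\<close> by the coordinate near the origin.\<close>
  have "0 \<in> A (ball z (\<tau> / 2))" using pos by (simp add: A_def z_def)
  with openA[OF open_ball] obtain \<delta> where \<delta>: "\<delta> > 0" "ball 0 \<delta> \<subseteq> A (ball z (\<tau> / 2))"
    using openE by blast
  have near: "norm (\<phi> \<zeta> - z) < \<tau> / 2" if "\<zeta> \<in> ball 0 \<delta>" for \<zeta>
    using that \<delta> by (auto simp: A_def dist_norm norm_minus_commute)
  have "ball 0 \<delta> \<subseteq> A (ball z \<tau>)" using \<delta>(2) pos by (auto simp: A_def)
  then have "(\<lambda>\<zeta>. \<psi> (\<phi> \<zeta>)) holomorphic_on ball 0 \<delta>" by (rule holchi)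
  moreover have "\<psi> (\<phi> 0) = 0" by (simp add: \<psi>_def Q_def z_def)
  ultimately obtain \<kappa> where \<kappa>: "\<kappa> holomorphic_on ball 0 \<delta>"
    "\<And>\<zeta>. norm \<zeta> < \<delta> \<Longrightarrow> \<psi> (\<phi> \<zeta>) = \<zeta> * \<kappa> \<zeta>" "deriv (\<lambda>\<zeta>. \<psi> (\<phi> \<zeta>)) 0 = \<kappa> 0"
    using Schwarz3[of "\<lambda>\<zeta>. \<psi> (\<phi> \<zeta>)" \<delta>] by metis
  define q where "q = (\<Sum>i\<in>UNIV. l $ i * deriv_vec \<phi> $ i)"
  have kappa0: "\<kappa> 0 = q / (2 * of_real s)"
  proof -
    have dQ: "((\<lambda>\<zeta>. Q (\<phi> \<zeta>)) has_field_derivative q) (at 0)"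
      unfolding Q_def z_def q_def by (rule deriv_quad_poly_disc[OF disc])
    have Q0: "Q (\<phi> 0) = 0" by (simp add: Q_def z_def)
    have "((\<lambda>\<zeta>. \<psi> (\<phi> \<zeta>)) has_field_derivative q / (2 * of_real s)) (at 0)"
      unfolding \<psi>_def using s(1)
      by (auto intro!: derivative_eq_intros dQ simp: Q0 divide_simps)
    then show ?thesis using DERIV_imp_deriv \<kappa>(3) by metis
  qed
  define U where "U = (\<lambda>\<zeta>. if \<zeta> = 0 then norm (\<kappa> 0) else S (\<phi> \<zeta>) / norm \<zeta>)"
  have U_near: "U \<zeta> = norm (\<kappa> \<zeta>)" if "\<zeta> \<in> ball 0 \<delta>" for \<zeta>
    using \<kappa>(2)[of \<zeta>] near[OF that] that by (auto simp: U_def S_def norm_mult)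
  have contS: "continuous_on (ball 0 1) (\<lambda>\<zeta>. S (\<phi> \<zeta>))"
  proof -
    define V1 where "V1 = A (ball z (\<tau> / 2))"
    define V2 where "V2 = A (ball z \<tau> \<inter> - cball z (\<tau> / 4))"
    define V3 where "V3 = A (- cball z (3 * \<tau> / 4))"
    have op: "open V1" "open V2" "open V3" unfolding V1_def V2_def V3_def by (auto intro!: openA)
    have cover: "ball 0 1 = V1 \<union> V2 \<union> V3"
      using pos by (auto simp: V1_def V2_def V3_def A_def)
    have cchi: "continuous_on T (\<lambda>\<zeta>. norm (\<psi> (\<phi> \<zeta>)))" if "T \<subseteq> A (ball z \<tau>)" for T
      using holomorphic_on_imp_continuous_on[OF holchi[OF that]] by (rule continuous_on_norm)
    have cE: "continuous_on T (\<lambda>\<zeta>. exp (E (\<phi> \<zeta>)))" if "T \<subseteq> ball 0 1" for T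
      unfolding E_def by (intro continuous_intros continuous_on_subset[OF contphi that])
    have "continuous_on V1 (\<lambda>\<zeta>. S (\<phi> \<zeta>))"
    proof -
      have "V1 \<subseteq> A (ball z \<tau>)" using pos by (auto simp: V1_def A_def)
      moreover have "S (\<phi> \<zeta>) = norm (\<psi> (\<phi> \<zeta>))" if "\<zeta> \<in> V1" for \<zeta>
        using that by (auto simp: V1_def A_def S_def dist_norm norm_minus_commute)
      ultimately show ?thesis using cchi continuous_on_cong by (metis (mono_tags, lifting))
    qed
    moreover have "continuous_on V2 (\<lambda>\<zeta>. S (\<phi> \<zeta>))"
    proof -
      have "continuous_on V2 (\<lambda>\<zeta>. max (norm (\<psi> (\<phi> \<zeta>))) (exp (E (\<phi> \<zeta>))))"
        by (intro continuous_on_max cchi cE) (auto simp: V2_def A_def)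
      moreover have "S (\<phi> \<zeta>) = max (norm (\<psi> (\<phi> \<zeta>))) (exp (E (\<phi> \<zeta>)))" if "\<zeta> \<in> V2" for \<zeta>
        using that chi_lower[of "\<phi> \<zeta>"] inX[of \<zeta>]
        by (auto simp: V2_def A_def S_def dist_norm norm_minus_commute max_def)
      ultimately show ?thesis using continuous_on_cong by (metis (mono_tags, lifting))
    qed
    moreover have "continuous_on V3 (\<lambda>\<zeta>. S (\<phi> \<zeta>))"
    proof -
      have "continuous_on V3 (\<lambda>\<zeta>. exp (E (\<phi> \<zeta>)))" by (intro cE) (auto simp: V3_def A_def)
      moreover have "S (\<phi> \<zeta>) = exp (E (\<phi> \<zeta>))" if "\<zeta> \<in> V3" for \<zeta>
      proof -
        have 1: "\<phi> \<zeta> \<in> X" "3 * \<tau> / 4 < norm (\<phi> \<zeta> - z)" 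
          using that inX[of \<zeta>] by (auto simp: V3_def A_def dist_norm norm_minus_commute)
        have "norm (\<psi> (\<phi> \<zeta>)) \<le> exp (E (\<phi> \<zeta>))" if "norm (\<phi> \<zeta> - z) < \<tau>"
          using order_trans[OF chi1[OF 1(1) that] E_ge] 1(2) by simp
        then show ?thesis using 1 pos by (auto simp: S_def max_def)
      qed
      ultimately show ?thesis using continuous_on_cong by (metis (mono_tags, lifting))
    qed
    ultimately show ?thesis unfolding cover using op
      by (intro continuous_on_open_Un) auto
  qed
  have contU: "continuous_on (ball 0 1) U"
  proof -
    have "continuous_on (ball 0 1 - {0}) U"
    proof -
      have "continuous_on (ball 0 1 - {0}) (\<lambda>\<zeta>. S (\<phi> \<zeta>) / norm \<zeta>)"
        by (intro continuous_intros continuous_on_subset[OF contS]) auto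
      then show ?thesis by (rule continuous_on_eq) (auto simp: U_def)
    qed
    moreover have "continuous_on (ball 0 \<delta>) U"
      using continuous_on_norm[OF holomorphic_on_imp_continuous_on[OF \<kappa>(1)]]
      by (rule continuous_on_eq) (simp add: U_near)
    ultimately have "continuous_on ((ball 0 1 - {0}) \<union> ball 0 \<delta>) U"
      by (intro continuous_on_open_Un) auto
    moreover have "(ball 0 1 - {0}) \<union> ball 0 \<delta> = ball (0::complex) 1"
      using \<delta> subA by (fastforce simp: A_def)
    ultimately show ?thesis by simp
  qed
  have suppU: "holomorphically_supported U \<zeta>" if \<zeta>: "\<zeta> \<in> ball 0 1" for \<zeta>
  proof (cases "\<zeta> = 0")
    case True
    show ?thesis
      by (rule holomorphically_supportedI[of "ball 0 \<delta>" _ \<kappa>]) (use True \<delta> \<kappa> U_near in auto)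
  next
    case False
    define a where "a = \<phi> \<zeta>"
    have aX: "a \<in> X" using inX[OF \<zeta>] by (simp add: a_def)
    show ?thesis using S3[of a]
    proof (elim disjE conjE)
      assume a: "S a = norm (\<psi> a)" "norm (a - z) < \<tau>"
      show ?thesis
      proof (rule holomorphically_supportedI[of "A (ball z \<tau>) - {0}" _ "\<lambda>w. \<psi> (\<phi> w) / w"])
        show "open (A (ball z \<tau>) - {0})" by (intro open_delete openA) auto
        show "\<zeta> \<in> A (ball z \<tau>) - {0}"
          using False \<zeta> a by (auto simp: A_def a_def dist_norm norm_minus_commute)
        show "(\<lambda>w. \<psi> (\<phi> w) / w) holomorphic_on A (ball z \<tau>) - {0}"
          by (intro holomorphic_intros holchi) auto
        show "norm (\<psi> (\<phi> \<zeta>) / \<zeta>) = U \<zeta>" using a False by (simp add: U_def norm_divide a_def)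
        show "norm (\<psi> (\<phi> w) / w) \<le> U w" if "w \<in> A (ball z \<tau>) - {0}" for w
          using that S2[OF inX[of w]]
          by (auto simp: U_def A_def norm_divide divide_right_mono dist_norm norm_minus_commute)
      qed
    next
      assume a: "S a = exp (E a)" "\<tau> / 2 \<le> norm (a - z)"
      define F where "F = (\<lambda>w. exp (of_real (E a) + of_real (2 * K * s) * herm (\<phi> w - a) (a - z)) / w)"
      have nF: "norm (F w) = exp (E a + 2 * K * s * ((\<phi> w - a) \<bullet> (a - z))) / norm w" for w
        by (simp add: F_def norm_divide Re_herm)
      show ?thesis
      proof (rule holomorphically_supportedI[of "A (- cball z (\<tau> / 4)) - {0}" _ F])
        show "open (A (- cball z (\<tau> / 4)) - {0})" by (intro open_delete openA) auto
        show "\<zeta> \<in> A (- cball z (\<tau> / 4)) - {0}"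
          using False \<zeta> a pos by (auto simp: A_def a_def dist_norm norm_minus_commute)
        show "F holomorphic_on A (- cball z (\<tau> / 4)) - {0}"
          unfolding F_def using subA
          by (intro holomorphic_intros holomorphic_disc_herm[OF disc]) auto
        show "norm (F \<zeta>) = U \<zeta>" using a False by (simp add: U_def nF a_def)
        show "norm (F w) \<le> U w" if w: "w \<in> A (- cball z (\<tau> / 4)) - {0}" for w
        proof -
          define h where "h = \<phi> w - a"
          have w': "\<phi> w \<in> X" "\<tau> / 4 \<le> norm (\<phi> w - z)" "w \<noteq> 0"
            using w inX[of w] by (auto simp: A_def dist_norm norm_minus_commute)
          have eq: "(norm (\<phi> w - z))\<^sup>2 = (norm (a - z))\<^sup>2 + 2 * (h \<bullet> (a - z)) + (norm h)\<^sup>2"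
            using norm_add_sq[of "a - z" h] by (simp add: h_def)
          have "E (\<phi> w) = E a + 2 * K * s * (h \<bullet> (a - z)) + K * s * (norm h)\<^sup>2"
            unfolding E_def eq by algebra
          then have "E a + 2 * K * s * (h \<bullet> (a - z)) \<le> E (\<phi> w)" using K0 s by simp
          then have "exp (E a + 2 * K * s * (h \<bullet> (a - z))) \<le> S (\<phi> w)"
            using S1[OF w'(1,2)] by (meson exp_le_cancel_iff order_trans)
          then show ?thesis using w'(3) by (simp add: nF U_def divide_right_mono flip: h_def)
        qed
      qed
    qed
  qed
  have main: "norm (\<kappa> 0) * \<rho> \<le> exp (K * R\<^sup>2 * s)" if \<rho>: "0 < \<rho>" "\<rho> < 1" for \<rho>
  proof -
    have sub: "cball 0 \<rho> \<subseteq> ball (0::complex) 1" using \<rho> by auto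
    have "U 0 \<le> exp (K * R\<^sup>2 * s) / \<rho>"
    proof (rule maximum_principle[OF continuous_on_subset[OF contU sub] \<rho>(1)])
      show "holomorphically_supported U \<zeta>" if "\<zeta> \<in> ball 0 \<rho>" for \<zeta> using that \<rho> by (intro suppU) auto
      show "U \<zeta> \<le> exp (K * R\<^sup>2 * s) / \<rho>" if "norm \<zeta> = \<rho>" for \<zeta>
        using that \<rho> S4[OF inX[of \<zeta>]] by (auto simp: U_def intro!: divide_right_mono)
    qed
    then show ?thesis using \<rho> by (simp add: U_def field_simps)
  qed
  have lim: "((\<lambda>\<rho>. norm (\<kappa> 0) * \<rho>) \<longlongrightarrow> norm (\<kappa> 0) * 1) (at_left 1)"
    by (intro tendsto_intros)
  have ev: "\<forall>\<^sub>F \<rho> in at_left 1. norm (\<kappa> 0) * \<rho> \<le> exp (K * R\<^sup>2 * s)"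
    using eventually_at_left_real[of 0 1] by (auto elim!: eventually_mono intro!: main)
  have "norm (\<kappa> 0) \<le> exp (K * R\<^sup>2 * s)"
    using tendsto_upperbound[OF lim ev] by simp
  then have "norm q \<le> 2 * s * exp (K * R\<^sup>2 * s)"
    using s(1) by (simp add: kappa0 norm_divide field_simps norm_mult)
  moreover have "\<bar>r' z (deriv_vec \<phi>)\<bar> \<le> norm q"
    unfolding l[symmetric] q_def by (rule abs_Re_le_cmod)
  ultimately show ?thesis by (simp add: s_def z_def)
qed

section \<open>Elementary bounds for the Kobayashi metric\<close>

lemma kobayashi_metric_le:
  assumes "holomorphic_disc X \<phi>" "\<phi> 0 = z" "deriv_vec \<phi> = \<alpha> *\<^sub>R \<xi>" "\<alpha> > 0"
  shows "kobayashi_metric X z \<xi> \<le> 1 / \<alpha>"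
  unfolding kobayashi_metric_def
proof (rule cInf_lower)
  show "bdd_below {1 / \<alpha> |\<alpha> \<phi>. \<alpha> > 0 \<and> holomorphic_disc X \<phi> \<and> \<phi> 0 = z \<and>
      (\<chi> i. deriv (\<lambda>t. \<phi> t $ i) 0) = \<alpha> *\<^sub>R \<xi>}"
    by (rule bdd_belowI[of _ 0]) auto
qed (use assms in \<open>auto simp: deriv_vec_def\<close>)

lemma affine_disc:
  assumes "ball z d \<subseteq> X" "norm u \<le> d" "d > 0"
  shows "holomorphic_disc X (\<lambda>\<zeta>. z + \<zeta> *s u)" "deriv_vec (\<lambda>\<zeta>. z + \<zeta> *s u) = u"
proof -
  have "z + \<zeta> *s u \<in> ball z d" if "norm \<zeta> < 1" for \<zeta>
  proof -
    have "norm \<zeta> * norm u \<le> norm \<zeta> * d" using assms by (intro mult_left_mono) auto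
    also have "\<dots> < 1 * d" using that assms by (intro mult_strict_right_mono) auto
    finally show ?thesis by (simp add: dist_norm norm_smult)
  qed
  with assms show "holomorphic_disc X (\<lambda>\<zeta>. z + \<zeta> *s u)"
    by (auto simp: holomorphic_disc_def intro!: holomorphic_intros)
  have "deriv (\<lambda>t. (z + t *s u) $ i) 0 = u $ i" for i
    by (rule DERIV_imp_deriv) (auto intro!: derivative_eq_intros)
  then show "deriv_vec (\<lambda>\<zeta>. z + \<zeta> *s u) = u"
    by (simp add: deriv_vec_def vec_eq_iff)
qed

lemma kobayashi_metric_ge:
  assumes "open X" "z \<in> X"
    and "\<And>\<phi> \<alpha>. holomorphic_disc X \<phi> \<Longrightarrow> \<phi> 0 = z \<Longrightarrow> deriv_vec \<phi> = \<alpha> *\<^sub>R \<xi> \<Longrightarrow> \<alpha> > 0 \<Longrightarrow> m \<le> 1 / \<alpha>"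
  shows "m \<le> kobayashi_metric X z \<xi>"
  unfolding kobayashi_metric_def
proof (rule cInf_greatest)
  obtain d where d: "d > 0" "ball z d \<subseteq> X" using assms(1,2) openE by blast
  define \<alpha> where "\<alpha> = d / (norm \<xi> + 1)"
  have \<alpha>: "\<alpha> > 0" using d by (simp add: \<alpha>_def add_nonneg_pos)
  have "d * norm \<xi> \<le> d * (norm \<xi> + 1)" using d by simp
  then have "norm (\<alpha> *\<^sub>R \<xi>) \<le> d"
    using d by (simp add: \<alpha>_def pos_divide_le_eq add_nonneg_pos)
  from affine_disc[OF d(2) this d(1)] \<alpha>
  have "1 / \<alpha> \<in> {1 / \<alpha> |\<alpha> \<phi>. \<alpha> > 0 \<and> holomorphic_disc X \<phi> \<and> \<phi> 0 = z \<and> deriv_vec \<phi> = \<alpha> *\<^sub>R \<xi>}"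
    by (auto intro!: exI[of _ \<alpha>] exI[of _ "\<lambda>\<zeta>. z + \<zeta> *s (\<alpha> *\<^sub>R \<xi>)"])
  then show "{1 / \<alpha> |\<alpha> \<phi>. \<alpha> > 0 \<and> holomorphic_disc X \<phi> \<and> \<phi> 0 = z \<and>
      (\<chi> i. deriv (\<lambda>t. \<phi> t $ i) 0) = \<alpha> *\<^sub>R \<xi>} \<noteq> {}"
    unfolding deriv_vec_def by blast
qed (use assms in \<open>auto simp: deriv_vec_def\<close>)

lemma kobayashi_metric_nonneg:
  assumes "open X" "z \<in> X"
  shows "0 \<le> kobayashi_metric X z \<xi>"
  by (rule kobayashi_metric_ge[OF assms]) auto

text \<open>
  For \<open>\<xi> = 0\<close> the constant disc competes with every \<open>\<alpha>\<close>, so the infimum is \<open>0\<close>.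
\<close>
lemma kobayashi_metric_le_ball:
  assumes "ball z d \<subseteq> X" "d > 0"
  shows "kobayashi_metric X z \<xi> \<le> norm \<xi> / d"
proof -
  have *: "kobayashi_metric X z \<xi> \<le> 1 / \<alpha>" if "\<alpha> > 0" "\<alpha> * norm \<xi> \<le> d" for \<alpha>
  proof (rule kobayashi_metric_le)
    have "norm (\<alpha> *\<^sub>R \<xi>) \<le> d" using that by simp
    from affine_disc[OF assms(1) this assms(2)]
    show "holomorphic_disc X (\<lambda>\<zeta>. z + \<zeta> *s (\<alpha> *\<^sub>R \<xi>))" "deriv_vec (\<lambda>\<zeta>. z + \<zeta> *s (\<alpha> *\<^sub>R \<xi>)) = \<alpha> *\<^sub>R \<xi>" by auto
  qed (use that in auto)
  show ?thesis
  proof (cases "\<xi> = 0")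
    case True
    show ?thesis
    proof (rule field_le_epsilon)
      fix e :: real assume "e > 0"
      then show "kobayashi_metric X z \<xi> \<le> norm \<xi> / d + e"
        using *[of "1 / e"] True assms(2) by simp
    qed
  next
    case False
    then show ?thesis using *[of "d / norm \<xi>"] assms(2) by simp
  qed
qed

section \<open>Quantitative \<open>C\<^sup>2\<close> domains\<close>

abbreviation deriv1 :: "(complex ^ 'n \<Rightarrow> real) \<Rightarrow> complex ^ 'n \<Rightarrow> complex ^ 'n \<Rightarrow> real" where
  "deriv1 \<rho> z h \<equiv> blinfun_apply (total_deriv \<rho> z) h"

text \<open>
  The first vector is the direction in which the first derivative is differentiated.
\<close>
abbreviation deriv2 :: "(complex ^ 'n \<Rightarrow> real) \<Rightarrow> complex ^ 'n \<Rightarrow> complex ^ 'n \<Rightarrow> complex ^ 'n \<Rightarrow> real" where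
  "deriv2 \<rho> z h k \<equiv> blinfun_apply (blinfun_apply (total_deriv (total_deriv \<rho>) z) h) k"

text \<open>
  All constants are parameters and the ambient set \<open>W\<close> is fixed, so that one choice of them can serve
  a whole sequence of domains together with its limit.
\<close>
definition C2_domain ::
  "(complex ^ 'n) set \<Rightarrow> real \<Rightarrow> real \<Rightarrow> real \<Rightarrow> real \<Rightarrow> (complex ^ 'n) set \<Rightarrow> (complex ^ 'n \<Rightarrow> real) \<Rightarrow> bool" where
  "C2_domain W \<eta> B \<epsilon> g X \<rho> \<longleftrightarrow>
     open W \<and> X = {z \<in> W. \<rho> z < 0} \<and> (\<forall>z\<in>X. ball z \<eta> \<subseteq> W) \<and>
     (\<forall>z\<in>X. \<forall>w\<in>X. norm (z - w) \<le> B) \<and> C2_on W \<rho> \<and>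
     (\<forall>z\<in>W. \<bar>\<rho> z\<bar> \<le> B \<and> norm (total_deriv \<rho> z) \<le> B \<and> norm (total_deriv (total_deriv \<rho>) z) \<le> B) \<and>
     (\<forall>z\<in>X. \<rho> z > -\<epsilon> \<longrightarrow> g \<le> norm (total_deriv \<rho> z))"

text \<open>
  Four times the Levi form, and the Laplacian of \<open>\<rho>\<close> along the complex line through \<open>z\<close> in direction
  \<open>v\<close>.
\<close>
definition levi_real :: "(complex ^ 'n \<Rightarrow> real) \<Rightarrow> complex ^ 'n \<Rightarrow> complex ^ 'n \<Rightarrow> real" where
  "levi_real \<rho> z v = deriv2 \<rho> z v v + deriv2 \<rho> z (\<i> *s v) (\<i> *s v)"

text \<open>
  A quantitative form of the positivity of the Levi form on the complex tangent spaces: a penalty for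
  the complex normal component makes the form positive definite on all vectors, and on the scale \<open>\<tau>\<close>
  the second derivatives vary by less than its lower bound.
\<close>
definition strongly_psc_domain ::
  "(complex ^ 'n) set \<Rightarrow> real \<Rightarrow> real \<Rightarrow> real \<Rightarrow> (complex ^ 'n) set \<Rightarrow> (complex ^ 'n \<Rightarrow> real) \<Rightarrow> real \<Rightarrow> bool" where
  "strongly_psc_domain W A c \<tau> X \<rho> \<epsilon> \<longleftrightarrow>
     (\<forall>z\<in>X. \<rho> z > -\<epsilon> \<longrightarrow>
        (\<forall>v. c * (norm v)\<^sup>2 \<le> levi_real \<rho> z v + A * ((deriv1 \<rho> z v)\<^sup>2 + (deriv1 \<rho> z (\<i> *s v))\<^sup>2))) \<and>
     (\<forall>z\<in>X. \<forall>w\<in>W. norm (z - w) < \<tau> \<longrightarrow>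
        norm (total_deriv (total_deriv \<rho>) z - total_deriv (total_deriv \<rho>) w) \<le> c / 8)"

lemma C2_on_has_derivative:
  assumes "C2_on W \<rho>" "z \<in> W"
  shows "(\<rho> has_derivative deriv1 \<rho> z) (at z)"
    and "((\<lambda>z. deriv1 \<rho> z k) has_derivative (\<lambda>h. deriv2 \<rho> z h k)) (at z)"
proof -
  have d: "\<rho> differentiable (at z)" "total_deriv \<rho> differentiable (at z)"
    using assms by (auto simp: C2_on_def C1_on_def)
  show "(\<rho> has_derivative deriv1 \<rho> z) (at z)" by (rule total_deriv_has_derivative[OF d(1)])
  show "((\<lambda>z. deriv1 \<rho> z k) has_derivative (\<lambda>h. deriv2 \<rho> z h k)) (at z)"
    using blinfun.FDERIV[OF total_deriv_has_derivative[OF d(2)] has_derivative_const[of k]]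
    by (simp add: blinfun.zero_right)
qed

lemma segment_derivs:
  assumes "C2_on W \<rho>" "z + t *\<^sub>R h \<in> W"
  shows "((\<lambda>t. \<rho> (z + t *\<^sub>R h)) has_real_derivative deriv1 \<rho> (z + t *\<^sub>R h) h) (at t)"
    and "((\<lambda>t. deriv1 \<rho> (z + t *\<^sub>R h) h) has_real_derivative deriv2 \<rho> (z + t *\<^sub>R h) h h) (at t)"
proof -
  have l: "((\<lambda>t. z + t *\<^sub>R h) has_derivative (\<lambda>s. s *\<^sub>R h)) (at t)"
    by (auto intro!: derivative_eq_intros)
  show "((\<lambda>t. \<rho> (z + t *\<^sub>R h)) has_real_derivative deriv1 \<rho> (z + t *\<^sub>R h) h) (at t)"
    using has_derivative_compose[OF l C2_on_has_derivative(1)[OF assms]]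
    by (simp add: has_field_derivative_def blinfun.scaleR_right mult_commute_abs)
  show "((\<lambda>t. deriv1 \<rho> (z + t *\<^sub>R h) h) has_real_derivative deriv2 \<rho> (z + t *\<^sub>R h) h h) (at t)"
    using has_derivative_compose[OF l C2_on_has_derivative(2)[OF assms]]
    by (simp add: has_field_derivative_def blinfun.scaleR_right blinfun.scaleR_left mult_commute_abs)
qed

lemma C2_taylor:
  assumes "C2_on W \<rho>" "\<And>t. 0 \<le> t \<Longrightarrow> t \<le> 1 \<Longrightarrow> z + t *\<^sub>R h \<in> W"
  shows "\<exists>\<theta>. 0 < \<theta> \<and> \<theta> < 1 \<and> \<rho> (z + h) = \<rho> z + deriv1 \<rho> z h + deriv2 \<rho> (z + \<theta> *\<^sub>R h) h h / 2"
proof -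
  define diff where "diff = (\<lambda>(n::nat) t. if n = 0 then \<rho> (z + t *\<^sub>R h)
    else if n = 1 then deriv1 \<rho> (z + t *\<^sub>R h) h else deriv2 \<rho> (z + t *\<^sub>R h) h h)"
  have "\<exists>t>0. t < 1 \<and> diff 0 1 = (\<Sum>m<2. diff m 0 / fact m * 1 ^ m) + diff 2 t / fact 2 * 1 ^ 2"
  proof (rule Maclaurin)
    show "\<forall>m t. m < 2 \<and> 0 \<le> t \<and> t \<le> 1 \<longrightarrow> DERIV (diff m) t :> diff (Suc m) t"
      using segment_derivs[OF assms(1)] assms(2)
      by (auto simp: diff_def less_2_cases_iff)
  qed auto
  then show ?thesis by (auto simp: diff_def lessThan_nat_numeral numeral_2_eq_2)
qed

lemma blinfun2_bound: "\<bar>blinfun_apply (blinfun_apply T h) k\<bar> \<le> norm (T :: 'a::real_normed_vector \<Rightarrow>\<^sub>L 'a \<Rightarrow>\<^sub>L real) * norm h * norm k"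
proof -
  have "\<bar>blinfun_apply (blinfun_apply T h) k\<bar> \<le> norm (blinfun_apply T h) * norm k"
    using norm_blinfun[of "blinfun_apply T h" k] by simp
  also have "\<dots> \<le> norm T * norm h * norm k"
    by (intro mult_right_mono norm_blinfun) auto
  finally show ?thesis .
qed

lemma blinfun1_bound: "\<bar>blinfun_apply (T :: 'a::real_normed_vector \<Rightarrow>\<^sub>L real) h\<bar> \<le> norm T * norm h"
  using norm_blinfun[of T h] by simp

context
  fixes W \<eta> B \<epsilon> g X \<rho>
  assumes dom: "C2_domain W \<eta> B \<epsilon> g X \<rho>"
begin

lemma dom_sub: "X \<subseteq> W" and dom_C2: "C2_on W \<rho>"
  and dom_ball: "z \<in> X \<Longrightarrow> ball z \<eta> \<subseteq> W"
  and dom_neg: "z \<in> X \<Longrightarrow> \<rho> z < 0" and dom_in: "z \<in> W \<Longrightarrow> \<rho> z < 0 \<Longrightarrow> z \<in> X"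
  and dom_diam: "z \<in> X \<Longrightarrow> w \<in> X \<Longrightarrow> norm (z - w) \<le> B"
  and dom_abs: "z \<in> W \<Longrightarrow> \<bar>\<rho> z\<bar> \<le> B"
  and dom_D1: "z \<in> W \<Longrightarrow> norm (total_deriv \<rho> z) \<le> B"
  and dom_D2: "z \<in> W \<Longrightarrow> norm (total_deriv (total_deriv \<rho>) z) \<le> B"
  using dom unfolding C2_domain_def by blast+

lemma dom_cont: "continuous_on W \<rho>"
  using dom_C2 C1_on_imp_continuous_on by (auto simp: C2_on_def)

lemma dom_open: "open X"
proof -
  have "open (W \<inter> \<rho> -` {..<0})"
    using dom dom_cont by (intro continuous_open_preimage) (auto simp: C2_domain_def)
  moreover have "X = W \<inter> \<rho> -` {..<0}" using dom by (auto simp: C2_domain_def)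
  ultimately show ?thesis by simp
qed

lemma dom_segment:
  assumes "z \<in> X" "norm h < \<eta>" "0 \<le> t" "t \<le> 1"
  shows "z + t *\<^sub>R h \<in> W"
proof -
  have "norm (t *\<^sub>R h) < \<eta>" using assms mult_left_le_one_le[of "norm h" t] by simp
  then show ?thesis using dom_ball[OF assms(1)] by (auto simp: dist_norm)
qed

lemma dom_taylor:
  assumes "z \<in> X" "norm h < \<eta>"
  obtains \<theta> where "0 < \<theta>" "\<theta> < 1" "\<rho> (z + h) = \<rho> z + deriv1 \<rho> z h + deriv2 \<rho> (z + \<theta> *\<^sub>R h) h h / 2"
    "z + \<theta> *\<^sub>R h \<in> W"
  using C2_taylor[OF dom_C2, of z h] dom_segment[OF assms] by (metis less_eq_real_def)

lemma dom_taylor_bound: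
  assumes "z \<in> X" "norm h < \<eta>"
  shows "\<bar>\<rho> (z + h) - \<rho> z - deriv1 \<rho> z h\<bar> \<le> B / 2 * (norm h)\<^sup>2"
proof -
  obtain \<theta> where \<theta>: "\<rho> (z + h) = \<rho> z + deriv1 \<rho> z h + deriv2 \<rho> (z + \<theta> *\<^sub>R h) h h / 2" "z + \<theta> *\<^sub>R h \<in> W"
    using dom_taylor[OF assms] by metis
  have "\<bar>deriv2 \<rho> (z + \<theta> *\<^sub>R h) h h\<bar> \<le> norm (total_deriv (total_deriv \<rho>) (z + \<theta> *\<^sub>R h)) * norm h * norm h"
    by (rule blinfun2_bound)
  also have "\<dots> \<le> B * norm h * norm h" using dom_D2[OF \<theta>(2)] by (intro mult_right_mono) auto
  finally show ?thesis using \<theta>(1) by (simp add: power2_eq_square abs_le_iff)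
qed

lemma dom_lipschitz:
  assumes "z \<in> X" "norm h < \<eta>"
  shows "\<bar>\<rho> (z + h) - \<rho> z\<bar> \<le> B * norm h"
proof -
  have "\<exists>t>0. t < 1 \<and> \<rho> (z + 1 *\<^sub>R h) - \<rho> (z + 0 *\<^sub>R h) = (1 - 0) * deriv1 \<rho> (z + t *\<^sub>R h) h"
    using segment_derivs(1)[OF dom_C2] dom_segment[OF assms] by (intro MVT2) auto
  then obtain t where t: "0 < t" "t < 1" "\<rho> (z + h) - \<rho> z = deriv1 \<rho> (z + t *\<^sub>R h) h" by auto
  have "norm (total_deriv \<rho> (z + t *\<^sub>R h)) \<le> B" using dom_D1 dom_segment[OF assms] t by auto
  then have "norm (total_deriv \<rho> (z + t *\<^sub>R h)) * norm h \<le> B * norm h" by (intro mult_right_mono) auto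
  with blinfun1_bound[of "total_deriv \<rho> (z + t *\<^sub>R h)" h] show ?thesis unfolding t(3) by linarith
qed

text \<open>
  By the Lipschitz bound for \<open>\<rho>\<close> the ball of radius \<open>-\<rho> z / (B/\<eta> + B)\<close> about \<open>z\<close> lies in \<open>X\<close>; the term
  \<open>B/\<eta>\<close> keeps the radius below \<open>\<eta>\<close>.
\<close>
lemma dom_kobayashi_upper:
  assumes pos: "\<eta> > 0" "B > 0" and z: "z \<in> X"
  shows "kobayashi_metric X z \<xi> \<le> (B / \<eta> + B) * norm \<xi> / (- \<rho> z)"
proof -
  define s where "s = - \<rho> z"
  have s: "0 < s" "s \<le> B" using dom_neg[OF z] dom_abs[of z] dom_sub z by (auto simp: s_def)
  define d where "d = s / (B / \<eta> + B)"
  have k: "B / \<eta> + B > 0" using pos by (simp add: add_pos_pos)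
  have d0: "d > 0" using s k by (simp add: d_def)
  have "d \<le> s / (B / \<eta>)" unfolding d_def using s pos k by (intro divide_left_mono mult_pos_pos) auto
  also have "\<dots> \<le> \<eta>" using s pos by (simp add: field_simps)
  finally have d1: "d \<le> \<eta>" .
  have "d \<le> s / B" unfolding d_def using s pos k by (intro divide_left_mono mult_pos_pos) auto
  then have d2: "B * d \<le> s" using pos by (simp add: field_simps)
  have "ball z d \<subseteq> X"
  proof
    fix w assume "w \<in> ball z d"
    then have w: "norm (w - z) < d" by (simp add: dist_norm norm_minus_commute)
    have 1: "B * norm (w - z) < B * d" using w pos by simp
    have "\<rho> w - \<rho> z \<le> B * norm (w - z)"
      using dom_lipschitz[OF z, of "w - z"] w d1 by simp
    then have "\<rho> w < 0" using 1 d2 by (simp add: s_def)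
    moreover have "w \<in> W" using dom_ball[OF z] w d1 by (auto simp: dist_norm norm_minus_commute)
    ultimately show "w \<in> X" by (rule dom_in[rotated])
  qed
  from kobayashi_metric_le_ball[OF this d0, of \<xi>] show ?thesis
    using s k by (simp add: d_def s_def mult.commute)
qed

end

section \<open>The Levi polynomial\<close>

text \<open>
  \<open>f(h) - \<i> f(\<i>h)\<close> is the complex linear form with real part \<open>f\<close>.
\<close>
lemma real_linear_complexify:
  fixes f :: "(complex ^ 'n) \<Rightarrow> real"
  assumes f: "linear f"
  shows "complex_of_real (f h) - \<i> * complex_of_real (f (\<i> *s h))
     = (\<Sum>i\<in>UNIV. (complex_of_real (f (axis i 1)) - \<i> * complex_of_real (f (axis i \<i>))) * h $ i)"
proof -
  have e: "h = (\<Sum>i\<in>UNIV. Re (h $ i) *\<^sub>R axis i 1 + Im (h $ i) *\<^sub>R axis i \<i>)"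
    by (auto simp: vec_eq_iff axis_def complex_eq_iff if_distrib cong: if_cong)
  have ie: "\<i> *s h = (\<Sum>i\<in>UNIV. Re (h $ i) *\<^sub>R axis i \<i> - Im (h $ i) *\<^sub>R axis i 1)"
    by (auto simp: vec_eq_iff axis_def complex_eq_iff if_distrib cong: if_cong)
  have 1: "f h = (\<Sum>i\<in>UNIV. Re (h $ i) * f (axis i 1) + Im (h $ i) * f (axis i \<i>))"
    by (subst e) (simp add: linear_sum[OF f] linear_add[OF f] linear_scale[OF f])
  have 2: "f (\<i> *s h) = (\<Sum>i\<in>UNIV. Re (h $ i) * f (axis i \<i>) - Im (h $ i) * f (axis i 1))"
    by (subst ie) (simp add: linear_sum[OF f] linear_diff[OF f] linear_scale[OF f])
  show ?thesis
    unfolding 1 2 by (auto simp: complex_eq_iff sum_subtractf sum.distrib sum_negf algebra_simps)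
qed

lemma smult_i_axis: "\<i> *s axis j 1 = axis j \<i>" for j :: "'n::finite"
  by (simp add: vec_eq_iff axis_def)

lemma linear_smult_i: "linear (\<lambda>h :: complex ^ 'n. \<i> *s h)"
  by (rule linearI) (auto simp: vec_eq_iff algebra_simps)

text \<open>
  The complex quadratic form is obtained by complexifying \<open>b\<close> in each variable. It provides the
  quadratic part of the Levi polynomial: \<open>2 b(h,h)\<close> is its real part plus \<open>b(h,h) + b(\<i>h,\<i>h)\<close>, the
  contribution of the Levi form.
\<close>
lemma real_bilinear_complexify:
  fixes b :: "(complex ^ 'n) \<Rightarrow>\<^sub>L (complex ^ 'n) \<Rightarrow>\<^sub>L real"
  obtains m where "\<And>h. Re (\<Sum>i\<in>UNIV. \<Sum>j\<in>UNIV. m i j * h $ i * h $ j) =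
     blinfun_apply (blinfun_apply b h) h - blinfun_apply (blinfun_apply b (\<i> *s h)) (\<i> *s h)"
proof -
  define L where "L = (\<lambda>h k. complex_of_real (blinfun_apply (blinfun_apply b h) k)
      - \<i> * complex_of_real (blinfun_apply (blinfun_apply b h) (\<i> *s k)))"
  have lin1: "linear (blinfun_apply (blinfun_apply b h))" for h
    by (intro bounded_linear.linear blinfun.bounded_linear_right)
  have lin2: "linear (\<lambda>h. blinfun_apply (blinfun_apply b h) k)" for k
    by (rule linearI) (auto simp: blinfun.add_right blinfun.add_left blinfun.scaleR_right blinfun.scaleR_left)
  have Lk: "L h k = (\<Sum>j\<in>UNIV. L h (axis j 1) * k $ j)" for h k
    using real_linear_complexify[OF lin1[of h], of k] by (simp add: L_def smult_i_axis)
  have Lh: "L h k - \<i> * L (\<i> *s h) k = (\<Sum>i\<in>UNIV. (L (axis i 1) k - \<i> * L (axis i \<i>) k) * h $ i)" for h k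
  proof -
    have "L h k - \<i> * L (\<i> *s h) k =
       (complex_of_real (blinfun_apply (blinfun_apply b h) k) - \<i> * complex_of_real (blinfun_apply (blinfun_apply b (\<i> *s h)) k))
       - \<i> * (complex_of_real (blinfun_apply (blinfun_apply b h) (\<i> *s k)) - \<i> * complex_of_real (blinfun_apply (blinfun_apply b (\<i> *s h)) (\<i> *s k)))"
      by (simp add: L_def algebra_simps)
    also have "\<dots> = (\<Sum>i\<in>UNIV. (L (axis i 1) k - \<i> * L (axis i \<i>) k) * h $ i)"
      unfolding real_linear_complexify[OF lin2[of k], of h] real_linear_complexify[OF lin2[of "\<i> *s k"], of h]
        sum_distrib_left sum_subtractf[symmetric]
      by (rule sum.cong) (auto simp: L_def algebra_simps)
    finally show ?thesis .
  qed
  define m where "m = (\<lambda>i j. L (axis i 1) (axis j 1) - \<i> * L (axis i \<i>) (axis j 1))"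
  have "(\<Sum>i\<in>UNIV. \<Sum>j\<in>UNIV. m i j * h $ i * h $ j) = L h h - \<i> * L (\<i> *s h) h" for h
  proof -
    have "L (axis i 1) h - \<i> * L (axis i \<i>) h = (\<Sum>j\<in>UNIV. m i j * h $ j)" for i
      unfolding Lk[of "axis i 1" h] Lk[of "axis i \<i>" h] m_def
      by (simp add: sum_distrib_left left_diff_distrib sum_subtractf mult.assoc)
    then show ?thesis
      unfolding Lh by (simp add: sum_distrib_left mult_ac)
  qed
  then show ?thesis
    by (intro that[of m]) (simp add: L_def)
qed

section \<open>A strictly plurisubharmonic defining function\<close>

lemma exp_quadratic_lower:
  fixes t :: real
  assumes "-2 \<le> t"
  shows "1 + t + t\<^sup>2 / 4 \<le> exp t"
proof -
  have "(1 + t / 2)\<^sup>2 \<le> (exp (t / 2))\<^sup>2"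
    using assms exp_ge_add_one_self[of "t / 2"] by (intro power_mono) auto
  also have "\<dots> = exp t" by (simp flip: exp_double)
  finally show ?thesis by (simp add: power2_eq_square algebra_simps)
qed

text \<open>
  Composition with \<open>exp(2A t) - 1\<close> adds a multiple of the square of the first derivative to the
  second derivative, which is the penalty in \<open>strongly_psc_domain\<close>. The quadratic lower bound for the
  exponential reduces the expansion of \<open>exp(2A\<rho>) - 1\<close> to that of \<open>\<rho>\<close>: with \<open>y = \<rho>(a + h) - \<rho>(a)\<close> it
  remains to bound \<open>y + A y\<^sup>2/2\<close> from below.
\<close>
lemma exponential_strictly_psh:
  assumes dom: "C2_domain W \<eta> B \<epsilon> g X \<rho>" and psc: "strongly_psc_domain W A c \<tau> X \<rho> \<epsilon>"
    and pos: "\<eta> > 0" "B > 0" "A > 0" "c > 0" "\<tau> > 0"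
    and \<tau>': "\<tau>' \<le> \<eta>" "\<tau>' \<le> \<tau>" "A * B * \<tau>' \<le> 1" "8 * A * B\<^sup>2 * \<tau>' \<le> c"
  shows "strictly_psh_collar X (\<lambda>z. exp (2 * A * \<rho> z) - 1) (\<lambda>z h. 2 * A * exp (2 * A * \<rho> z) * deriv1 \<rho> z h)
     B (1 - exp (- (2 * A * \<epsilon>))) \<tau>' (A * exp (- (2 * A * B)) * c / 4)"
  unfolding strictly_psh_collar_def
proof (intro conjI ballI impI)
  show "norm (z - w) \<le> B" if "z \<in> X" "w \<in> X" for z w using dom_diam[OF dom] that .
  show "continuous_on X (\<lambda>z. exp (2 * A * \<rho> z) - 1)"
    by (intro continuous_intros continuous_on_subset[OF dom_cont[OF dom] dom_sub[OF dom]])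
  show "exp (2 * A * \<rho> z) - 1 < 0" if "z \<in> X" for z
    using dom_neg[OF dom that] pos by (simp add: mult_pos_neg)
  fix a assume a: "a \<in> X" and ra: "- (1 - exp (- (2 * A * \<epsilon>))) < exp (2 * A * \<rho> a) - 1"
  have collar: "\<rho> a > - \<epsilon>"
  proof -
    have "exp (- (2 * A * \<epsilon>)) < exp (2 * A * \<rho> a)" using ra by simp
    then have "2 * A * (- \<epsilon>) < 2 * A * \<rho> a" by simp
    then show ?thesis using pos mult_less_cancel_left_pos[of "2 * A" "- \<epsilon>" "\<rho> a"] by simp
  qed
  define E where "E = exp (2 * A * \<rho> a)"
  have aW: "a \<in> W" using a dom_sub[OF dom] by blast
  have E: "E > 0" "exp (- (2 * A * B)) \<le> E"
    using dom_abs[OF dom aW] pos mult_left_mono[of "-B" "\<rho> a" A] by (auto simp: E_def abs_le_iff)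
  define u where "u = blinfun_apply (total_deriv \<rho> a)"
  have lin: "linear u" unfolding u_def by (intro bounded_linear.linear blinfun.bounded_linear_right)
  define l1 where "l1 = (\<lambda>i. complex_of_real (u (axis i 1)) - \<i> * complex_of_real (u (axis i \<i>)))"
  have l1: "(\<Sum>i\<in>UNIV. l1 i * h $ i) = complex_of_real (u h) - \<i> * complex_of_real (u (\<i> *s h))" for h
    unfolding l1_def by (rule real_linear_complexify[OF lin, symmetric])
  obtain m1 where m1: "\<And>h. Re (\<Sum>i\<in>UNIV. \<Sum>j\<in>UNIV. m1 i j * h $ i * h $ j) =
      deriv2 \<rho> a h h - deriv2 \<rho> a (\<i> *s h) (\<i> *s h)"
    by (rule real_bilinear_complexify[of "total_deriv (total_deriv \<rho>) a"]) blast
  define m2 where "m2 = (\<lambda>i j. m1 i j / 4 + of_real (A / 4) * l1 i * l1 j)"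
  define l where "l = (\<chi> i. of_real (2 * A * E) * l1 i)"
  define m where "m = (\<lambda>i j. of_real (2 * A * E) * m2 i j)"
  have ReP: "Re (quad_poly l m h) = 2 * A * E *
     (u h + (deriv2 \<rho> a h h - deriv2 \<rho> a (\<i> *s h) (\<i> *s h)) / 4 + A / 4 * ((u h)\<^sup>2 - (u (\<i> *s h))\<^sup>2))" for h
  proof -
    let ?c = "complex_of_real (2 * A * E)"
    let ?s = "\<Sum>i\<in>UNIV. l1 i * h $ i" and ?m = "\<Sum>i\<in>UNIV. \<Sum>j\<in>UNIV. m1 i j * h $ i * h $ j"
    have "(\<Sum>i\<in>UNIV. l $ i * h $ i) = ?c * ?s"
      by (simp add: l_def sum_distrib_left mult.assoc)
    moreover have "(\<Sum>i\<in>UNIV. \<Sum>j\<in>UNIV. m i j * h $ i * h $ j) = ?c * (?m / 4 + of_real (A / 4) * (?s * ?s))"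
    proof -
      have "m i j * h $ i * h $ j = ?c / 4 * (m1 i j * h $ i * h $ j)
          + ?c * of_real (A / 4) * ((l1 i * h $ i) * (l1 j * h $ j))" for i j
        unfolding m_def m2_def by algebra
      then have "(\<Sum>i\<in>UNIV. \<Sum>j\<in>UNIV. m i j * h $ i * h $ j)
          = ?c / 4 * ?m + ?c * of_real (A / 4) * (\<Sum>i\<in>UNIV. \<Sum>j\<in>UNIV. (l1 i * h $ i) * (l1 j * h $ j))"
        by (simp only: sum.distrib sum_distrib_left)
      then show ?thesis unfolding sum_product by (simp only: distrib_left) (simp add: mult.assoc)
    qed
    ultimately have "quad_poly l m h = ?c * (?s + (?m / 4 + of_real (A / 4) * (?s * ?s)))"
      by (simp add: quad_poly_def distrib_left)
    moreover have "Re (?s * ?s) = (u h)\<^sup>2 - (u (\<i> *s h))\<^sup>2" "Re ?s = u h"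
      unfolding l1 by (simp_all add: power2_eq_square)
    moreover have "Re (of_real x * y) = x * Re y" for x y by simp
    ultimately show ?thesis by (simp only: plus_complex.sel Re_divide_numeral m1 add.assoc)
  qed
  show "\<exists>l m. (\<forall>h. Re (\<Sum>i\<in>UNIV. l $ i * h $ i) = 2 * A * exp (2 * A * \<rho> a) * deriv1 \<rho> a h) \<and>
      (\<forall>h. norm h < \<tau>' \<and> a + h \<in> X \<longrightarrow>
        exp (2 * A * \<rho> a) - 1 + Re (quad_poly l m h) + A * exp (- (2 * A * B)) * c / 4 * (norm h)\<^sup>2
        \<le> exp (2 * A * \<rho> (a + h)) - 1)"
  proof (intro exI[of _ l] exI[of _ m] conjI allI impI)
    have "(\<Sum>i\<in>UNIV. l $ i * h $ i) = of_real (2 * A * E) * (\<Sum>i\<in>UNIV. l1 i * h $ i)" for h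
      by (simp add: l_def sum_distrib_left algebra_simps)
    then show "Re (\<Sum>i\<in>UNIV. l $ i * h $ i) = 2 * A * exp (2 * A * \<rho> a) * deriv1 \<rho> a h" for h
      unfolding l1 by (simp add: E_def u_def)
    fix h assume "norm h < \<tau>' \<and> a + h \<in> X"
    then have h: "norm h < \<tau>'" "a + h \<in> X" "norm h < \<eta>" "norm h < \<tau>" using \<tau>' by auto
    define n2 where "n2 = (norm h)\<^sup>2"
    define y where "y = \<rho> (a + h) - \<rho> a"
    obtain \<theta> where \<theta>: "0 < \<theta>" "\<theta> < 1" "\<rho> (a + h) = \<rho> a + deriv1 \<rho> a h + deriv2 \<rho> (a + \<theta> *\<^sub>R h) h h / 2"
      "a + \<theta> *\<^sub>R h \<in> W" by (rule dom_taylor[OF dom a h(3)])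
    have "norm (\<theta> *\<^sub>R h) < \<tau>" using \<theta> h(4) mult_left_le_one_le[of "norm h" \<theta>] by simp
    then have "norm (a - (a + \<theta> *\<^sub>R h)) < \<tau>" by simp
    then have "norm (total_deriv (total_deriv \<rho>) a - total_deriv (total_deriv \<rho>) (a + \<theta> *\<^sub>R h)) \<le> c / 8"
      using psc a \<theta>(4) unfolding strongly_psc_domain_def by blast
    then have "norm (total_deriv (total_deriv \<rho>) a - total_deriv (total_deriv \<rho>) (a + \<theta> *\<^sub>R h)) * norm h * norm h \<le> c / 8 * norm h * norm h"
      by (intro mult_right_mono) auto
    with blinfun2_bound[of "total_deriv (total_deriv \<rho>) a - total_deriv (total_deriv \<rho>) (a + \<theta> *\<^sub>R h)" h h]
    have mod: "deriv2 \<rho> a h h - c / 8 * n2 \<le> deriv2 \<rho> (a + \<theta> *\<^sub>R h) h h"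
      by (simp add: blinfun.diff_left n2_def power2_eq_square abs_le_iff)
    have y1: "u h + deriv2 \<rho> a h h / 2 - c / 16 * n2 \<le> y"
      using mod \<theta>(3) by (simp add: y_def u_def)
    have yB: "\<bar>y\<bar> \<le> B * norm h" using dom_lipschitz[OF dom a h(3)] by (simp add: y_def)
    have yl: "\<bar>y - u h\<bar> \<le> B / 2 * n2" using dom_taylor_bound[OF dom a h(3)] by (simp add: y_def u_def n2_def)
    have lB: "\<bar>u h\<bar> \<le> B * norm h"
      using blinfun1_bound[of "total_deriv \<rho> a" h] mult_right_mono[OF dom_D1[OF dom aW], of "norm h"]
      by (simp add: u_def)
    have y2: "(u h)\<^sup>2 - B\<^sup>2 * norm h * n2 \<le> y\<^sup>2"
    proof -
      have "(u h)\<^sup>2 - y\<^sup>2 = (u h - y) * (u h + y)" by algebra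
      also have "\<dots> \<le> \<bar>y - u h\<bar> * \<bar>u h + y\<bar>" by (metis abs_ge_self abs_minus_commute abs_mult)
      also have "\<dots> \<le> (B / 2 * n2) * (2 * (B * norm h))"
        using yl yB lB pos by (intro mult_mono) (auto simp: n2_def)
      finally show ?thesis by (simp add: power2_eq_square algebra_simps)
    qed
    have small: "A * B\<^sup>2 * norm h * n2 \<le> c / 8 * n2"
    proof (rule mult_right_mono)
      have "A * B\<^sup>2 * norm h \<le> A * B\<^sup>2 * \<tau>'" using h pos by (intro mult_left_mono) auto
      then show "A * B\<^sup>2 * norm h \<le> c / 8" using \<tau>'(4) by simp
    qed (simp add: n2_def)
    have levi: "c * n2 \<le> levi_real \<rho> a h + A * ((u h)\<^sup>2 + (u (\<i> *s h))\<^sup>2)"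
      using psc a collar unfolding strongly_psc_domain_def by (auto simp: n2_def u_def)
    have "-2 \<le> 2 * A * y"
    proof -
      have "A * \<bar>y\<bar> \<le> A * (B * \<tau>')" using yB h pos by (intro mult_left_mono order_trans[OF yB]) auto
      then have "A * \<bar>y\<bar> \<le> 1" using \<tau>'(3) by simp
      moreover have "A * (- \<bar>y\<bar>) \<le> A * y" using pos by (intro mult_left_mono) auto
      ultimately show ?thesis by simp
    qed
    from exp_quadratic_lower[OF this]
    have "E * (1 + 2 * A * y + (2 * A * y)\<^sup>2 / 4) \<le> E * exp (2 * A * y)"
      using E by (intro mult_left_mono) auto
    also have "E * exp (2 * A * y) = exp (2 * A * \<rho> (a + h))"
      by (simp add: E_def y_def algebra_simps flip: exp_add)
    finally have lower: "E + 2 * A * E * (y + A / 2 * y\<^sup>2) \<le> exp (2 * A * \<rho> (a + h))"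
      by (simp add: power2_eq_square algebra_simps)
    have "u h + (deriv2 \<rho> a h h - deriv2 \<rho> a (\<i> *s h) (\<i> *s h)) / 4 + A / 4 * ((u h)\<^sup>2 - (u (\<i> *s h))\<^sup>2) + c / 8 * n2
       \<le> y + A / 2 * y\<^sup>2"
    proof -
      have "A * ((u h)\<^sup>2 - B\<^sup>2 * norm h * n2) \<le> A * y\<^sup>2" using y2 pos by (intro mult_left_mono) auto
      then have 1: "A * (u h)\<^sup>2 - c * n2 / 8 \<le> A * y\<^sup>2" using small by (simp add: right_diff_distrib mult_ac)
      have 2: "u h + deriv2 \<rho> a h h / 2 - c * n2 / 16 \<le> y" using y1 by simp
      have 3: "c * n2 \<le> deriv2 \<rho> a h h + deriv2 \<rho> a (\<i> *s h) (\<i> *s h) + A * (u h)\<^sup>2 + A * (u (\<i> *s h))\<^sup>2"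
        using levi unfolding levi_real_def distrib_left by simp
      have "u h + (deriv2 \<rho> a h h - deriv2 \<rho> a (\<i> *s h) (\<i> *s h)) / 4 + (A * (u h)\<^sup>2 - A * (u (\<i> *s h))\<^sup>2) / 4 + c * n2 / 8
          \<le> y + A * y\<^sup>2 / 2"
        using 1 2 3 by argo
      then show ?thesis by (simp add: right_diff_distrib diff_divide_distrib)
    qed
    then have "2 * A * E * (u h + (deriv2 \<rho> a h h - deriv2 \<rho> a (\<i> *s h) (\<i> *s h)) / 4 + A / 4 * ((u h)\<^sup>2 - (u (\<i> *s h))\<^sup>2) + c / 8 * n2)
       \<le> 2 * A * E * (y + A / 2 * y\<^sup>2)" using pos E by (intro mult_left_mono) auto
    then have "Re (quad_poly l m h) + A * E * c / 4 * n2 \<le> 2 * A * E * (y + A / 2 * y\<^sup>2)"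
      unfolding ReP by (simp add: algebra_simps)
    moreover have "A * exp (- (2 * A * B)) * c / 4 * n2 \<le> A * E * c / 4 * n2"
      using E pos by (intro mult_right_mono divide_right_mono mult_left_mono) (auto simp: n2_def)
    ultimately show "exp (2 * A * \<rho> a) - 1 + Re (quad_poly l m h) + A * exp (- (2 * A * B)) * c / 4 * (norm h)\<^sup>2
        \<le> exp (2 * A * \<rho> (a + h)) - 1"
      using lower by (simp add: E_def n2_def)
  qed
qed

section \<open>Uniform lower bounds for the Kobayashi metric\<close>

lemma exp_minus_one_le: "exp x - 1 \<le> x * exp (x :: real)"
  using exp_ge_add_one_self[of "- x"] by (simp add: exp_minus field_simps)

text \<open>
  The two bounds for discs, applied to \<open>exp(2A\<rho>) - 1\<close> and rewritten in terms of \<open>\<rho>\<close>. The sharp bound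
  for discs is available close to the boundary; at a definite distance from it the second estimate
  follows from the first one.
\<close>
lemma kobayashi_lower_bounds:
  fixes W :: "(complex ^ 'n) set"
  assumes pos: "\<eta> > 0" "B > 0" "\<epsilon> > 0" "A > 0" "c > 0" "\<tau> > 0"
  obtains C where "C > 0"
    "\<And>X \<rho> g z \<xi>. C2_domain W \<eta> B \<epsilon> g X \<rho> \<Longrightarrow> strongly_psc_domain W A c \<tau> X \<rho> \<epsilon> \<Longrightarrow> z \<in> X \<Longrightarrow>
       norm \<xi> \<le> C * sqrt (- \<rho> z) * kobayashi_metric X z \<xi>"
    "\<And>X \<rho> g z \<xi>. C2_domain W \<eta> B \<epsilon> g X \<rho> \<Longrightarrow> strongly_psc_domain W A c \<tau> X \<rho> \<epsilon> \<Longrightarrow> z \<in> X \<Longrightarrow>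
       \<bar>deriv1 \<rho> z \<xi>\<bar> \<le> 2 * (- \<rho> z) * (1 + C * (- \<rho> z)) * kobayashi_metric X z \<xi>"
proof -
  define \<tau>' where "\<tau>' = min (min \<eta> \<tau>) (min (1 / (A * B)) (c / (8 * A * B\<^sup>2)))"
  define \<epsilon>' where "\<epsilon>' = 1 - exp (- (2 * A * \<epsilon>))"
  define c1 where "c1 = A * exp (- (2 * A * B)) * c / 4"
  define c' where "c' = min c1 (\<epsilon>' / (2 * B\<^sup>2))"
  define \<mu> where "\<mu> = c1 * \<tau>'\<^sup>2 / 16"
  define K where "K = 13 / (\<mu> * \<tau>'\<^sup>2)"
  \<comment> \<open>Near the boundary the sharp bound produces the factor \<open>exp(M\<sigma>)\<close>, which is at most
      \<open>1 + C2 \<sigma>\<close>; the constant \<open>C3\<close> is for the range \<open>\<sigma> \<ge> \<sigma>0\<close>.\<close>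
  define M where "M = 2 * A + K * B\<^sup>2 * (2 * A)"
  define \<sigma>0 where "\<sigma>0 = min \<epsilon> (\<mu> / (16 * A))"
  define C1 where "C1 = sqrt (2 * A / c')"
  define C2 where "C2 = M * exp (M * B)"
  define C3 where "C3 = B * C1 * sqrt B / (2 * \<sigma>0\<^sup>2)"
  have \<tau>': "\<tau>' > 0" "\<tau>' \<le> \<eta>" "\<tau>' \<le> \<tau>" "A * B * \<tau>' \<le> 1" "8 * A * B\<^sup>2 * \<tau>' \<le> c"
  proof -
    show "\<tau>' > 0" "\<tau>' \<le> \<eta>" "\<tau>' \<le> \<tau>" using pos by (auto simp: \<tau>'_def)
    have "\<tau>' \<le> 1 / (A * B)" "\<tau>' \<le> c / (8 * A * B\<^sup>2)" by (auto simp: \<tau>'_def)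
    then show "A * B * \<tau>' \<le> 1" "8 * A * B\<^sup>2 * \<tau>' \<le> c" using pos by (simp_all add: pos_le_divide_eq mult_ac)
  qed
  have \<epsilon>': "\<epsilon>' > 0" using pos by (simp add: \<epsilon>'_def)
  have c1: "c1 > 0" using pos by (simp add: c1_def)
  have c': "c' > 0" "c' \<le> c1" "c' * B\<^sup>2 \<le> \<epsilon>' / 2"
  proof -
    show "c' > 0" "c' \<le> c1" using c1 \<epsilon>' pos by (auto simp: c'_def)
    have "c' \<le> \<epsilon>' / (2 * B\<^sup>2)" by (simp add: c'_def)
    then show "c' * B\<^sup>2 \<le> \<epsilon>' / 2" using pos by (simp add: pos_le_divide_eq mult_ac)
  qed
  have p: "\<mu> > 0" "K > 0" "M > 0" "\<sigma>0 > 0" "C1 > 0" "C2 > 0" "C3 > 0"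
  proof -
    show 1: "\<mu> > 0" using c1 \<tau>' by (simp add: \<mu>_def)
    then show 2: "K > 0" using \<tau>' by (simp add: K_def)
    then show 3: "M > 0" using pos by (simp add: M_def add_pos_pos)
    show 4: "\<sigma>0 > 0" using pos 1 by (simp add: \<sigma>0_def)
    show 5: "C1 > 0" using pos c' by (simp add: C1_def)
    show "C2 > 0" using 3 by (simp add: C2_def)
    show "C3 > 0" using 4 5 pos by (simp add: C3_def)
  qed
  let ?F = kobayashi_metric
  have est1: "norm \<xi> \<le> C1 * sqrt (- \<rho> z) * ?F X z \<xi>"
    and est2: "\<bar>deriv1 \<rho> z \<xi>\<bar> \<le> 2 * (- \<rho> z) * (1 + (C2 + C3) * (- \<rho> z)) * ?F X z \<xi>"
    if dom: "C2_domain W \<eta> B \<epsilon> g X \<rho>" and psc: "strongly_psc_domain W A c \<tau> X \<rho> \<epsilon>" and z: "z \<in> X"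
    for X \<rho> g z \<xi>
  proof -
    define \<sigma> where "\<sigma> = - \<rho> z"
    have zW: "z \<in> W" using dom_sub[OF dom] z by blast
    have \<sigma>: "0 < \<sigma>" "\<sigma> \<le> B" using dom_neg[OF dom z] dom_abs[OF dom zW] by (auto simp: \<sigma>_def)
    have opn: "open X" by (rule dom_open[OF dom])
    have F0: "?F X z \<xi> \<ge> 0" by (rule kobayashi_metric_nonneg[OF opn z])
    define r where "r = (\<lambda>z. exp (2 * A * \<rho> z) - 1)"
    define r' where "r' = (\<lambda>z h. 2 * A * exp (2 * A * \<rho> z) * deriv1 \<rho> z h)"
    have psh: "strictly_psh_collar X r r' B \<epsilon>' \<tau>' c1"
      unfolding r_def r'_def \<epsilon>'_def c1_def
      using dom psc pos(1,2,4,5,6) \<tau>'(2-5) by (rule exponential_strictly_psh)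
    define s where "s = - r z"
    have s: "s = 1 - exp (- (2 * A * \<sigma>))" by (simp add: s_def r_def \<sigma>_def)
    have s\<sigma>: "s \<le> 2 * A * \<sigma>" using exp_ge_add_one_self[of "- (2 * A * \<sigma>)"] by (simp add: s)
    have sq: "sqrt \<sigma> > 0" using \<sigma> by simp
    have "norm \<xi> / (C1 * sqrt \<sigma>) \<le> ?F X z \<xi>"
    proof (rule kobayashi_metric_ge[OF opn z])
      fix \<phi> \<alpha> assume \<phi>: "holomorphic_disc X \<phi>" "\<phi> 0 = z" "deriv_vec \<phi> = \<alpha> *\<^sub>R \<xi>" "(\<alpha> :: real) > 0"
      have "c' * (norm (deriv_vec \<phi>))\<^sup>2 \<le> s"
        using disc_deriv_norm_bound[OF psh \<epsilon>' \<tau>'(1) c' \<phi>(1)] \<phi>(2) by (simp add: s_def)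
      then have "c' * (\<alpha> * norm \<xi>)\<^sup>2 \<le> 2 * A * \<sigma>" using s\<sigma> \<phi>(3,4) by simp
      then have "(\<alpha> * norm \<xi>)\<^sup>2 \<le> 2 * A / c' * \<sigma>" using c' by (simp add: pos_le_divide_eq mult_ac)
      then have "sqrt ((\<alpha> * norm \<xi>)\<^sup>2) \<le> sqrt (2 * A / c' * \<sigma>)" by (rule real_sqrt_le_mono)
      moreover have "sqrt (2 * A / c' * \<sigma>) = C1 * sqrt \<sigma>" by (simp only: C1_def real_sqrt_mult)
      ultimately have "\<alpha> * norm \<xi> \<le> C1 * sqrt \<sigma>" using \<phi>(4) by simp
      then show "norm \<xi> / (C1 * sqrt \<sigma>) \<le> 1 / \<alpha>" using \<phi>(4) p sq by (simp add: field_simps)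
    qed
    then show e1: "norm \<xi> \<le> C1 * sqrt (- \<rho> z) * ?F X z \<xi>"
      using p sq by (simp add: pos_divide_le_eq \<sigma>_def[symmetric] mult_ac)
    have "\<bar>deriv1 \<rho> z \<xi>\<bar> \<le> 2 * \<sigma> * (1 + (C2 + C3) * \<sigma>) * ?F X z \<xi>"
    proof (cases "\<sigma> < \<sigma>0")
      case True
      have sm: "s < \<epsilon>'" "8 * s \<le> \<mu>"
      proof -
        have "exp (- (2 * A * \<epsilon>)) < exp (- (2 * A * \<sigma>))" using True pos by (simp add: \<sigma>0_def)
        then show "s < \<epsilon>'" by (simp add: s \<epsilon>'_def)
        have "\<sigma> \<le> \<mu> / (16 * A)" using True by (simp add: \<sigma>0_def)
        then have "16 * A * \<sigma> \<le> \<mu>" using pos by (simp add: pos_le_divide_eq mult_ac)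
        then show "8 * s \<le> \<mu>" using s\<sigma> by simp
      qed
      have b: "2 * s * exp (K * B\<^sup>2 * s) \<le> 2 * A * exp (- (2 * A * \<sigma>)) * (2 * \<sigma> * (1 + C2 * \<sigma>))"
      proof -
        have "s = exp (- (2 * A * \<sigma>)) * (exp (2 * A * \<sigma>) - 1)" by (simp add: s right_diff_distrib flip: exp_add)
        also have "\<dots> \<le> exp (- (2 * A * \<sigma>)) * (2 * A * \<sigma> * exp (2 * A * \<sigma>))"
          by (intro mult_left_mono exp_minus_one_le) auto
        finally have 1: "s \<le> exp (- (2 * A * \<sigma>)) * (2 * A * \<sigma> * exp (2 * A * \<sigma>))" .
        have "K * B\<^sup>2 * s \<le> K * B\<^sup>2 * (2 * A * \<sigma>)" using s\<sigma> p by (intro mult_left_mono) auto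
        then have 2: "exp (K * B\<^sup>2 * s) \<le> exp (K * B\<^sup>2 * (2 * A * \<sigma>))" by simp
        have "2 * s * exp (K * B\<^sup>2 * s) \<le> 2 * (exp (- (2 * A * \<sigma>)) * (2 * A * \<sigma> * exp (2 * A * \<sigma>))) * exp (K * B\<^sup>2 * (2 * A * \<sigma>))"
          using 1 2 \<sigma> pos s by (intro mult_mono) auto
        also have "\<dots> = 2 * A * exp (- (2 * A * \<sigma>)) * (2 * \<sigma> * exp (M * \<sigma>))"
          by (simp add: M_def exp_add[symmetric] distrib_left algebra_simps)
        also have "\<dots> \<le> 2 * A * exp (- (2 * A * \<sigma>)) * (2 * \<sigma> * (1 + C2 * \<sigma>))"
        proof -
          have "exp (M * \<sigma>) - 1 \<le> M * \<sigma> * exp (M * \<sigma>)" by (rule exp_minus_one_le)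
          also have "\<dots> \<le> M * \<sigma> * exp (M * B)" using p \<sigma> by (intro mult_left_mono) auto
          finally have "exp (M * \<sigma>) \<le> 1 + C2 * \<sigma>" by (simp add: C2_def mult_ac)
          then show ?thesis using pos \<sigma> by (intro mult_left_mono) auto
        qed
        finally show ?thesis .
      qed
      have q: "2 * \<sigma> * (1 + C2 * \<sigma>) > 0" using \<sigma> p by (simp add: add_pos_nonneg)
      have "\<bar>deriv1 \<rho> z \<xi>\<bar> / (2 * \<sigma> * (1 + C2 * \<sigma>)) \<le> ?F X z \<xi>"
      proof (rule kobayashi_metric_ge[OF opn z])
        fix \<phi> \<alpha> assume \<phi>: "holomorphic_disc X \<phi>" "\<phi> 0 = z" "deriv_vec \<phi> = \<alpha> *\<^sub>R \<xi>" "(\<alpha> :: real) > 0"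
        have "\<bar>r' z (deriv_vec \<phi>)\<bar> \<le> 2 * s * exp (K * B\<^sup>2 * s)"
          using disc_deriv_sharp_bound[OF psh \<epsilon>' \<tau>'(1) c1 \<mu>_def K_def \<phi>(1)] sm \<phi>(2) by (simp add: s_def)
        also note b
        finally have "2 * A * exp (- (2 * A * \<sigma>)) * (\<alpha> * \<bar>deriv1 \<rho> z \<xi>\<bar>)
            \<le> 2 * A * exp (- (2 * A * \<sigma>)) * (2 * \<sigma> * (1 + C2 * \<sigma>))"
          using \<phi>(4) pos by (simp add: r'_def \<phi>(3) blinfun.scaleR_right abs_mult \<sigma>_def)
        then have "\<alpha> * \<bar>deriv1 \<rho> z \<xi>\<bar> \<le> 2 * \<sigma> * (1 + C2 * \<sigma>)"
          using pos by (subst (asm) mult_le_cancel_left_pos) auto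
        then show "\<bar>deriv1 \<rho> z \<xi>\<bar> / (2 * \<sigma> * (1 + C2 * \<sigma>)) \<le> 1 / \<alpha>"
          using \<phi>(4) q by (simp add: divide_le_eq le_divide_eq mult_ac)
      qed
      then have "\<bar>deriv1 \<rho> z \<xi>\<bar> \<le> 2 * \<sigma> * (1 + C2 * \<sigma>) * ?F X z \<xi>"
        using q by (simp add: pos_divide_le_eq mult_ac)
      also have "\<dots> \<le> 2 * \<sigma> * (1 + (C2 + C3) * \<sigma>) * ?F X z \<xi>"
        using \<sigma> p F0 by (intro mult_right_mono mult_left_mono add_left_mono) auto
      finally show ?thesis .
    next
      case False
      have "\<bar>deriv1 \<rho> z \<xi>\<bar> \<le> B * norm \<xi>"
        using blinfun1_bound[of "total_deriv \<rho> z" \<xi>] mult_right_mono[OF dom_D1[OF dom zW], of "norm \<xi>"] by simp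
      also have "\<dots> \<le> B * (C1 * sqrt \<sigma> * ?F X z \<xi>)" using e1 pos by (intro mult_left_mono) (auto simp: \<sigma>_def)
      also have "\<dots> = (B * C1 * sqrt \<sigma>) * ?F X z \<xi>" by simp
      also have "\<dots> \<le> (2 * \<sigma> * (1 + (C2 + C3) * \<sigma>)) * ?F X z \<xi>"
      proof (rule mult_right_mono[OF _ F0])
        have "B * C1 * sqrt \<sigma> \<le> B * C1 * sqrt B" using pos p \<sigma> by (intro mult_left_mono) auto
        also have "\<dots> = 2 * C3 * \<sigma>0\<^sup>2" using p by (simp add: C3_def)
        also have "\<dots> \<le> 2 * C3 * \<sigma>\<^sup>2" using p False by (intro mult_left_mono power_mono) auto
        also have "\<dots> \<le> 2 * \<sigma> * (1 + (C2 + C3) * \<sigma>)"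
          using p \<sigma> by (simp add: power2_eq_square algebra_simps)
        finally show "B * C1 * sqrt \<sigma> \<le> 2 * \<sigma> * (1 + (C2 + C3) * \<sigma>)" .
      qed
      finally show ?thesis .
    qed
    then show "\<bar>deriv1 \<rho> z \<xi>\<bar> \<le> 2 * (- \<rho> z) * (1 + (C2 + C3) * (- \<rho> z)) * ?F X z \<xi>" by (simp add: \<sigma>_def)
  qed
  show ?thesis
  proof (rule that[of "C1 + C2 + C3"])
    show "C1 + C2 + C3 > 0" using p by simp
    fix X \<rho> g z \<xi> assume a: "C2_domain W \<eta> B \<epsilon> g X \<rho>" "strongly_psc_domain W A c \<tau> X \<rho> \<epsilon>" "z \<in> X"
    have F0: "?F X z \<xi> \<ge> 0" by (rule kobayashi_metric_nonneg[OF dom_open[OF a(1)] a(3)])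
    have \<sigma>: "- \<rho> z > 0" using dom_neg[OF a(1,3)] by simp
    have "C1 * sqrt (- \<rho> z) * ?F X z \<xi> \<le> (C1 + C2 + C3) * sqrt (- \<rho> z) * ?F X z \<xi>"
      using p \<sigma> F0 by (intro mult_right_mono) auto
    with est1[OF a, of \<xi>] show "norm \<xi> \<le> (C1 + C2 + C3) * sqrt (- \<rho> z) * ?F X z \<xi>" by linarith
    have "2 * (- \<rho> z) * (1 + (C2 + C3) * (- \<rho> z)) * ?F X z \<xi> \<le> 2 * (- \<rho> z) * (1 + (C1 + C2 + C3) * (- \<rho> z)) * ?F X z \<xi>"
      using p \<sigma> F0 by (intro mult_right_mono mult_left_mono add_left_mono) auto
    with est2[OF a, of \<xi>] show "\<bar>deriv1 \<rho> z \<xi>\<bar> \<le> 2 * (- \<rho> z) * (1 + (C1 + C2 + C3) * (- \<rho> z)) * ?F X z \<xi>" by linarith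
  qed
qed

section \<open>The Levi form in real terms and its independence of the defining function\<close>

lemma total_deriv_eqI:
  assumes "(f has_derivative blinfun_apply T) (at x)"
  shows "total_deriv f x = T"
  using frechet_derivative_at[OF assms] by (metis total_deriv_def blinfun_apply_inverse)

text \<open>
  The double sum of Wirtinger derivatives complexifies the real second derivative, linearly in one
  argument and antilinearly in the other.
\<close>
lemma Re_levi_form:
  assumes C2: "C2_on U \<rho>" and U: "open U" "p \<in> U"
  shows "Re (levi_form \<rho> p v) = levi_real \<rho> p v / 4"
proof -
  let ?c = complex_of_real
  let ?g = "\<lambda>z. ?c (\<rho> z)"
  have fg: "frechet_derivative ?g (at z) h = ?c (deriv1 \<rho> z h)" if "z \<in> U" for z h
  proof -
    have "(?g has_derivative (\<lambda>h. ?c (deriv1 \<rho> z h))) (at z)"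
      using C2_on_has_derivative(1)[OF C2 that] by (rule has_derivative_of_real)
    from frechet_derivative_at[OF this] show ?thesis by metis
  qed
  define M where "M = (\<lambda>h k. ?c (deriv2 \<rho> p h k) + \<i> * ?c (deriv2 \<rho> p h (\<i> *s k)))"
  have zbar: "frechet_derivative (d_zbar k ?g) (at p) h = M h (axis k 1) / 2" for k h
  proof -
    have "((\<lambda>z. (1 / 2) * (?c (deriv1 \<rho> z (axis k 1)) + \<i> * ?c (deriv1 \<rho> z (axis k \<i>)))) has_derivative
        (\<lambda>h. (1 / 2) * (?c (deriv2 \<rho> p h (axis k 1)) + \<i> * ?c (deriv2 \<rho> p h (axis k \<i>))))) (at p)"
      by (intro has_derivative_mult_right has_derivative_add has_derivative_of_real
          C2_on_has_derivative(2)[OF C2 U(2)])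
    moreover have "(\<lambda>h. (1 / 2) * (?c (deriv2 \<rho> p h (axis k 1)) + \<i> * ?c (deriv2 \<rho> p h (axis k \<i>)))) = (\<lambda>h. M h (axis k 1) / 2)"
      by (simp add: M_def smult_i_axis)
    ultimately have *: "((\<lambda>z. (1 / 2) * (?c (deriv1 \<rho> z (axis k 1)) + \<i> * ?c (deriv1 \<rho> z (axis k \<i>)))) has_derivative
        (\<lambda>h. M h (axis k 1) / 2)) (at p)" by metis
    have "(d_zbar k ?g has_derivative (\<lambda>h. M h (axis k 1) / 2)) (at p)"
    proof (rule has_derivative_transform_within_open[OF * U])
      show "(1 / 2) * (?c (deriv1 \<rho> z (axis k 1)) + \<i> * ?c (deriv1 \<rho> z (axis k \<i>))) = d_zbar k ?g z" if "z \<in> U" for z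
        by (simp add: d_zbar_def fg[OF that])
    qed
    from frechet_derivative_at[OF this] show ?thesis by metis
  qed
  have lin1: "linear (blinfun_apply (blinfun_apply (total_deriv (total_deriv \<rho>) p) h))" for h
    by (intro bounded_linear.linear blinfun.bounded_linear_right)
  have lin2: "linear (\<lambda>h. deriv2 \<rho> p h k)" for k
    by (rule linearI) (auto simp: blinfun.add_right blinfun.add_left blinfun.scaleR_right blinfun.scaleR_left)
  have Mk: "M h k = (\<Sum>j\<in>UNIV. M h (axis j 1) * cnj (k $ j))" for h k
  proof -
    have "cnj (?c (deriv2 \<rho> p h k) - \<i> * ?c (deriv2 \<rho> p h (\<i> *s k))) = (\<Sum>j\<in>UNIV. M h (axis j 1) * cnj (k $ j))"
      unfolding real_linear_complexify[OF lin1[of h], of k] cnj_sum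
      by (simp add: M_def smult_i_axis)
    then show ?thesis by (simp add: M_def)
  qed
  have Mh: "M h k - \<i> * M (\<i> *s h) k = (\<Sum>i\<in>UNIV. (M (axis i 1) k - \<i> * M (axis i \<i>) k) * h $ i)" for h k
  proof -
    have "M h k - \<i> * M (\<i> *s h) k =
       (?c (deriv2 \<rho> p h k) - \<i> * ?c (deriv2 \<rho> p (\<i> *s h) k))
       + \<i> * (?c (deriv2 \<rho> p h (\<i> *s k)) - \<i> * ?c (deriv2 \<rho> p (\<i> *s h) (\<i> *s k)))"
      by (simp add: M_def algebra_simps)
    also have "\<dots> = (\<Sum>i\<in>UNIV. (M (axis i 1) k - \<i> * M (axis i \<i>) k) * h $ i)"
      unfolding real_linear_complexify[OF lin2[of k], of h] real_linear_complexify[OF lin2[of "\<i> *s k"], of h]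
        sum_distrib_left sum.distrib[symmetric]
      by (rule sum.cong) (auto simp: M_def algebra_simps)
    finally show ?thesis .
  qed
  have dz: "d_z j (d_zbar k ?g) p = (M (axis j 1) (axis k 1) - \<i> * M (axis j \<i>) (axis k 1)) / 4" for j k
    by (simp add: d_z_def zbar diff_divide_distrib)
  have "levi_form \<rho> p v = (\<Sum>j\<in>UNIV. (M (axis j 1) v - \<i> * M (axis j \<i>) v) * v $ j) / 4"
  proof -
    have "(M (axis j 1) v - \<i> * M (axis j \<i>) v) = (\<Sum>k\<in>UNIV. (M (axis j 1) (axis k 1) - \<i> * M (axis j \<i>) (axis k 1)) * cnj (v $ k))" for j
      unfolding Mk[of "axis j 1" v] Mk[of "axis j \<i>" v]
      by (simp add: sum_distrib_left left_diff_distrib sum_subtractf mult.assoc)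
    then show ?thesis
      by (simp add: levi_form_def dz sum_divide_distrib sum_distrib_left sum_distrib_right mult_ac)
  qed
  also have "\<dots> = (M v v - \<i> * M (\<i> *s v) v) / 4" by (simp only: Mh)
  finally have eq: "levi_form \<rho> p v = (M v v - \<i> * M (\<i> *s v) v) / 4" .
  show ?thesis unfolding eq by (simp add: M_def levi_real_def)
qed

lemma complex_tangent_space_iff:
  assumes C2: "C2_on U \<rho>" and U: "p \<in> U"
  shows "v \<in> complex_tangent_space \<rho> p \<longleftrightarrow> deriv1 \<rho> p v = 0 \<and> deriv1 \<rho> p (\<i> *s v) = 0"
proof -
  let ?c = complex_of_real
  have fg: "frechet_derivative (\<lambda>z. ?c (\<rho> z)) (at p) h = ?c (deriv1 \<rho> p h)" for h
  proof -
    have "((\<lambda>z. ?c (\<rho> z)) has_derivative (\<lambda>h. ?c (deriv1 \<rho> p h))) (at p)"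
      using C2_on_has_derivative(1)[OF C2 U] by (rule has_derivative_of_real)
    from frechet_derivative_at[OF this] show ?thesis by metis
  qed
  have lin: "linear (blinfun_apply (total_deriv \<rho> p))"
    by (intro bounded_linear.linear blinfun.bounded_linear_right)
  have "(\<Sum>j\<in>UNIV. d_z j (\<lambda>z. ?c (\<rho> z)) p * v $ j) = (?c (deriv1 \<rho> p v) - \<i> * ?c (deriv1 \<rho> p (\<i> *s v))) / 2"
    unfolding real_linear_complexify[OF lin] d_z_def fg by (simp add: sum_divide_distrib)
  moreover have "(?c a - \<i> * ?c b) / 2 = 0 \<longleftrightarrow> a = 0 \<and> b = 0" for a b
    by (simp add: complex_eq_iff)
  ultimately show ?thesis by (simp only: complex_tangent_space_def mem_Collect_eq)
qed

text \<open>
  Along parabolas that are tangent to the level set, the second derivative of \<open>\<rho>\<close> in the tangent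
  direction competes with the first derivative in the direction \<open>n\<close>.
\<close>
lemma curve_second_order:
  fixes \<rho> :: "complex ^ 'n \<Rightarrow> real"
  assumes C2: "C2_on U \<rho>" and U: "open U" "p \<in> U" and p: "\<rho> p = 0" "deriv1 \<rho> p u = 0"
  shows "((\<lambda>t. \<rho> (p + t *\<^sub>R u + t\<^sup>2 *\<^sub>R n) / t\<^sup>2) \<longlongrightarrow> deriv1 \<rho> p n + deriv2 \<rho> p u u / 2) (at 0)"
proof -
  define h where "h = (\<lambda>t. t *\<^sub>R u + t\<^sup>2 *\<^sub>R n)"
  obtain d where d: "d > 0" "ball p d \<subseteq> U" using U openE by blast
  have h0: "(h \<longlongrightarrow> 0) (at 0)" unfolding h_def by (auto intro!: tendsto_eq_intros)
  have small: "\<forall>\<^sub>F t in at 0. norm (h t) < d"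
    using tendstoD[OF h0 d(1)] by simp
  have seg: "p + s *\<^sub>R h t \<in> U" if "norm (h t) < d" "0 \<le> s" "s \<le> 1" for s t
  proof -
    have "norm (s *\<^sub>R h t) < d" using that mult_left_le_one_le[of "norm (h t)" s] by simp
    then show ?thesis using d(2) by (auto simp: dist_norm)
  qed
  have "\<forall>t. \<exists>\<theta>. norm (h t) < d \<longrightarrow> 0 < \<theta> \<and> \<theta> < 1 \<and> \<rho> (p + h t) = deriv1 \<rho> p (h t) + deriv2 \<rho> (p + \<theta> *\<^sub>R h t) (h t) (h t) / 2"
    using C2_taylor[OF C2 seg] p(1) by (metis add_0)
  then obtain \<theta> where \<theta>: "\<And>t. norm (h t) < d \<Longrightarrow> 0 < \<theta> t \<and> \<theta> t < 1 \<and>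
      \<rho> (p + h t) = deriv1 \<rho> p (h t) + deriv2 \<rho> (p + \<theta> t *\<^sub>R h t) (h t) (h t) / 2" by metis
  have lim\<theta>: "((\<lambda>t. \<theta> t *\<^sub>R h t) \<longlongrightarrow> 0) (at 0)"
  proof (rule Lim_null_comparison[OF _ tendsto_norm_zero[OF h0]])
    show "\<forall>\<^sub>F t in at 0. norm (\<theta> t *\<^sub>R h t) \<le> norm (h t)"
      using small
    proof eventually_elim
      case (elim t)
      show ?case using \<theta>[OF elim] by (simp add: mult_left_le_one_le)
    qed
  qed
  have "((\<lambda>t. p + \<theta> t *\<^sub>R h t) \<longlongrightarrow> p + 0) (at 0)" by (intro tendsto_intros lim\<theta>)
  moreover have "isCont (total_deriv (total_deriv \<rho>)) p"
    using C2 U by (auto simp: C2_on_def C1_on_def continuous_on_eq_continuous_at)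
  ultimately have T: "((\<lambda>t. total_deriv (total_deriv \<rho>) (p + \<theta> t *\<^sub>R h t)) \<longlongrightarrow> total_deriv (total_deriv \<rho>) p) (at 0)"
    using isCont_tendsto_compose by fastforce
  have "((\<lambda>t. deriv1 \<rho> p n + deriv2 \<rho> (p + \<theta> t *\<^sub>R h t) (u + t *\<^sub>R n) (u + t *\<^sub>R n) / 2) \<longlongrightarrow>
      deriv1 \<rho> p n + deriv2 \<rho> p (u + 0 *\<^sub>R n) (u + 0 *\<^sub>R n) / 2) (at 0)"
    by (intro tendsto_intros blinfun.tendsto T) auto
  then have lim: "((\<lambda>t. deriv1 \<rho> p n + deriv2 \<rho> (p + \<theta> t *\<^sub>R h t) (u + t *\<^sub>R n) (u + t *\<^sub>R n) / 2) \<longlongrightarrow>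
      deriv1 \<rho> p n + deriv2 \<rho> p u u / 2) (at 0)" by simp
  have "\<forall>\<^sub>F t in at 0. \<rho> (p + t *\<^sub>R u + t\<^sup>2 *\<^sub>R n) / t\<^sup>2 =
      deriv1 \<rho> p n + deriv2 \<rho> (p + \<theta> t *\<^sub>R h t) (u + t *\<^sub>R n) (u + t *\<^sub>R n) / 2"
    using small eventually_at_ball'[of 1 "0::real" UNIV, simplified]
  proof eventually_elim
    case (elim t)
    have ht: "h t = t *\<^sub>R (u + t *\<^sub>R n)" by (simp add: h_def power2_eq_square scaleR_add_right)
    have "deriv1 \<rho> p (h t) = t\<^sup>2 * deriv1 \<rho> p n" by (simp add: h_def blinfun.add_right blinfun.scaleR_right p)
    moreover have "deriv2 \<rho> (p + \<theta> t *\<^sub>R h t) (h t) (h t) = t\<^sup>2 * deriv2 \<rho> (p + \<theta> t *\<^sub>R h t) (u + t *\<^sub>R n) (u + t *\<^sub>R n)"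
    proof -
      have "blinfun_apply (blinfun_apply T (h t)) (h t) = t\<^sup>2 * blinfun_apply (blinfun_apply T (u + t *\<^sub>R n)) (u + t *\<^sub>R n)"
        for T :: "(complex ^ 'n) \<Rightarrow>\<^sub>L (complex ^ 'n) \<Rightarrow>\<^sub>L real"
        by (simp add: ht blinfun.scaleR_right blinfun.scaleR_left power2_eq_square)
      then show ?thesis .
    qed
    ultimately have "\<rho> (p + h t) = t\<^sup>2 * (deriv1 \<rho> p n + deriv2 \<rho> (p + \<theta> t *\<^sub>R h t) (u + t *\<^sub>R n) (u + t *\<^sub>R n) / 2)"
      using \<theta>[OF elim(1)] by (simp add: distrib_left)
    moreover have "\<rho> (p + t *\<^sub>R u + t\<^sup>2 *\<^sub>R n) = \<rho> (p + h t)" by (simp add: h_def add.assoc)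
    ultimately show ?case using elim(2) by simp
  qed
  then show ?thesis using lim by (simp add: tendsto_cong)
qed

lemma defining_function_frontier:
  assumes "C2_defining_function D U \<rho>" "open D" "p \<in> frontier D"
  shows "p \<in> U" "open U" "C2_on U \<rho>" "\<rho> p = 0" "\<exists>n. deriv1 \<rho> p n = 1"
proof -
  show pU: "p \<in> U" and U: "open U" and C2: "C2_on U \<rho>"
    using assms by (auto simp: C2_defining_function_def)
  have DU: "D \<inter> U = {z \<in> U. \<rho> z < 0}" using assms by (auto simp: C2_defining_function_def)
  have "p \<notin> D" "p \<in> closure D" using assms(2,3) by (auto simp: frontier_def interior_open)
  then have "\<rho> p \<ge> 0" using DU pU by force
  moreover have "\<not> \<rho> p > 0"
  proof
    assume pos: "\<rho> p > 0"
    have "continuous_on U \<rho>" using C2 C1_on_imp_continuous_on by (auto simp: C2_on_def)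
    then have "open (U \<inter> \<rho> -` {0<..})" using U by (intro continuous_open_preimage) auto
    moreover have "p \<in> U \<inter> \<rho> -` {0<..}" using pos pU by simp
    ultimately obtain x where x: "x \<in> D" "x \<in> U \<inter> \<rho> -` {0<..}"
      using \<open>p \<in> closure D\<close> by (meson closure_iff_nhds_not_empty disjoint_iff order_refl)
    then have "x \<in> D \<inter> U" by simp
    with x(2) show False unfolding DU by simp
  qed
  ultimately show "\<rho> p = 0" by simp
  have "total_deriv \<rho> p \<noteq> 0" using assms by (auto simp: C2_defining_function_def)
  then obtain n where "deriv1 \<rho> p n \<noteq> 0" using blinfun_eqI[of "total_deriv \<rho> p" 0] by auto
  then have "deriv1 \<rho> p ((1 / deriv1 \<rho> p n) *\<^sub>R n) = 1" by (simp add: blinfun.scaleR_right)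
  then show "\<exists>n. deriv1 \<rho> p n = 1" by blast
qed

text \<open>
  Two defining functions have the same sign near a boundary point. Along lines this compares their
  first derivatives, along parabolas their second derivatives in tangent directions.
\<close>
lemma defining_functions_compare:
  assumes D: "open D" "p \<in> frontier D"
    and f1: "C2_defining_function D U \<rho>" and f2: "C2_defining_function D V \<sigma>"
  shows "deriv1 \<rho> p u < 0 \<Longrightarrow> deriv1 \<sigma> p u \<le> 0"
    and "\<lbrakk>deriv1 \<rho> p u = 0; deriv1 \<sigma> p u = 0; deriv1 \<rho> p n + deriv2 \<rho> p u u / 2 > 0\<rbrakk> \<Longrightarrow> deriv1 \<sigma> p n + deriv2 \<sigma> p u u / 2 \<ge> 0"
proof -
  note F = defining_function_frontier[OF f1 D] and G = defining_function_frontier[OF f2 D]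
  have DU: "D \<inter> U = {z \<in> U. \<rho> z < 0}" and DV: "D \<inter> V = {z \<in> V. \<sigma> z < 0}"
    using f1 f2 by (auto simp: C2_defining_function_def)
  have ev: "\<forall>\<^sub>F t in at 0. p + t *\<^sub>R u + t\<^sup>2 *\<^sub>R n \<in> U \<inter> V" for u n
  proof -
    have "((\<lambda>t. p + t *\<^sub>R u + t\<^sup>2 *\<^sub>R n) \<longlongrightarrow> p) (at 0)" by (auto intro!: tendsto_eq_intros)
    then show ?thesis by (rule topological_tendstoD) (use F G in auto)
  qed
  have sgn: "\<sigma> z < 0 \<longleftrightarrow> \<rho> z < 0" if "z \<in> U \<inter> V" for z using that DU DV by auto
  { assume neg: "deriv1 \<rho> p u < 0"
    have lim: "((\<lambda>t. \<rho>' (p + t *\<^sub>R u + t\<^sup>2 *\<^sub>R 0) / t) \<longlongrightarrow> deriv1 \<rho>' p u) (at 0)"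
      if "C2_on U' \<rho>'" "p \<in> U'" "\<rho>' p = 0" for \<rho>' U'
      using segment_derivs(1)[of U' \<rho>' p 0 u] that by (simp add: DERIV_def)
    have l1: "((\<lambda>t. \<rho> (p + t *\<^sub>R u + t\<^sup>2 *\<^sub>R 0) / t) \<longlongrightarrow> deriv1 \<rho> p u) (at_right 0)"
      and l2: "((\<lambda>t. \<sigma> (p + t *\<^sub>R u + t\<^sup>2 *\<^sub>R 0) / t) \<longlongrightarrow> deriv1 \<sigma> p u) (at_right 0)"
      using lim[OF F(3,1,4)] lim[OF G(3,1,4)] by (auto intro: tendsto_mono[OF at_le[OF subset_UNIV]])
    have "\<forall>\<^sub>F t in at_right 0. \<sigma> (p + t *\<^sub>R u + t\<^sup>2 *\<^sub>R 0) / t \<le> 0"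
      using order_tendstoD(2)[OF l1 neg] eventually_at_right_less[of "0::real"]
        filter_leD[OF at_le[OF subset_UNIV] ev[of u 0]]
    proof eventually_elim
      case (elim t)
      then have "\<rho> (p + t *\<^sub>R u + t\<^sup>2 *\<^sub>R 0) < 0" by (simp add: divide_less_0_iff)
      then show ?case using sgn[OF elim(3)] elim(2) by (simp add: divide_le_0_iff)
    qed
    then show "deriv1 \<sigma> p u \<le> 0" by (intro tendsto_upperbound[OF l2]) auto }
  { assume u: "deriv1 \<rho> p u = 0" "deriv1 \<sigma> p u = 0" and pos: "deriv1 \<rho> p n + deriv2 \<rho> p u u / 2 > 0"
    note l1 = curve_second_order[OF F(3,2,1,4) u(1), of n] and l2 = curve_second_order[OF G(3,2,1,4) u(2), of n]
    have "\<forall>\<^sub>F t in at 0. 0 \<le> \<sigma> (p + t *\<^sub>R u + t\<^sup>2 *\<^sub>R n) / t\<^sup>2"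
      using order_tendstoD(1)[OF l1 pos] ev[of u n]
    proof eventually_elim
      case (elim t)
      then have "\<not> \<rho> (p + t *\<^sub>R u + t\<^sup>2 *\<^sub>R n) < 0" by (auto simp: zero_less_divide_iff)
      then show ?case using sgn[OF elim(2)] by (auto simp: zero_le_divide_iff)
    qed
    then show "deriv1 \<sigma> p n + deriv2 \<sigma> p u u / 2 \<ge> 0" by (intro tendsto_lowerbound[OF l2]) auto }
qed

text \<open>
  Here \<open>d\<sigma> = \<kappa> d\<rho>\<close> at \<open>p\<close> with \<open>\<kappa> > 0\<close>, and \<open>D\<^sup>2\<sigma>(u,u) \<ge> \<kappa> D\<^sup>2\<rho>(u,u)\<close> in tangent directions \<open>u\<close>: every
  parabola \<open>p + tu + t\<^sup>2n\<close> on which \<open>\<rho>\<close> is positive near \<open>p\<close> stays outside \<open>D\<close>, so \<open>\<sigma>\<close> is nonnegative on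
  it. The inequalities for \<open>v\<close> and \<open>\<i>v\<close> add up to one between the Levi forms. The argument avoids the
  quotient \<open>\<sigma>/\<rho>\<close>, whose second derivative need not exist.
\<close>
lemma levi_positive_independent:
  assumes D: "open D" "p \<in> frontier D"
    and f1: "C2_defining_function D U \<rho>" and f2: "C2_defining_function D V \<sigma>"
    and pos: "\<And>v. v \<in> complex_tangent_space \<rho> p \<Longrightarrow> v \<noteq> 0 \<Longrightarrow> Re (levi_form \<rho> p v) > 0"
    and v: "deriv1 \<sigma> p v = 0" "deriv1 \<sigma> p (\<i> *s v) = 0" "v \<noteq> 0"
  shows "levi_real \<sigma> p v > 0"
proof -
  note F = defining_function_frontier[OF f1 D] and G = defining_function_frontier[OF f2 D]
  note cmp1 = defining_functions_compare(1)[OF D f1 f2] and cmp2 = defining_functions_compare(2)[OF D f1 f2]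
  note cmp1' = defining_functions_compare(1)[OF D f2 f1]
  have ker: "deriv1 \<rho>' p u = 0"
    if "deriv1 \<sigma>' p u = 0" "deriv1 \<sigma>' p m = 1" and c: "\<And>u. deriv1 \<rho>' p u < 0 \<Longrightarrow> deriv1 \<sigma>' p u \<le> 0" for u m \<rho>' \<sigma>'
  proof (rule ccontr)
    assume nz: "deriv1 \<rho>' p u \<noteq> 0"
    \<comment> \<open>The vector below is descending for the first function and ascending for the second.\<close>
    define s where "s = - (1 + \<bar>deriv1 \<rho>' p m\<bar>) / deriv1 \<rho>' p u"
    have "deriv1 \<rho>' p (m + s *\<^sub>R u) = deriv1 \<rho>' p m - (1 + \<bar>deriv1 \<rho>' p m\<bar>)"
      using nz by (simp add: s_def blinfun.add_right blinfun.scaleR_right)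
    then have "deriv1 \<rho>' p (m + s *\<^sub>R u) < 0" by linarith
    from c[OF this] show False using that(1,2) by (simp add: blinfun.add_right blinfun.scaleR_right)
  qed
  obtain m where m: "deriv1 \<sigma> p m = 1" using G(5) by blast
  obtain n where n: "deriv1 \<rho> p n = 1" using F(5) by blast
  have k1: "deriv1 \<rho> p u = 0" if "deriv1 \<sigma> p u = 0" for u using ker[OF that m cmp1] .
  define \<kappa> where "\<kappa> = deriv1 \<sigma> p n"
  have "\<kappa> \<noteq> 0" using ker[of \<rho> u n \<sigma> for u] k1[of n] n by (auto simp: \<kappa>_def)
  moreover have "deriv1 \<sigma> p (- n) \<le> 0" by (rule cmp1) (simp add: blinfun.minus_right n)
  ultimately have \<kappa>: "\<kappa> > 0" by (simp add: \<kappa>_def blinfun.minus_right)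
  have deriv2: "\<kappa> * deriv2 \<rho> p u u \<le> deriv2 \<sigma> p u u" if u: "deriv1 \<sigma> p u = 0" for u
  proof (rule field_le_epsilon)
    fix e :: real assume e: "e > 0"
    define c where "c = - (deriv2 \<rho> p u u / 2) + e / (2 * \<kappa>)"
    have "deriv1 \<rho> p (c *\<^sub>R n) + deriv2 \<rho> p u u / 2 > 0"
      using e \<kappa> by (simp add: c_def blinfun.scaleR_right n)
    from cmp2[OF k1[OF u] u this] have "0 \<le> c * \<kappa> + deriv2 \<sigma> p u u / 2"
      by (simp add: blinfun.scaleR_right \<kappa>_def)
    also have "c * \<kappa> = - (\<kappa> * deriv2 \<rho> p u u / 2) + e / 2" using \<kappa> by (simp add: c_def field_simps)
    finally show "\<kappa> * deriv2 \<rho> p u u \<le> deriv2 \<sigma> p u u + e" by simp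
  qed
  have "v \<in> complex_tangent_space \<rho> p"
    using complex_tangent_space_iff[OF F(3,1)] k1 v by blast
  then have "0 < levi_real \<rho> p v" using pos v(3) Re_levi_form[OF F(3,2,1)] by force
  then have "0 < \<kappa> * levi_real \<rho> p v" using \<kappa> by simp
  also have "\<dots> \<le> levi_real \<sigma> p v"
    using deriv2[OF v(1)] deriv2[OF v(2)] by (simp add: levi_real_def distrib_left)
  finally show ?thesis .
qed

section \<open>Uniform data for a convergent sequence of domains\<close>

text \<open>
  The quadratic form of \<open>strongly_psc_domain\<close> as a function of the two derivatives, for perturbation
  arguments.
\<close>
definition penalized_levi ::
  "real \<Rightarrow> ((complex ^ 'n) \<Rightarrow>\<^sub>L real) \<Rightarrow> ((complex ^ 'n) \<Rightarrow>\<^sub>L (complex ^ 'n) \<Rightarrow>\<^sub>L real) \<Rightarrow> complex ^ 'n \<Rightarrow> real" where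
  "penalized_levi A S T v = blinfun_apply (blinfun_apply T v) v + blinfun_apply (blinfun_apply T (\<i> *s v)) (\<i> *s v)
     + A * ((blinfun_apply S v)\<^sup>2 + (blinfun_apply S (\<i> *s v))\<^sup>2)"

lemma penalized_levi_perturb:
  assumes A: "A \<ge> 0"
  shows "\<bar>penalized_levi A S T v - penalized_levi A S' T' v\<bar>
    \<le> (2 * norm (T - T') + 2 * A * (norm (S - S') * (norm S + norm S'))) * (norm v)\<^sup>2"
proof -
  have 1: "\<bar>blinfun_apply (blinfun_apply T w) w - blinfun_apply (blinfun_apply T' w) w\<bar> \<le> norm (T - T') * (norm v)\<^sup>2"
    if "norm w = norm v" for w
    using blinfun2_bound[of "T - T'" w w] that by (simp add: blinfun.diff_left power2_eq_square mult.assoc)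
  have 2: "\<bar>(blinfun_apply S w)\<^sup>2 - (blinfun_apply S' w)\<^sup>2\<bar> \<le> norm (S - S') * (norm S + norm S') * (norm v)\<^sup>2"
    if w: "norm w = norm v" for w
  proof -
    have "\<bar>(blinfun_apply S w)\<^sup>2 - (blinfun_apply S' w)\<^sup>2\<bar> = \<bar>blinfun_apply (S - S') w\<bar> * \<bar>blinfun_apply (S + S') w\<bar>"
      by (simp add: power2_eq_square blinfun.diff_left blinfun.add_left square_diff_square_factored abs_mult mult.commute)
    also have "\<dots> \<le> (norm (S - S') * norm v) * ((norm S + norm S') * norm v)"
    proof (intro mult_mono)
      show "\<bar>blinfun_apply (S - S') w\<bar> \<le> norm (S - S') * norm v" using blinfun1_bound[of "S - S'" w] w by simp
      have "\<bar>blinfun_apply (S + S') w\<bar> \<le> norm (S + S') * norm v" using blinfun1_bound[of "S + S'" w] w by simp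
      also have "\<dots> \<le> (norm S + norm S') * norm v" by (intro mult_right_mono norm_triangle_ineq) auto
      finally show "\<bar>blinfun_apply (S + S') w\<bar> \<le> (norm S + norm S') * norm v" .
    qed auto
    finally show ?thesis by (simp add: power2_eq_square mult_ac)
  qed
  have i: "norm (\<i> *s v) = norm v" by (simp add: norm_smult)
  define x where "x = (norm v)\<^sup>2"
  define y where "y = norm (S - S') * (norm S + norm S')"
  have 3: "A * \<bar>(blinfun_apply S w)\<^sup>2 - (blinfun_apply S' w)\<^sup>2\<bar> \<le> A * (y * x)" if "norm w = norm v" for w
    using 2[OF that] A by (intro mult_left_mono) (auto simp: y_def x_def)
  have "penalized_levi A S T v - penalized_levi A S' T' v =
     (blinfun_apply (blinfun_apply T v) v - blinfun_apply (blinfun_apply T' v) v)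
     + (blinfun_apply (blinfun_apply T (\<i> *s v)) (\<i> *s v) - blinfun_apply (blinfun_apply T' (\<i> *s v)) (\<i> *s v))
     + A * ((blinfun_apply S v)\<^sup>2 - (blinfun_apply S' v)\<^sup>2)
     + A * ((blinfun_apply S (\<i> *s v))\<^sup>2 - (blinfun_apply S' (\<i> *s v))\<^sup>2)"
    by (simp add: penalized_levi_def algebra_simps)
  also have "\<bar>\<dots>\<bar> \<le> norm (T - T') * x + norm (T - T') * x + A * (y * x) + A * (y * x)"
    by (intro order_trans[OF abs_triangle_ineq] add_mono)
       (use 1[OF refl] 1[OF i] 3[OF refl] 3[OF i] A in \<open>simp_all add: x_def abs_mult\<close>)
  also have "\<dots> = (2 * norm (T - T') + 2 * A * y) * x" by (simp add: algebra_simps)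
  finally show ?thesis by (simp add: x_def y_def)
qed

lemma penalized_levi_scale:
  "penalized_levi A S T (t *\<^sub>R v) = t\<^sup>2 * penalized_levi A S T v"
proof -
  have "\<i> *s (t *\<^sub>R v) = t *\<^sub>R (\<i> *s v)" by (simp add: vec_eq_iff)
  then show ?thesis
    by (simp add: penalized_levi_def blinfun.scaleR_right blinfun.scaleR_left power2_eq_square algebra_simps)
qed

text \<open>
  On the compact set where \<open>L \<le> 0\<close> the penalty \<open>T\<close> is bounded away from zero, so a large multiple of it
  outweighs \<open>L\<close>.
\<close>
lemma compact_penalty:
  fixes L T :: "'a::topological_space \<Rightarrow> real"
  assumes K: "compact K" and cont: "continuous_on K L" "continuous_on K T"
    and pos: "\<And>x. x \<in> K \<Longrightarrow> T x \<ge> 0" "\<And>x. x \<in> K \<Longrightarrow> T x = 0 \<Longrightarrow> L x > 0"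
  obtains A c where "A > 0" "c > 0" "\<And>x. x \<in> K \<Longrightarrow> c \<le> L x + A * T x"
proof -
  have ex: "\<exists>m>0. \<forall>x\<in>K'. m \<le> f x"
    if "compact K'" "continuous_on K' f" "\<And>x. x \<in> K' \<Longrightarrow> f x > 0" for K' and f :: "'a \<Rightarrow> real"
  proof (cases "K' = {}")
    case False
    then show ?thesis using continuous_attains_inf[OF that(1) False that(2)] that(3) by blast
  qed (auto intro: exI[of _ 1])
  have "\<exists>b. \<forall>x\<in>K. \<bar>L x\<bar> \<le> b"
    using compact_imp_bounded[OF compact_continuous_image[OF cont(1) K]] by (auto simp: bounded_iff)
  then obtain b where b: "\<And>x. x \<in> K \<Longrightarrow> \<bar>L x\<bar> \<le> b" by blast
  define K' where "K' = K \<inter> L -` {..0}"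
  have K': "compact K'"
  proof -
    have "closedin (top_of_set K) (K \<inter> L -` {..0})"
      by (rule continuous_closedin_preimage[OF cont(1)]) auto
    then show ?thesis unfolding K'_def using K closedin_compact by blast
  qed
  have "\<exists>m>0. \<forall>x\<in>K'. m \<le> T x"
  proof (rule ex[OF K'])
    show "continuous_on K' T" by (rule continuous_on_subset[OF cont(2)]) (auto simp: K'_def)
    fix x assume "x \<in> K'"
    then have "x \<in> K" "L x \<le> 0" by (auto simp: K'_def)
    then show "T x > 0" using pos[of x] by (meson le_less not_less)
  qed
  then obtain m where m: "m > 0" "\<And>x. x \<in> K' \<Longrightarrow> m \<le> T x" by blast
  define A where "A = (\<bar>b\<bar> + 1) / m"
  have A: "A > 0" using m by (simp add: A_def add_nonneg_pos)
  have "\<exists>c>0. \<forall>x\<in>K. c \<le> L x + A * T x"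
  proof (rule ex[OF K])
    show "continuous_on K (\<lambda>x. L x + A * T x)" by (intro continuous_intros cont)
    fix x assume x: "x \<in> K"
    show "L x + A * T x > 0"
    proof (cases "L x \<le> 0")
      case True
      then have "A * m \<le> A * T x" using m(2)[of x] x A by (intro mult_left_mono) (auto simp: K'_def)
      moreover have "A * m = \<bar>b\<bar> + 1" using m by (simp add: A_def)
      ultimately show ?thesis using b[OF x] by linarith
    next
      case False
      then show ?thesis using pos(1)[OF x] A by (simp add: add_pos_nonneg)
    qed
  qed
  with A that show ?thesis by blast
qed

lemma C2_on_continuous:
  assumes "C2_on U \<rho>"
  shows "continuous_on U \<rho>" "continuous_on U (total_deriv \<rho>)" "continuous_on U (total_deriv (total_deriv \<rho>))"
  using assms C1_on_imp_continuous_on by (auto simp: C2_on_def C1_on_def)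

lemma frontier_penalized_levi:
  fixes \<rho> :: "complex ^ 'n \<Rightarrow> real"
  assumes F: "compact F" "F \<subseteq> U" and C2: "C2_on U \<rho>"
    and pos: "\<And>p v. p \<in> F \<Longrightarrow> deriv1 \<rho> p v = 0 \<Longrightarrow> deriv1 \<rho> p (\<i> *s v) = 0 \<Longrightarrow> v \<noteq> 0 \<Longrightarrow> levi_real \<rho> p v > 0"
  obtains A c where "A > 0" "c > 0"
    "\<And>p v. p \<in> F \<Longrightarrow> c * (norm v)\<^sup>2 \<le> penalized_levi A (total_deriv \<rho> p) (total_deriv (total_deriv \<rho>) p) v"
proof -
  let ?K = "F \<times> sphere (0 :: complex ^ 'n) 1"
  have K: "compact ?K" using F by (intro compact_Times) auto
  have c1: "continuous_on ?K (\<lambda>x. total_deriv \<rho> (fst x))" "continuous_on ?K (\<lambda>x. total_deriv (total_deriv \<rho>) (fst x))"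
    using F by (auto intro!: continuous_on_compose2[OF C2_on_continuous(2)[OF C2]] continuous_on_compose2[OF C2_on_continuous(3)[OF C2]] continuous_intros)
  have ci: "continuous_on ?K (\<lambda>x. \<i> *s snd x)"
    by (intro linear_continuous_on_compose[OF _ linear_smult_i] continuous_intros)
  have "continuous_on ?K (\<lambda>x. levi_real \<rho> (fst x) (snd x))"
    unfolding levi_real_def by (intro continuous_intros blinfun.continuous_on c1 ci)
  moreover have "continuous_on ?K (\<lambda>x. (deriv1 \<rho> (fst x) (snd x))\<^sup>2 + (deriv1 \<rho> (fst x) (\<i> *s snd x))\<^sup>2)"
    by (intro continuous_intros blinfun.continuous_on c1 ci)
  ultimately obtain A c where Ac: "A > 0" "c > 0"
    "\<And>x. x \<in> ?K \<Longrightarrow> c \<le> levi_real \<rho> (fst x) (snd x) + A * ((deriv1 \<rho> (fst x) (snd x))\<^sup>2 + (deriv1 \<rho> (fst x) (\<i> *s snd x))\<^sup>2)"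
  proof (rule compact_penalty[OF K])
    fix x assume x: "x \<in> ?K" and "(deriv1 \<rho> (fst x) (snd x))\<^sup>2 + (deriv1 \<rho> (fst x) (\<i> *s snd x))\<^sup>2 = 0"
    then have "deriv1 \<rho> (fst x) (snd x) = 0" "deriv1 \<rho> (fst x) (\<i> *s snd x) = 0"
      by (simp_all add: sum_power2_eq_zero_iff)
    then show "levi_real \<rho> (fst x) (snd x) > 0" using x by (intro pos) auto
  qed (auto intro: that)
  show ?thesis
  proof (rule that[OF Ac(1,2)])
    fix p v assume p: "p \<in> F"
    show "c * (norm v)\<^sup>2 \<le> penalized_levi A (total_deriv \<rho> p) (total_deriv (total_deriv \<rho>) p) v"
    proof (cases "v = 0")
      case True
      then show ?thesis using penalized_levi_scale[of A _ _ 0 v] by simp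
    next
      case False
      define w where "w = (1 / norm v) *\<^sub>R v"
      have v: "v = norm v *\<^sub>R w" using False by (simp add: w_def)
      have "c \<le> penalized_levi A (total_deriv \<rho> p) (total_deriv (total_deriv \<rho>) p) w"
        using Ac(3)[of "(p, w)"] p False by (simp add: penalized_levi_def levi_real_def w_def)
      then have "(norm v)\<^sup>2 * c \<le> (norm v)\<^sup>2 * penalized_levi A (total_deriv \<rho> p) (total_deriv (total_deriv \<rho>) p) w"
        by (intro mult_left_mono) auto
      also have "\<dots> = penalized_levi A (total_deriv \<rho> p) (total_deriv (total_deriv \<rho>) p) v"
        by (simp only: penalized_levi_scale[symmetric] v[symmetric])
      finally show ?thesis by (simp add: mult.commute)
    qed
  qed
qed

lemma C2_norm_diff_bounds:
  fixes \<rho> \<sigma> :: "complex ^ 'n \<Rightarrow> real"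
  assumes C2: "C2_on U \<rho>" "C2_on U \<sigma>" and U: "open U" "z \<in> U" and e: "C2_norm U (\<lambda>z. \<rho> z - \<sigma> z) < ennreal e"
  shows "\<bar>\<rho> z - \<sigma> z\<bar> < e" "norm (total_deriv \<rho> z - total_deriv \<sigma> z) < e"
    "norm (total_deriv (total_deriv \<rho>) z - total_deriv (total_deriv \<sigma>) z) < e"
proof -
  let ?g = "\<lambda>z. \<rho> z - \<sigma> z"
  have d1: "total_deriv ?g w = total_deriv \<rho> w - total_deriv \<sigma> w" if "w \<in> U" for w
  proof (rule total_deriv_eqI)
    show "(?g has_derivative blinfun_apply (total_deriv \<rho> w - total_deriv \<sigma> w)) (at w)"
      using has_derivative_diff[OF C2_on_has_derivative(1)[OF C2(1) that] C2_on_has_derivative(1)[OF C2(2) that]]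
      by (simp add: minus_blinfun.rep_eq)
  qed
  have d2: "total_deriv (total_deriv ?g) z = total_deriv (total_deriv \<rho>) z - total_deriv (total_deriv \<sigma>) z"
  proof (rule total_deriv_eqI)
    have "(total_deriv \<rho> has_derivative blinfun_apply (total_deriv (total_deriv \<rho>) z)) (at z)"
      "(total_deriv \<sigma> has_derivative blinfun_apply (total_deriv (total_deriv \<sigma>) z)) (at z)"
      using C2 U by (auto simp: C2_on_def C1_on_def intro!: total_deriv_has_derivative)
    from has_derivative_diff[OF this]
    have "((\<lambda>w. total_deriv \<rho> w - total_deriv \<sigma> w) has_derivative
       blinfun_apply (total_deriv (total_deriv \<rho>) z - total_deriv (total_deriv \<sigma>) z)) (at z)"
      by (simp add: minus_blinfun.rep_eq)
    then show "(total_deriv ?g has_derivative blinfun_apply (total_deriv (total_deriv \<rho>) z - total_deriv (total_deriv \<sigma>) z)) (at z)"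
      by (rule has_derivative_transform_within_open[OF _ U]) (simp add: d1)
  qed
  let ?a = "SUP x\<in>U. ennreal (norm (?g x))" and ?b = "SUP x\<in>U. ennreal (norm (total_deriv ?g x))"
    and ?c = "SUP x\<in>U. ennreal (norm (total_deriv (total_deriv ?g) x))"
  have "ennreal (norm (?g z)) \<le> ?a" "ennreal (norm (total_deriv ?g z)) \<le> ?b"
    "ennreal (norm (total_deriv (total_deriv ?g) z)) \<le> ?c"
    by (rule SUP_upper[OF U(2)])+
  moreover have "?a \<le> ?a + ?b + ?c" "?b \<le> ?a + ?b + ?c" "?c \<le> ?a + ?b + ?c"
    by (simp_all add: add_increasing add_increasing2)
  ultimately have "ennreal (norm (?g z)) < ennreal e" "ennreal (norm (total_deriv ?g z)) < ennreal e"
    "ennreal (norm (total_deriv (total_deriv ?g) z)) < ennreal e"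
    using e unfolding C2_norm_def by (meson order_le_less_trans order_trans)+
  then show "\<bar>\<rho> z - \<sigma> z\<bar> < e" "norm (total_deriv \<rho> z - total_deriv \<sigma> z) < e"
    "norm (total_deriv (total_deriv \<rho>) z - total_deriv (total_deriv \<sigma>) z) < e"
    using d1[OF U(2)] d2 by (simp_all add: ennreal_less_iff)
qed

lemma connected_sublevel:
  fixes h :: "'a::topological_space \<Rightarrow> real"
  assumes "connected X" "continuous_on X h" "x \<in> X" "h x < t" "\<And>z. z \<in> X \<Longrightarrow> h z \<noteq> t" "y \<in> X"
  shows "h y < t"
proof (rule ccontr)
  assume "\<not> h y < t"
  then have "t \<in> {h x..h y}" using assms(4) by auto
  moreover have "connected (h ` X)" using connected_continuous_image assms(1,2) by blast
  ultimately have "t \<in> h ` X" using connected_contains_Icc[of "h ` X" "h x" "h y"] assms(3,6) by blast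
  then show False using assms(5) by auto
qed

lemma C2_converges_uniformly:
  fixes Dk :: "nat \<Rightarrow> (complex ^ 'n) set"
  assumes "C2_converges Dk D"
  obtains U \<rho>0 \<rho> where "closure D \<subseteq> U" "C2_defining_function D U \<rho>0"
    "\<And>k. k \<ge> 1 \<Longrightarrow> C2_on U (\<rho> k) \<and> Dk k = {z \<in> U. \<rho> k z < 0}"
    "\<And>e. e > 0 \<Longrightarrow> \<forall>\<^sub>F k in sequentially. \<forall>z\<in>U. \<bar>\<rho> k z - \<rho>0 z\<bar> < e \<and>
       norm (total_deriv (\<rho> k) z - total_deriv \<rho>0 z) < e \<and>
       norm (total_deriv (total_deriv (\<rho> k)) z - total_deriv (total_deriv \<rho>0) z) < e"
proof -
  obtain U \<rho>0 \<rho> where U: "closure D \<subseteq> U" "C2_defining_function D U \<rho>0"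
    "\<And>k. k \<ge> 1 \<Longrightarrow> C2_on U (\<rho> k) \<and> Dk k = {z \<in> U. \<rho> k z < 0}"
    and lim: "(\<lambda>k. C2_norm U (\<lambda>z. \<rho> k z - \<rho>0 z)) \<longlonglongrightarrow> 0"
    using assms unfolding C2_converges_def by blast
  have U0: "open U" "C2_on U \<rho>0" using U(2) by (auto simp: C2_defining_function_def)
  have "\<forall>\<^sub>F k in sequentially. \<forall>z\<in>U. \<bar>\<rho> k z - \<rho>0 z\<bar> < e \<and>
       norm (total_deriv (\<rho> k) z - total_deriv \<rho>0 z) < e \<and>
       norm (total_deriv (total_deriv (\<rho> k)) z - total_deriv (total_deriv \<rho>0) z) < e" if "e > 0" for e
  proof -
    have "\<forall>\<^sub>F k in sequentially. C2_norm U (\<lambda>z. \<rho> k z - \<rho>0 z) < ennreal e"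
      using that by (intro order_tendstoD(2)[OF lim]) simp
    then show ?thesis using eventually_ge_at_top[of 1]
    proof eventually_elim
      case (elim k)
      show ?case using C2_norm_diff_bounds[OF _ U0(2,1) _ elim(1)] U(3)[OF elim(2)] by blast
    qed
  qed
  with U that show ?thesis by blast
qed

text \<open>
  Outside the closure a zero would be a local minimum, which the nonvanishing derivative excludes.
\<close>
lemma defining_function_positive_outside:
  fixes \<rho> :: "complex ^ 'n \<Rightarrow> real"
  assumes f: "C2_defining_function D U \<rho>" and z: "z \<in> U" "z \<notin> closure D" "total_deriv \<rho> z \<noteq> 0"
  shows "\<rho> z > 0"
proof -
  have U: "open U" "C2_on U \<rho>" "D \<inter> U = {z \<in> U. \<rho> z < 0}" using f by (auto simp: C2_defining_function_def)
  have V: "open (U - closure D)" "z \<in> U - closure D" using U z by auto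
  have nn: "\<rho> w \<ge> 0" if "w \<in> U - closure D" for w
    using that U(3) closure_subset[of D] by (metis (mono_tags, lifting) DiffD1 DiffD2 IntD1 mem_Collect_eq not_le subsetD)
  have "\<rho> z \<noteq> 0"
  proof
    assume 0: "\<rho> z = 0"
    have "(\<rho> has_derivative deriv1 \<rho> z) (at z)" using C2_on_has_derivative(1)[OF U(2) z(1)] .
    then have "deriv1 \<rho> z = (\<lambda>v. 0)"
      using V nn 0 by (intro differential_zero_maxmin[OF V(2,1)]) auto
    then have "total_deriv \<rho> z = 0" by (intro blinfun_eqI) simp
    with z(3) show False by simp
  qed
  with nn[of z] z show ?thesis by force
qed

text \<open>
  Positivity of the penalized Levi form and nonvanishing of the gradient extend from the boundary of
  \<open>D\<close> to an open collar \<open>N\<close>, and \<open>D \<union> N\<close> contains a compact neighbourhood \<open>K\<close> of the closure of \<open>D\<close>, on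
  which all derivatives are bounded and uniformly continuous. Closeness of the functions and of their
  first two derivatives transfers everything to the approximating functions.

  The approximating domains are sublevel sets in a neighbourhood \<open>U\<close> that may be much larger than \<open>K\<close>.
  They stay in \<open>K\<close> because they are connected, meet \<open>D\<close>, and cannot cross the set at distance \<open>\<eta>\<close> from
  \<open>D\<close>, on which the limit function is positive.
\<close>
lemma uniform_domains:
  fixes Dk :: "nat \<Rightarrow> (complex ^ 'n) set"
  assumes spc: "strongly_pseudoconvex_domain D" and dom: "\<forall>k\<ge>1. is_domain (Dk k)"
    and conv: "C2_converges Dk D"
  obtains W \<eta> B \<epsilon> g A c \<tau> \<rho>0 \<rho> where
    "\<eta> > 0" "B > 0" "\<epsilon> > 0" "g > 0" "A > 0" "c > 0" "\<tau> > 0" "closure D \<subseteq> W" 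
    "C2_domain W \<eta> B \<epsilon> g D \<rho>0"
    "\<forall>\<^sub>F k in sequentially. C2_domain W \<eta> B \<epsilon> g (Dk k) (\<rho> k) \<and> strongly_psc_domain W A c \<tau> (Dk k) (\<rho> k) \<epsilon>"
    "\<forall>e>0. \<forall>\<^sub>F k in sequentially. \<forall>z\<in>W. \<bar>\<rho> k z - \<rho>0 z\<bar> < e"
proof -
  obtain U \<rho>0 \<rho> where clD: "closure D \<subseteq> U" and f0: "C2_defining_function D U \<rho>0"
    and fk: "\<And>k. k \<ge> 1 \<Longrightarrow> C2_on U (\<rho> k) \<and> Dk k = {z \<in> U. \<rho> k z < 0}"
    and close: "\<And>e. e > 0 \<Longrightarrow> \<forall>\<^sub>F k in sequentially. \<forall>z\<in>U. \<bar>\<rho> k z - \<rho>0 z\<bar> < e \<and>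
       norm (total_deriv (\<rho> k) z - total_deriv \<rho>0 z) < e \<and>
       norm (total_deriv (total_deriv (\<rho> k)) z - total_deriv (total_deriv \<rho>0) z) < e"
    by (rule C2_converges_uniformly[OF conv]) blast
  have U: "open U" and C2: "C2_on U \<rho>0" and DU': "D \<inter> U = {z \<in> U. \<rho>0 z < 0}"
    using f0 by (auto simp: C2_defining_function_def)
  have D: "open D" "connected D" "D \<noteq> {}" "bounded D"
    using spc by (auto simp: strongly_pseudoconvex_domain_def is_domain_def)
  have DU: "z \<in> D \<longleftrightarrow> \<rho>0 z < 0" if "z \<in> U" for z using that DU' by blast
  have D_sub_U: "D \<subseteq> U" using clD closure_subset by blast
  note cont = C2_on_continuous[OF C2]
  let ?S = "total_deriv \<rho>0" and ?T = "total_deriv (total_deriv \<rho>0)"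
  obtain V \<rho>1 where f1: "C2_defining_function D V \<rho>1"
    and levi1: "\<forall>p\<in>frontier D. \<forall>v\<in>complex_tangent_space \<rho>1 p. v \<noteq> 0 \<longrightarrow> Re (levi_form \<rho>1 p v) > 0"
    using spc unfolding strongly_pseudoconvex_domain_def by blast
  have F: "compact (frontier D)" "frontier D \<subseteq> U"
    using compact_frontier_bounded[OF D(4)] clD by (simp, auto simp: frontier_def)
  obtain A c0 where A: "A > 0" and c0: "c0 > 0"
    and PL0: "\<And>p v. p \<in> frontier D \<Longrightarrow> c0 * (norm v)\<^sup>2 \<le> penalized_levi A (?S p) (?T p) v"
  proof (rule frontier_penalized_levi[OF F C2])
    show "levi_real \<rho>0 p v > 0" if "p \<in> frontier D" "deriv1 \<rho>0 p v = 0" "deriv1 \<rho>0 p (\<i> *s v) = 0" "v \<noteq> 0" for p v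
      using levi_positive_independent[OF D(1) that(1) f1 f0 _ that(2-4)] levi1 that(1) by blast
  qed (auto intro: that)
  define N where "N = interior {z \<in> U. ?S z \<noteq> 0 \<and> (\<forall>v. c0 / 2 * (norm v)\<^sup>2 \<le> penalized_levi A (?S z) (?T z) v)}"
  have N: "open N" "N \<subseteq> U" "\<And>z. z \<in> N \<Longrightarrow> ?S z \<noteq> 0"
    "\<And>z v. z \<in> N \<Longrightarrow> c0 / 2 * (norm v)\<^sup>2 \<le> penalized_levi A (?S z) (?T z) v"
    unfolding N_def using interior_subset by (auto dest: subsetD[OF interior_subset])
  have FN: "frontier D \<subseteq> N"
  proof
    fix p assume p: "p \<in> frontier D"
    then have pU: "p \<in> U" using F by blast
    have cS: "(?S \<longlongrightarrow> ?S p) (nhds p)" and cT: "(?T \<longlongrightarrow> ?T p) (nhds p)"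
      using cont U pU by (auto simp: continuous_on_eq_continuous_at isCont_def tendsto_nhds_iff)
    have "?S p \<noteq> 0" using f0 p by (auto simp: C2_defining_function_def)
    then have e1: "\<forall>\<^sub>F z in nhds p. ?S z \<noteq> 0" using tendsto_imp_eventually_ne[OF cS] by blast
    have "((\<lambda>z. 2 * norm (?T p - ?T z) + 2 * A * (norm (?S p - ?S z) * (norm (?S p) + norm (?S z)))) \<longlongrightarrow>
        2 * norm (?T p - ?T p) + 2 * A * (norm (?S p - ?S p) * (norm (?S p) + norm (?S p)))) (nhds p)"
      by (intro tendsto_intros cS cT)
    then have "\<forall>\<^sub>F z in nhds p. 2 * norm (?T p - ?T z) + 2 * A * (norm (?S p - ?S z) * (norm (?S p) + norm (?S z))) < c0 / 2"
      using c0 by (intro order_tendstoD(2)) auto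
    moreover have "\<forall>\<^sub>F z in nhds p. z \<in> U" using U pU by (rule eventually_nhds_in_open)
    ultimately have "\<forall>\<^sub>F z in nhds p. z \<in> U \<and> ?S z \<noteq> 0 \<and> (\<forall>v. c0 / 2 * (norm v)\<^sup>2 \<le> penalized_levi A (?S z) (?T z) v)"
      using e1
    proof eventually_elim
      case (elim z)
      have "c0 / 2 * (norm v)\<^sup>2 \<le> penalized_levi A (?S z) (?T z) v" for v
      proof -
        have "\<bar>penalized_levi A (?S p) (?T p) v - penalized_levi A (?S z) (?T z) v\<bar> \<le> c0 / 2 * (norm v)\<^sup>2"
          using elim(1) A by (intro order_trans[OF penalized_levi_perturb] mult_right_mono) auto
        moreover have "c0 * (norm v)\<^sup>2 = 2 * (c0 / 2 * (norm v)\<^sup>2)" by simp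
        ultimately show ?thesis using PL0[OF p, of v] by linarith
      qed
      with elim show ?case by blast
    qed
    then show "p \<in> N" unfolding N_def eventually_nhds interior_def by blast
  qed
  have "closure D \<subseteq> D \<union> N" using FN closure_Un_frontier[of D] by blast
  moreover have cpD: "compact (closure D)" "closure D \<noteq> {}" using D by (auto simp: compact_closure)
  ultimately obtain e1 where e1: "e1 > 0" "{x. infdist x (closure D) \<le> e1} \<subseteq> D \<union> N"
    using compact_in_open_separated[of "closure D" "D \<union> N"] D(1) N(1) by auto
  define d where "d = (\<lambda>x. infdist x (closure D))"
  have contd: "continuous_on X d" for X unfolding d_def by (intro continuous_intros)
  have d0: "d x = 0" if "x \<in> D" for x
    using that closure_subset[of D] by (auto simp: d_def)
  have dtri: "d x \<le> d y + norm (x - y)" for x y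
    using infdist_triangle[of x "closure D" y] by (simp add: d_def dist_norm)
  define \<eta> where "\<eta> = e1 / 2"
  have \<eta>: "\<eta> > 0" using e1 by (simp add: \<eta>_def)
  define K where "K = {x. d x \<le> e1}"
  define W where "W = {x. d x < e1}"
  have KDN: "K \<subseteq> D \<union> N" using e1 by (simp add: K_def d_def)
  then have KU: "K \<subseteq> U" using D_sub_U N(2) by blast
  have WK: "W \<subseteq> K" by (auto simp: W_def K_def)
  have W: "open W" unfolding W_def using contd[of UNIV] by (intro open_Collect_less) (auto simp: continuous_on_eq_continuous_at)
  have "closed K" unfolding K_def using contd[of UNIV] by (intro closed_Collect_le) auto
  moreover have "bounded K"
  proof -
    obtain b where b: "\<And>x. x \<in> closure D \<Longrightarrow> norm x \<le> b"
      using compact_imp_bounded[OF cpD(1)] by (auto simp: bounded_iff)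
    have "norm x \<le> b + e1" if "x \<in> K" for x
    proof -
      obtain y where "y \<in> closure D" "infdist x (closure D) = dist x y"
        using infdist_attains_inf[OF _ cpD(2), of x] by auto
      then show ?thesis using that b[of y] norm_triangle_ineq2[of x y] by (auto simp: K_def d_def dist_norm)
    qed
    then show ?thesis by (auto simp: bounded_iff)
  qed
  ultimately have K: "compact K" by (simp add: compact_eq_bounded_closed)
  have clK: "closure D \<subseteq> W" using cpD e1 by (auto simp: W_def d_def)
  \<comment> \<open>The level \<open>-2\<epsilon>\<close> is chosen such that the points of \<open>K\<close> above it lie in the collar.\<close>
  have inf: "\<exists>m>0. \<forall>x\<in>K'. m \<le> f x"
    if "compact K'" "continuous_on K' f" "\<And>x. x \<in> K' \<Longrightarrow> f x > 0" for K' and f :: "complex ^ 'n \<Rightarrow> real"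
  proof (cases "K' = {}")
    case False
    then show ?thesis using continuous_attains_inf[OF that(1) False that(2)] that(3) by blast
  qed (auto intro: exI[of _ 1])
  have "\<exists>m>0. \<forall>x\<in>closure D - N. m \<le> - \<rho>0 x"
  proof (rule inf)
    show "compact (closure D - N)" using cpD(1) N(1) by (rule compact_diff)
    show "continuous_on (closure D - N) (\<lambda>x. - \<rho>0 x)"
      using clD by (intro continuous_intros continuous_on_subset[OF cont(1)]) auto
    show "- \<rho>0 x > 0" if "x \<in> closure D - N" for x
    proof -
      have "x \<in> D" "x \<in> U" using that FN closure_Un_frontier[of D] D_sub_U clD by blast+
      then show ?thesis using DU[of x] by simp
    qed
  qed
  then obtain m where m: "m > 0" "\<And>x. x \<in> closure D - N \<Longrightarrow> m \<le> - \<rho>0 x" by blast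
  define \<epsilon> where "\<epsilon> = m / 2"
  have \<epsilon>: "\<epsilon> > 0" using m by (simp add: \<epsilon>_def)
  have collar: "z \<in> N" if "z \<in> K" "\<rho>0 z > - 2 * \<epsilon>" for z
  proof (rule ccontr)
    assume "z \<notin> N"
    then have "z \<in> closure D - N" using that(1) KDN closure_subset[of D] by blast
    from m(2)[OF this] that(2) show False by (simp add: \<epsilon>_def)
  qed
  define Kc where "Kc = K \<inter> \<rho>0 -` {- (3 / 2 * \<epsilon>)..}"
  have Kc: "compact Kc"
  proof -
    have "closedin (top_of_set K) Kc" unfolding Kc_def
      by (rule continuous_closedin_preimage[OF continuous_on_subset[OF cont(1) KU]]) auto
    then show ?thesis using K closedin_compact by blast
  qed
  have "\<exists>m>0. \<forall>x\<in>Kc. m \<le> norm (?S x)"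
  proof (rule inf[OF Kc])
    show "continuous_on Kc (\<lambda>x. norm (?S x))"
      using KU by (intro continuous_intros continuous_on_subset[OF cont(2)]) (auto simp: Kc_def)
    show "norm (?S x) > 0" if "x \<in> Kc" for x
      using that collar[of x] N(3)[of x] \<epsilon> by (auto simp: Kc_def)
  qed
  then obtain g2 where g2: "g2 > 0" "\<And>x. x \<in> Kc \<Longrightarrow> g2 \<le> norm (?S x)" by blast
  define g where "g = g2 / 2"
  have g: "g > 0" using g2 by (simp add: g_def)
  have bnd: "\<exists>b. \<forall>x\<in>K. norm (f x) \<le> b" if "continuous_on K f" for f :: "complex ^ 'n \<Rightarrow> 'z::real_normed_vector"
    using compact_imp_bounded[OF compact_continuous_image[OF that K]] by (auto simp: bounded_iff)
  obtain b0 where b0: "\<And>x. x \<in> K \<Longrightarrow> norm (\<rho>0 x) \<le> b0" using bnd[OF continuous_on_subset[OF cont(1) KU]] by blast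
  obtain b1 where b1: "\<And>x. x \<in> K \<Longrightarrow> norm (?S x) \<le> b1" using bnd[OF continuous_on_subset[OF cont(2) KU]] by blast
  obtain b2 where b2: "\<And>x. x \<in> K \<Longrightarrow> norm (?T x) \<le> b2" using bnd[OF continuous_on_subset[OF cont(3) KU]] by blast
  obtain b3 where b3: "\<And>x. x \<in> K \<Longrightarrow> norm x \<le> b3" using bnd[OF continuous_on_id] by auto
  define B where "B = \<bar>b0\<bar> + \<bar>b1\<bar> + \<bar>b2\<bar> + 2 * \<bar>b3\<bar> + 1"
  have B: "B > 0" by (simp add: B_def)
  have B0: "\<bar>\<rho>0 x\<bar> \<le> B - 1" and B1: "norm (?S x) \<le> B - 1" and B2: "norm (?T x) \<le> B - 1" if "x \<in> K" for x
    using b0[OF that] b1[OF that] b2[OF that] by (auto simp: B_def)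
  have B3: "norm (x - y) \<le> B" if "x \<in> K" "y \<in> K" for x y
    using b3[OF that(1)] b3[OF that(2)] norm_triangle_ineq4[of x y] by (simp add: B_def)
  define c where "c = c0 / 4"
  have c: "c > 0" using c0 by (simp add: c_def)
  have "uniformly_continuous_on K ?T"
    by (rule compact_uniformly_continuous[OF continuous_on_subset[OF cont(3) KU] K])
  then obtain \<tau> where \<tau>: "\<tau> > 0" "\<And>x y. x \<in> K \<Longrightarrow> y \<in> K \<Longrightarrow> dist y x < \<tau> \<Longrightarrow> dist (?T y) (?T x) < c / 16"
    unfolding uniformly_continuous_on_def using c by (metis zero_less_divide_iff zero_less_numeral)
  \<comment> \<open>The set that the approximating domains cannot cross.\<close>
  define Sh where "Sh = {x. d x = \<eta>}"
  have "\<exists>m>0. \<forall>x\<in>Sh. m \<le> \<rho>0 x"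
  proof (rule inf)
    have "closed Sh" unfolding Sh_def using contd[of UNIV] by (intro closed_Collect_eq) auto
    moreover have ShK: "Sh \<subseteq> K" using e1 by (auto simp: Sh_def K_def \<eta>_def)
    ultimately show "compact Sh" using K compact_Int_closed[of K Sh] by (simp add: Int_absorb1)
    show "continuous_on Sh \<rho>0" using ShK KU by (intro continuous_on_subset[OF cont(1)]) auto
    show "\<rho>0 x > 0" if x: "x \<in> Sh" for x
    proof (rule defining_function_positive_outside[OF f0])
      have dx: "d x \<noteq> 0" using x \<eta> by (auto simp: Sh_def)
      show "x \<in> U" using x ShK KU by blast
      show "x \<notin> closure D" using dx by (auto simp: d_def)
      then have "x \<in> N" using x ShK KDN closure_subset[of D] by blast
      then show "?S x \<noteq> 0" by (rule N(3))
    qed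
  qed
  then obtain msh where msh: "msh > 0" "\<And>x. x \<in> Sh \<Longrightarrow> msh \<le> \<rho>0 x" by blast
  obtain x0 where x0: "x0 \<in> D" using D by blast
  have rx0: "\<rho>0 x0 < 0" using x0 DU D_sub_U by blast
  \<comment> \<open>The entries of the minimum \<open>e\<close> serve, in this order, the common bound \<open>B\<close>, the collar, the gradient, the
      modulus of continuity, the penalized Levi form, the set at distance \<open>\<eta>\<close>, and the point \<open>x0\<close>.\<close>
  define q where "q = c0 / (4 * (2 + 4 * A * B))"
  have qpos: "4 * (2 + 4 * A * B) > 0" using A B by (simp add: add_pos_pos)
  then have q: "q > 0" using c0 unfolding q_def by (intro divide_pos_pos)
  define e where "e = min (min (min 1 (\<epsilon> / 2)) (min g (c / 32))) (min q (min msh (- \<rho>0 x0)))"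
  have e: "e > 0" "e \<le> 1" "e \<le> \<epsilon> / 2" "e \<le> g" "e \<le> c / 32" "e \<le> q" "e \<le> msh" "e \<le> - \<rho>0 x0"
    using \<epsilon> g c q msh rx0 by (auto simp: e_def)
  have PLe: "2 * e + 2 * A * (e * (2 * B)) \<le> c0 / 4"
  proof -
    from e(6) have "e * (4 * (2 + 4 * A * B)) \<le> c0" using qpos by (simp only: q_def pos_le_divide_eq)
    then show ?thesis by (simp add: algebra_simps)
  qed
  have WU: "W \<subseteq> U" using WK KU by blast
  have DW: "D \<subseteq> W" using clK closure_subset by blast
  have C2W: "C2_on W f" if "C2_on U f" for f :: "complex ^ 'n \<Rightarrow> real"
    using that WU by (auto simp: C2_on_def C1_on_def intro: continuous_on_subset)
  show ?thesis
  proof (rule that[OF \<eta> B \<epsilon> g A c \<tau>(1) clK])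
    show "C2_domain W \<eta> B \<epsilon> g D \<rho>0"
      unfolding C2_domain_def
    proof (intro conjI ballI impI)
      show "D = {z \<in> W. \<rho>0 z < 0}" using DW DU WU by blast
      show "ball z \<eta> \<subseteq> W" if "z \<in> D" for z
      proof
        fix w assume "w \<in> ball z \<eta>"
        then have "norm (w - z) < \<eta>" by (simp add: dist_norm norm_minus_commute)
        with dtri[of w z] d0[OF that] e1(1) show "w \<in> W" by (simp add: W_def \<eta>_def)
      qed
      show "norm (z - w) \<le> B" if "z \<in> D" "w \<in> D" for z w using that DW WK by (intro B3) auto
      show "\<bar>\<rho>0 z\<bar> \<le> B" "norm (?S z) \<le> B" "norm (?T z) \<le> B" if "z \<in> W" for z
        using B0[of z] B1[of z] B2[of z] that WK by auto
      show "g \<le> norm (?S z)" if "z \<in> D" "- \<epsilon> < \<rho>0 z" for z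
        using g2(2)[of z] g2(1) that DW WK \<epsilon> by (auto simp: Kc_def g_def)
    qed (use W C2W[OF C2] in auto)
    show "\<forall>e'>0. \<forall>\<^sub>F k in sequentially. \<forall>z\<in>W. \<bar>\<rho> k z - \<rho>0 z\<bar> < e'"
    proof (intro allI impI)
      fix e' :: real assume "e' > 0"
      from close[OF this] show "\<forall>\<^sub>F k in sequentially. \<forall>z\<in>W. \<bar>\<rho> k z - \<rho>0 z\<bar> < e'"
        by eventually_elim (use WU in blast)
    qed
    show "\<forall>\<^sub>F k in sequentially. C2_domain W \<eta> B \<epsilon> g (Dk k) (\<rho> k) \<and> strongly_psc_domain W A c \<tau> (Dk k) (\<rho> k) \<epsilon>"
      using close[OF e(1)] eventually_ge_at_top[of 1]
    proof eventually_elim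
      case (elim k)
      have cl: "\<bar>\<rho> k z - \<rho>0 z\<bar> < e" "norm (total_deriv (\<rho> k) z - ?S z) < e"
        "norm (total_deriv (total_deriv (\<rho> k)) z - ?T z) < e" if "z \<in> U" for z using elim(1) that by auto
      have C2k: "C2_on U (\<rho> k)" and Dkk: "Dk k = {z \<in> U. \<rho> k z < 0}" using fk[OF elim(2)] by auto
      have conk: "connected (Dk k)" using dom elim(2) by (simp add: is_domain_def)
      have x0k: "x0 \<in> Dk k" using x0 D_sub_U cl(1)[of x0] e(8) by (auto simp: Dkk)
      have dk: "d z < \<eta>" if "z \<in> Dk k" for z
      proof (rule connected_sublevel[OF conk contd x0k _ _ that])
        show "d x0 < \<eta>" using d0[OF x0] \<eta> by simp
        show "d z \<noteq> \<eta>" if "z \<in> Dk k" for z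
        proof
          assume "d z = \<eta>"
          then have "msh \<le> \<rho>0 z" using msh(2) by (simp add: Sh_def)
          moreover have "z \<in> U" "\<rho> k z < 0" using that by (auto simp: Dkk)
          ultimately show False using cl(1)[of z] e(7) by linarith
        qed
      qed
      have DkW: "Dk k \<subseteq> W" using dk e1(1) by (force simp: W_def \<eta>_def)
      have coll: "z \<in> N \<and> g \<le> norm (total_deriv (\<rho> k) z)" if "z \<in> Dk k" "- \<epsilon> < \<rho> k z" for z
      proof -
        have z: "z \<in> K" "z \<in> U" using that DkW WK WU by blast+
        have r: "\<rho>0 z > - (3 / 2 * \<epsilon>)" using cl(1)[OF z(2)] that(2) e(3) by linarith
        then have "z \<in> N" using collar[OF z(1)] \<epsilon> by linarith
        moreover have "2 * g \<le> norm (?S z)" using g2(2)[of z] r z by (simp add: Kc_def g_def)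
        then have "g \<le> norm (total_deriv (\<rho> k) z)"
          using cl(2)[OF z(2)] e(4) norm_triangle_ineq2[of "?S z" "total_deriv (\<rho> k) z"]
          by (simp add: norm_minus_commute)
        ultimately show ?thesis by blast
      qed
      have "C2_domain W \<eta> B \<epsilon> g (Dk k) (\<rho> k)"
        unfolding C2_domain_def
      proof (intro conjI ballI impI)
        show "Dk k = {z \<in> W. \<rho> k z < 0}" using DkW WU by (auto simp: Dkk)
        show "ball z \<eta> \<subseteq> W" if "z \<in> Dk k" for z
        proof
          fix w assume "w \<in> ball z \<eta>"
          then have "norm (w - z) < \<eta>" by (simp add: dist_norm norm_minus_commute)
          with dtri[of w z] dk[OF that] show "w \<in> W" by (simp add: W_def \<eta>_def)
        qed
        show "norm (z - w) \<le> B" if "z \<in> Dk k" "w \<in> Dk k" for z w using that DkW WK by (intro B3) auto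
        fix z assume z: "z \<in> W"
        have zK: "z \<in> K" "z \<in> U" using z WK WU by blast+
        show "\<bar>\<rho> k z\<bar> \<le> B" using B0[OF zK(1)] cl(1)[OF zK(2)] e(2) by linarith
        show "norm (total_deriv (\<rho> k) z) \<le> B"
          using B1[OF zK(1)] cl(2)[OF zK(2)] e(2) norm_triangle_sub[of "total_deriv (\<rho> k) z" "?S z"] by linarith
        show "norm (total_deriv (total_deriv (\<rho> k)) z) \<le> B"
          using B2[OF zK(1)] cl(3)[OF zK(2)] e(2) norm_triangle_sub[of "total_deriv (total_deriv (\<rho> k)) z" "?T z"] by linarith
      next
        show "g \<le> norm (total_deriv (\<rho> k) z)" if "z \<in> Dk k" "- \<epsilon> < \<rho> k z" for z using coll[OF that] by blast
      qed (use W C2W[OF C2k] in auto)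
      moreover have "strongly_psc_domain W A c \<tau> (Dk k) (\<rho> k) \<epsilon>"
        unfolding strongly_psc_domain_def
      proof (intro conjI ballI impI allI)
        fix z v assume z: "z \<in> Dk k" "- \<epsilon> < \<rho> k z"
        have zK: "z \<in> K" "z \<in> U" using z DkW WK WU by blast+
        have "c0 / 2 * (norm v)\<^sup>2 \<le> penalized_levi A (?S z) (?T z) v" using coll[OF z] N(4) by blast
        moreover have "\<bar>penalized_levi A (?S z) (?T z) v - penalized_levi A (total_deriv (\<rho> k) z) (total_deriv (total_deriv (\<rho> k)) z) v\<bar>
            \<le> c0 / 4 * (norm v)\<^sup>2"
        proof (rule order_trans[OF penalized_levi_perturb mult_right_mono])
          have s: "norm (?S z - total_deriv (\<rho> k) z) \<le> e" "norm (?T z - total_deriv (total_deriv (\<rho> k)) z) \<le> e"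
            using cl(2,3)[OF zK(2)] by (simp_all add: norm_minus_commute)
          have "norm (?S z) + norm (total_deriv (\<rho> k) z) \<le> 2 * B"
            using B1[OF zK(1)] cl(2)[OF zK(2)] e(2) norm_triangle_sub[of "total_deriv (\<rho> k) z" "?S z"] by linarith
          then have "norm (?S z - total_deriv (\<rho> k) z) * (norm (?S z) + norm (total_deriv (\<rho> k) z)) \<le> e * (2 * B)"
            using s(1) e(1) by (intro mult_mono) auto
          then have "2 * A * (norm (?S z - total_deriv (\<rho> k) z) * (norm (?S z) + norm (total_deriv (\<rho> k) z))) \<le> 2 * A * (e * (2 * B))"
            using A by (intro mult_left_mono) auto
          with s(2) PLe show "2 * norm (?T z - total_deriv (total_deriv (\<rho> k)) z) +
              2 * A * (norm (?S z - total_deriv (\<rho> k) z) * (norm (?S z) + norm (total_deriv (\<rho> k) z))) \<le> c0 / 4"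
            by linarith
        qed (use A in auto)
        moreover have "c0 / 2 * (norm v)\<^sup>2 = 2 * (c0 / 4 * (norm v)\<^sup>2)" by simp
        ultimately have "c0 / 4 * (norm v)\<^sup>2 \<le> penalized_levi A (total_deriv (\<rho> k) z) (total_deriv (total_deriv (\<rho> k)) z) v"
          by linarith
        then show "c * (norm v)\<^sup>2 \<le> levi_real (\<rho> k) z v + A * ((deriv1 (\<rho> k) z v)\<^sup>2 + (deriv1 (\<rho> k) z (\<i> *s v))\<^sup>2)"
          by (simp add: c_def penalized_levi_def levi_real_def)
      next
        fix z w assume z: "z \<in> Dk k" "w \<in> W" "norm (z - w) < \<tau>"
        have zK: "z \<in> K" "z \<in> U" "w \<in> K" "w \<in> U" using z DkW WK WU by blast+
        have "norm (?T z - ?T w) < c / 16" using \<tau>(2)[OF zK(3,1)] z(3) by (simp add: dist_norm)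
        then show "norm (total_deriv (total_deriv (\<rho> k)) z - total_deriv (total_deriv (\<rho> k)) w) \<le> c / 8"
          using cl(3)[OF zK(2)] cl(3)[OF zK(4)] e(5)
            norm_triangle_ineq4[of "total_deriv (total_deriv (\<rho> k)) z - ?T z" "total_deriv (total_deriv (\<rho> k)) w - ?T w"]
            norm_triangle_ineq[of "(total_deriv (total_deriv (\<rho> k)) z - ?T z) - (total_deriv (total_deriv (\<rho> k)) w - ?T w)" "?T z - ?T w"]
          by (simp add: algebra_simps)
      qed
      ultimately show ?case by blast
    qed
  qed
qed

section \<open>Functions that are 1-Lipschitz for the Kobayashi metric\<close>

text \<open>
  The infinitesimal form of being 1-Lipschitz for the Kobayashi distance. With such functions the mean
  value theorem replaces the integration of the metric along curves.
\<close>
definition kobayashi_lipschitz :: "(complex ^ 'n) set \<Rightarrow> (complex ^ 'n \<Rightarrow> real) \<Rightarrow> bool" where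
  "kobayashi_lipschitz X \<Lambda> \<longleftrightarrow>
     (\<forall>x\<in>X. \<exists>\<Lambda>'. (\<Lambda> has_derivative \<Lambda>') (at x) \<and> (\<forall>\<xi>. \<bar>\<Lambda>' \<xi>\<bar> \<le> kobayashi_metric X x \<xi>))"

lemma segment_bound:
  fixes f :: "'a::real_normed_vector \<Rightarrow> 'b::real_normed_vector"
  assumes ab: "a < b"
    and cont: "\<And>t. a \<le> t \<Longrightarrow> t \<le> b \<Longrightarrow> isCont f (x + t *\<^sub>R v)"
    and der: "\<And>t. a < t \<Longrightarrow> t < b \<Longrightarrow> \<exists>f'. (f has_derivative f') (at (x + t *\<^sub>R v)) \<and> norm (f' v) \<le> h t"
    and H: "continuous_on {a..b} H" "\<And>t. a < t \<Longrightarrow> t < b \<Longrightarrow> (H has_real_derivative h t) (at t)"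
  shows "norm (f (x + b *\<^sub>R v) - f (x + a *\<^sub>R v)) \<le> H b - H a"
proof -
  have "\<forall>t. \<exists>f'. a < t \<and> t < b \<longrightarrow> (f has_derivative f') (at (x + t *\<^sub>R v)) \<and> norm (f' v) \<le> h t"
    using der by blast
  then obtain f' where f': "\<And>t. a < t \<Longrightarrow> t < b \<Longrightarrow> (f has_derivative f' t) (at (x + t *\<^sub>R v))"
    "\<And>t. a < t \<Longrightarrow> t < b \<Longrightarrow> norm (f' t v) \<le> h t" by metis
  have l: "((\<lambda>t. x + t *\<^sub>R v) has_vector_derivative v) (at t)" for t
    by (auto intro!: derivative_eq_intros)
  show ?thesis
  proof (rule differentiable_bound_general[OF ab])
    have "isCont (\<lambda>t. f (x + t *\<^sub>R v)) t" if "a \<le> t" "t \<le> b" for t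
      using isCont_o2[of t "\<lambda>t. x + t *\<^sub>R v" f] cont[OF that] by (auto intro!: continuous_intros)
    then show "continuous_on {a..b} (\<lambda>t. f (x + t *\<^sub>R v))" by (auto intro!: continuous_at_imp_continuous_on)
    show "((\<lambda>t. f (x + t *\<^sub>R v)) has_vector_derivative f' t v) (at t)" if "a < t" "t < b" for t
      using vector_derivative_diff_chain_within[OF l has_derivative_at_withinI[OF f'(1)[OF that]]]
      by (simp add: o_def)
    show "(H has_vector_derivative h t) (at t)" if "a < t" "t < b" for t
      using H(2)[OF that] by (simp add: has_real_derivative_iff_has_vector_derivative)
  qed (use H f' in auto)
qed

text \<open>
  Any two points of \<open>K\<close> are joined by a chain of balls inside \<open>D\<close>, and by compactness the lengths of the
  chains are bounded. The set \<open>L\<close> and the constant \<open>C\<close> are chosen before the function \<open>\<Lambda>\<close>, so they serve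
  all domains that contain a fixed neighbourhood of \<open>L\<close>.
\<close>
lemma chain_bound:
  fixes D :: "'a::euclidean_space set"
  assumes D: "open D" "connected D" and K: "compact K" "K \<subseteq> D"
  obtains L C where "compact L" "L \<subseteq> D" "C \<ge> 0"
    "\<And>\<Lambda> :: 'a \<Rightarrow> real. \<And>M x y. M \<ge> 0 \<Longrightarrow>
       (\<And>x. x \<in> L \<Longrightarrow> \<exists>\<Lambda>'. (\<Lambda> has_derivative \<Lambda>') (at x) \<and> (\<forall>h. \<bar>\<Lambda>' h\<bar> \<le> M * norm h)) \<Longrightarrow>
       x \<in> K \<Longrightarrow> y \<in> K \<Longrightarrow> \<bar>\<Lambda> x - \<Lambda> y\<bar> \<le> C * M"
proof (cases "K = {}")
  case True
  show ?thesis by (rule that[of "{}" 0]) (use True in auto)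
next
  case False
  then obtain x0 where x0: "x0 \<in> K" by blast
  define good where "good = (\<lambda>L M (\<Lambda> :: 'a \<Rightarrow> real).
     \<forall>x\<in>L. \<exists>\<Lambda>'. (\<Lambda> has_derivative \<Lambda>') (at x) \<and> (\<forall>h. \<bar>\<Lambda>' h\<bar> \<le> M * norm h))"
  define P where "P = (\<lambda>y. \<exists>L C. compact L \<and> L \<subseteq> D \<and> C \<ge> 0 \<and>
      (\<forall>\<Lambda> M. M \<ge> 0 \<longrightarrow> good L M \<Lambda> \<longrightarrow> \<bar>\<Lambda> y - \<Lambda> x0\<bar> \<le> C * M))"
  have ball: "\<bar>\<Lambda> x - \<Lambda> y\<bar> \<le> (2 * e) * M"
    if gd: "good (cball a e) M \<Lambda>" and xy: "x \<in> cball a e" "y \<in> cball a e" and M0: "M \<ge> 0" for a x y M e and \<Lambda> :: "'a \<Rightarrow> real"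
  proof -
    obtain \<Lambda>' where \<Lambda>': "\<And>x. x \<in> cball a e \<Longrightarrow> (\<Lambda> has_derivative \<Lambda>' x) (at x)"
      "\<And>x h. x \<in> cball a e \<Longrightarrow> \<bar>\<Lambda>' x h\<bar> \<le> M * norm h"
      using gd unfolding good_def by metis
    have "norm (\<Lambda> x - \<Lambda> y) \<le> M * norm (x - y)"
    proof (rule differentiable_bound[OF convex_cball _ _ xy])
      show "(\<Lambda> has_derivative \<Lambda>' x) (at x within cball a e)" if "x \<in> cball a e" for x
        using \<Lambda>'(1)[OF that] by (rule has_derivative_at_withinI)
      show "onorm (\<Lambda>' x) \<le> M" if "x \<in> cball a e" for x
        using \<Lambda>'(2)[OF that] M0 by (intro onorm_bound) auto
    qed
    also have "\<dots> \<le> M * (2 * e)"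
    proof (rule mult_left_mono[OF _ M0])
      show "norm (x - y) \<le> 2 * e"
        using xy dist_triangle2[of x y a] by (simp add: dist_norm norm_minus_commute)
    qed
    finally show ?thesis by (simp add: mult_ac)
  qed
  have step: "\<exists>L C. compact L \<and> L \<subseteq> D \<and> C \<ge> 0 \<and> (\<forall>\<Lambda> M. M \<ge> 0 \<longrightarrow> good L M \<Lambda> \<longrightarrow> (\<forall>y\<in>cball a e. \<bar>\<Lambda> y - \<Lambda> x0\<bar> \<le> C * M))"
    if Px: "P x" and xa: "x \<in> cball a e" and ae: "cball a e \<subseteq> D" "e > 0" for x a e
  proof -
    obtain L C where LC: "compact L" "L \<subseteq> D" "C \<ge> 0"
      "\<And>\<Lambda> M. M \<ge> 0 \<Longrightarrow> good L M \<Lambda> \<Longrightarrow> \<bar>\<Lambda> x - \<Lambda> x0\<bar> \<le> C * M"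
      using Px unfolding P_def by blast
    have "\<bar>\<Lambda> y - \<Lambda> x0\<bar> \<le> (C + 2 * e) * M" if g: "good (L \<union> cball a e) M \<Lambda>" "M \<ge> 0" and y: "y \<in> cball a e" for \<Lambda> M y
    proof -
      have "good L M \<Lambda>" "good (cball a e) M \<Lambda>" using g by (auto simp: good_def)
      then have "\<bar>\<Lambda> x - \<Lambda> x0\<bar> \<le> C * M" "\<bar>\<Lambda> y - \<Lambda> x\<bar> \<le> (2 * e) * M"
        using LC(4) ball y xa g(2) by blast+
      then show ?thesis by (simp add: distrib_right)
    qed
    with LC ae show ?thesis
      by (intro exI[of _ "L \<union> cball a e"] exI[of _ "C + 2 * e"]) (auto intro: compact_Un)
  qed
  have P: "P y" if "y \<in> D" for y
  proof (rule connected_induction_simple[OF D(2) _ that])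
    show "x0 \<in> D" using x0 K by blast
    show "P x0" unfolding P_def by (intro exI[of _ "{}"] exI[of _ 0]) auto
    fix a assume "a \<in> D"
    then obtain e where e: "e > 0" "cball a e \<subseteq> D" using D(1) open_contains_cball by blast
    show "\<exists>T. openin (top_of_set D) T \<and> a \<in> T \<and> (\<forall>x\<in>T. \<forall>y\<in>T. P x \<longrightarrow> P y)"
    proof (intro exI[of _ "ball a e"] conjI ballI impI)
      show "openin (top_of_set D) (ball a e)"
        using e by (auto intro!: open_subset ball_subset_cball[THEN subset_trans])
      show "a \<in> ball a e" using e by simp
      show "P y" if "x \<in> ball a e" "y \<in> ball a e" "P x" for x y
        using step[OF that(3) _ e(2,1)] that(1,2) unfolding P_def by (meson ball_subset_cball subsetD)
    qed
  qed
  define Q where "Q = (\<lambda>a e L C. e > 0 \<and> compact L \<and> L \<subseteq> D \<and> C \<ge> 0 \<and>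
      (\<forall>\<Lambda> M. M \<ge> 0 \<longrightarrow> good L M \<Lambda> \<longrightarrow> (\<forall>y\<in>cball a e. \<bar>\<Lambda> y - \<Lambda> x0\<bar> \<le> C * M)))"
  have "\<exists>e L C. Q a e L C" if aK: "a \<in> K" for a
  proof -
    obtain e where e: "e > 0" "cball a e \<subseteq> D" using D(1) open_contains_cball aK K by blast
    have "a \<in> cball a e" "P a" using e(1) P aK K by auto
    from step[OF this(2,1) e(2,1)] e(1) show ?thesis unfolding Q_def by blast
  qed
  then obtain e L C where "\<And>a. a \<in> K \<Longrightarrow> Q a (e a) (L a) (C a)" by metis
  then have eLC: "\<And>a. a \<in> K \<Longrightarrow> e a > 0" "\<And>a. a \<in> K \<Longrightarrow> compact (L a)" "\<And>a. a \<in> K \<Longrightarrow> L a \<subseteq> D"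
    "\<And>a. a \<in> K \<Longrightarrow> C a \<ge> 0"
    "\<And>a \<Lambda> M y. a \<in> K \<Longrightarrow> M \<ge> 0 \<Longrightarrow> good (L a) M \<Lambda> \<Longrightarrow> y \<in> cball a (e a) \<Longrightarrow> \<bar>\<Lambda> y - \<Lambda> x0\<bar> \<le> C a * M"
    unfolding Q_def by blast+
  have "K \<subseteq> (\<Union>a\<in>K. ball a (e a))" using eLC(1) by force
  then obtain A where A: "A \<subseteq> K" "finite A" "K \<subseteq> (\<Union>a\<in>A. ball a (e a))"
    using compactE_image[OF K(1), of K "\<lambda>a. ball a (e a)"] by auto
  define L' where "L' = (\<Union>a\<in>A. L a)"
  define C' where "C' = (\<Sum>a\<in>A. C a)"
  have C'0: "C' \<ge> 0" unfolding C'_def using A eLC(4) by (intro sum_nonneg) auto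
  have bd: "\<bar>\<Lambda> y - \<Lambda> x0\<bar> \<le> C' * M" if "good L' M \<Lambda>" "M \<ge> 0" "y \<in> K" for \<Lambda> M y
  proof -
    obtain a where a: "a \<in> A" "y \<in> ball a (e a)" using A(3) \<open>y \<in> K\<close> by blast
    have "good (L a) M \<Lambda>" using that(1) a by (auto simp: good_def L'_def)
    then have "\<bar>\<Lambda> y - \<Lambda> x0\<bar> \<le> C a * M" using eLC(5)[of a M \<Lambda> y] a A that(2) by auto
    also have "C a \<le> C'" unfolding C'_def using a A eLC(4) by (intro member_le_sum) auto
    then have "C a * M \<le> C' * M" using that(2) by (rule mult_right_mono)
    finally show ?thesis .
  qed
  show ?thesis
  proof (rule that[of L' "2 * C'"])
    show "compact L'" unfolding L'_def using A eLC(2) by (intro compact_UN) auto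
    show "L' \<subseteq> D" unfolding L'_def using A eLC(3) by blast
    show "2 * C' \<ge> 0" using C'0 by simp
    fix \<Lambda> :: "'a \<Rightarrow> real" and M x y
    assume M: "0 \<le> M" and g: "\<And>x. x \<in> L' \<Longrightarrow> \<exists>\<Lambda>'. (\<Lambda> has_derivative \<Lambda>') (at x) \<and> (\<forall>h. \<bar>\<Lambda>' h\<bar> \<le> M * norm h)"
      and xy: "x \<in> K" "y \<in> K"
    have "good L' M \<Lambda>" using g by (simp add: good_def)
    from bd[OF this M xy(1)] bd[OF this M xy(2)] show "\<bar>\<Lambda> x - \<Lambda> y\<bar> \<le> 2 * C' * M" by simp
  qed
qed

section \<open>Descent along the inner normal\<close>

lemma smult_complex: "(c :: complex) *s v = Re c *\<^sub>R v + Im c *\<^sub>R (\<i> *s v)"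
  by (auto simp: vec_eq_iff complex_eq_iff)

lemma smult_of_real: "of_real t *s v = t *\<^sub>R (v :: complex ^ 'n)"
  by (simp add: vec_eq_iff complex_eq_iff)

text \<open>
  The vector is the gradient divided by its squared norm. A vector and its multiple by \<open>\<i>\<close> are
  orthogonal over the reals, so \<open>T\<close> vanishes on \<open>\<i>\<nu>\<close>.
\<close>
lemma complex_gradient:
  fixes T :: "(complex ^ 'n) \<Rightarrow>\<^sub>L real"
  assumes g: "g > 0" "g \<le> norm T"
  obtains \<nu> where "norm \<nu> \<le> 1 / g" "\<And>c. blinfun_apply T (c *s \<nu>) = Re c"
proof -
  have lin: "linear (blinfun_apply T)" by (intro bounded_linear.linear blinfun.bounded_linear_right)
  define v where "v = adjoint (blinfun_apply T) 1"
  have v: "blinfun_apply T h = h \<bullet> v" for h using adjoint_works[OF lin, of h 1] by (simp add: v_def)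
  have "norm T \<le> norm v"
    by (rule norm_blinfun_bound) (auto simp: v mult.commute Cauchy_Schwarz_ineq2)
  with g have nv: "norm v \<ge> g" "norm v > 0" by auto
  define \<nu> where "\<nu> = (1 / (norm v)\<^sup>2) *\<^sub>R v"
  have "norm \<nu> = 1 / norm v" using nv by (simp add: \<nu>_def power2_eq_square)
  then have "norm \<nu> \<le> 1 / g" using nv g by (simp add: divide_left_mono)
  moreover have "blinfun_apply T \<nu> = 1" using nv by (simp add: v \<nu>_def dot_square_norm)
  moreover have "blinfun_apply T (\<i> *s \<nu>) = 0"
  proof -
    have "(\<i> *s v) \<bullet> v = Re (\<i> * herm v v)" unfolding Re_herm[symmetric] by (simp add: herm_def sum_distrib_left mult.assoc)
    also have "\<dots> = 0" by (simp add: herm_self)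
    moreover have "\<i> *s \<nu> = (1 / (norm v)\<^sup>2) *\<^sub>R (\<i> *s v)" by (simp add: \<nu>_def vec_eq_iff)
    ultimately show ?thesis by (simp add: v)
  qed
  ultimately show ?thesis
    by (intro that[of \<nu>]; (subst smult_complex)?) (auto simp: blinfun.add_right blinfun.scaleR_right)
qed

text \<open>
  The affine image of the round disc with centre \<open>-a\<close> and radius \<open>R\<close> lies in \<open>X\<close>, and the bound is the
  Poincare metric of that disc at the point with normalized coordinate \<open>x\<close>.
\<close>
lemma moebius_disc:
  fixes w \<nu> :: "complex ^ 'n"
  assumes a: "0 \<le> x" "x < 1" and R: "R > 0"
    and sub: "\<And>\<tau>. norm (\<tau> + of_real a) < R \<Longrightarrow> w + \<tau> *s \<nu> \<in> X"
  shows "kobayashi_metric X (w + (R * x - a) *\<^sub>R \<nu>) \<nu> \<le> 1 / (R * (1 - x\<^sup>2))"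
proof (rule kobayashi_metric_le)
  define m where "m = (\<lambda>\<zeta>::complex. (\<zeta> + of_real x) / (1 + of_real x * \<zeta>))"
  define \<phi> where "\<phi> = (\<lambda>\<zeta>. w + (of_real R * m \<zeta> - of_real a) *s \<nu>)"
  have x2: "x\<^sup>2 < 1" using a by (simp add: abs_square_less_1)
  have den: "1 + of_real x * \<zeta> \<noteq> 0" "norm (m \<zeta>) < 1" if "norm \<zeta> < 1" for \<zeta>
  proof -
    have "(norm (1 + of_real x * \<zeta>))\<^sup>2 - (norm (\<zeta> + of_real x))\<^sup>2 = (1 - x\<^sup>2) * (1 - (norm \<zeta>)\<^sup>2)"
      by (simp add: cmod_power2) algebra
    moreover have "(1 - x\<^sup>2) * (1 - (norm \<zeta>)\<^sup>2) > 0"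
      using x2 that by (intro mult_pos_pos) (auto simp: abs_square_less_1)
    ultimately have "(norm (\<zeta> + of_real x))\<^sup>2 < (norm (1 + of_real x * \<zeta>))\<^sup>2" by simp
    then have lt: "norm (\<zeta> + of_real x) < norm (1 + of_real x * \<zeta>)" by (rule power2_less_imp_less) simp
    then show ne: "1 + of_real x * \<zeta> \<noteq> 0" by auto
    show "norm (m \<zeta>) < 1" using lt ne by (simp add: m_def norm_divide divide_less_eq)
  qed
  show "holomorphic_disc X \<phi>"
    unfolding holomorphic_disc_def
  proof (intro conjI allI)
    show "(\<lambda>t. \<phi> t $ i) holomorphic_on ball 0 1" for i
      unfolding \<phi>_def m_def using den by (auto intro!: holomorphic_intros)
    show "\<phi> ` ball 0 1 \<subseteq> X"
    proof clarify
      fix \<zeta> :: complex assume "\<zeta> \<in> ball 0 1"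
      then have "norm (of_real R * m \<zeta>) < R" using den(2)[of \<zeta>] R by (simp add: norm_mult)
      then show "\<phi> \<zeta> \<in> X" unfolding \<phi>_def by (intro sub) simp
    qed
  qed
  show "\<phi> 0 = w + (R * x - a) *\<^sub>R \<nu>"
    by (simp add: \<phi>_def m_def smult_of_real scaleR_diff_left flip: of_real_mult of_real_diff)
  have "deriv (\<lambda>t. \<phi> t $ i) 0 = (R * (1 - x\<^sup>2)) *\<^sub>R (\<nu> $ i)" for i
    unfolding \<phi>_def m_def
    by (rule DERIV_imp_deriv)
       (auto intro!: derivative_eq_intros simp: power2_eq_square scaleR_conv_of_real algebra_simps)
  then show "deriv_vec \<phi> = (R * (1 - x\<^sup>2)) *\<^sub>R \<nu>" by (simp add: deriv_vec_def vec_eq_iff)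
  show "R * (1 - x\<^sup>2) > 0" using R x2 by simp
qed

text \<open>
  In the complex normal direction \<open>\<rho>(w + \<tau>\<nu>) \<le> -\<sigma> + Re \<tau> + b\<bar>\<tau>\<bar>\<^sup>2\<close>. The right-hand side is negative on
  a round disc that contains the segment from \<open>0\<close> to its centre \<open>-a\<close>. The Poincare length of this
  segment is \<open>1/2 log ((R + a)/(R - a))\<close>, and \<open>(R + a)(R - a) = \<sigma>/b\<close>, so the length is \<open>1/2 log (1/\<sigma>)\<close> up
  to a bounded term.
\<close>
lemma normal_segment_bound:
  assumes pos: "\<eta> > 0" "B > 0" "g > 0"
  obtains s1 C where "s1 > 0" "C \<ge> 0"
    "\<And>X \<rho> w \<Lambda>. C2_domain W \<eta> B \<epsilon> g X \<rho> \<Longrightarrow> w \<in> X \<Longrightarrow> - \<rho> w < \<epsilon> \<Longrightarrow> kobayashi_lipschitz X \<Lambda> \<Longrightarrow>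
       \<exists>w'\<in>X. s1 \<le> - \<rho> w' \<and> \<bar>\<Lambda> w - \<Lambda> w'\<bar> \<le> C + ln (1 / (- \<rho> w)) / 2"
proof -
  \<comment> \<open>The second entry absorbs the Taylor remainder, the third keeps the disc inside the ball of
      radius \<open>\<eta>\<close>.\<close>
  define b where "b = max 1 (max (B / g\<^sup>2) (((1 + sqrt B) / (g * \<eta>))\<^sup>2))"
  have b: "b \<ge> 1" "B / g\<^sup>2 \<le> b" "((1 + sqrt B) / (g * \<eta>))\<^sup>2 \<le> b" by (auto simp: b_def)
  define a where "a = 1 / (2 * b)"
  have a: "a > 0" using b by (simp add: a_def)
  define C where "C = \<bar>ln ((g * \<eta>)\<^sup>2 * b)\<bar> / 2"
  show ?thesis
  proof (rule that[of "1 / (4 * b)" C])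
    show "1 / (4 * b) > 0" using b by simp
    show "C \<ge> 0" by (simp add: C_def)
    fix X \<rho> w \<Lambda> assume dom: "C2_domain W \<eta> B \<epsilon> g X \<rho>" and w: "w \<in> X" and col: "- \<rho> w < \<epsilon>"
      and \<Lambda>: "kobayashi_lipschitz X \<Lambda>"
    define \<sigma> where "\<sigma> = - \<rho> w"
    have wW: "w \<in> W" using w dom_sub[OF dom] by blast
    have \<sigma>: "\<sigma> > 0" "\<sigma> \<le> B" using dom_neg[OF dom w] dom_abs[OF dom wW] by (auto simp: \<sigma>_def)
    have "g \<le> norm (total_deriv \<rho> w)" using dom w col unfolding C2_domain_def by auto
    from complex_gradient[OF pos(3) this] obtain \<nu> where
      \<nu>: "norm \<nu> \<le> 1 / g" "\<And>c. deriv1 \<rho> w (c *s \<nu>) = Re c" by blast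
    define R where "R = sqrt (a\<^sup>2 + \<sigma> / b)"
    have R2: "R\<^sup>2 = a\<^sup>2 + \<sigma> / b" using \<sigma> b by (simp add: R_def)
    have R0: "R > a"
    proof -
      have "a\<^sup>2 < R\<^sup>2" using \<sigma> b by (simp add: R2)
      then show ?thesis by (rule power2_less_imp_less) (use \<sigma> b in \<open>simp add: R_def\<close>)
    qed
    have Rle: "R + a \<le> g * \<eta>"
    proof -
      have sb: "sqrt b > 0" "sqrt b \<le> b" using b by (auto intro: real_le_lsqrt simp: power2_eq_square)
      have "R \<le> a + sqrt (\<sigma> / b)" unfolding R_def using a \<sigma> b sqrt_add_le_add_sqrt[of "a\<^sup>2" "\<sigma> / b"] by simp
      also have "sqrt (\<sigma> / b) \<le> sqrt B / sqrt b" using \<sigma> sb by (simp add: real_sqrt_divide divide_right_mono)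
      finally have "R + a \<le> 2 * a + sqrt B / sqrt b" by simp
      also have "2 * a = 1 / b" by (simp add: a_def)
      also have "1 / b \<le> 1 / sqrt b" using sb by (intro divide_left_mono) auto
      finally have 1: "R + a \<le> (1 + sqrt B) / sqrt b" by (simp add: add_divide_distrib)
      have "sqrt (((1 + sqrt B) / (g * \<eta>))\<^sup>2) \<le> sqrt b" using b(3) by (rule real_sqrt_le_mono)
      then have "(1 + sqrt B) / (g * \<eta>) \<le> sqrt b" using pos by simp
      then have "(1 + sqrt B) / sqrt b \<le> g * \<eta>" using pos sb by (simp add: field_simps)
      with 1 show ?thesis by simp
    qed
    have key: "w + \<tau> *s \<nu> \<in> X \<and> \<rho> (w + \<tau> *s \<nu>) \<le> - \<sigma> + Re \<tau> + b * (norm \<tau>)\<^sup>2"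
      if \<tau>: "norm (\<tau> + of_real a) < R" for \<tau>
    proof -
      have "norm \<tau> < R + a" using \<tau> norm_triangle_ineq4[of "\<tau> + of_real a" "of_real a"] a by simp
      then have nt: "norm \<tau> < g * \<eta>" using Rle by simp
      have "norm (\<tau> *s \<nu>) \<le> norm \<tau> / g" using mult_left_mono[OF \<nu>(1), of "norm \<tau>"] by (simp add: norm_smult)
      moreover have "norm \<tau> / g < \<eta>" using nt pos by (simp add: divide_less_eq mult.commute)
      ultimately have h: "norm (\<tau> *s \<nu>) < \<eta>" and h2: "norm (\<tau> *s \<nu>) \<le> norm \<tau> / g" by auto
      have "(norm (\<tau> *s \<nu>))\<^sup>2 \<le> (norm \<tau> / g)\<^sup>2" using h2 by (intro power_mono) auto
      then have "B / 2 * (norm (\<tau> *s \<nu>))\<^sup>2 \<le> B / 2 * (norm \<tau> / g)\<^sup>2" using pos by (intro mult_left_mono) auto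
      also have "\<dots> = B / g\<^sup>2 / 2 * (norm \<tau>)\<^sup>2" by (simp add: power_divide)
      also have "\<dots> \<le> b * (norm \<tau>)\<^sup>2" using b pos by (intro mult_right_mono) auto
      finally have q: "B / 2 * (norm (\<tau> *s \<nu>))\<^sup>2 \<le> b * (norm \<tau>)\<^sup>2" .
      have r: "\<rho> (w + \<tau> *s \<nu>) \<le> - \<sigma> + Re \<tau> + b * (norm \<tau>)\<^sup>2"
        using dom_taylor_bound[OF dom w h] q unfolding \<nu>(2) \<sigma>_def by linarith
      have "(norm (\<tau> + of_real a))\<^sup>2 < R\<^sup>2" using \<tau> by (intro power_strict_mono) auto
      moreover have "(norm (\<tau> + of_real a))\<^sup>2 = (norm \<tau>)\<^sup>2 + 2 * a * Re \<tau> + a\<^sup>2"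
        by (simp add: cmod_power2) algebra
      ultimately have "(norm \<tau>)\<^sup>2 + Re \<tau> / b < \<sigma> / b" using b by (simp add: R2 a_def)
      then have "b * ((norm \<tau>)\<^sup>2 + Re \<tau> / b) < b * (\<sigma> / b)" using b by (intro mult_strict_left_mono) auto
      then have "b * (norm \<tau>)\<^sup>2 + Re \<tau> < \<sigma>" using b by (simp add: distrib_left)
      with r have "\<rho> (w + \<tau> *s \<nu>) < 0" by linarith
      moreover have "w + \<tau> *s \<nu> \<in> W" using dom_ball[OF dom w] h by (auto simp: dist_norm)
      ultimately show ?thesis using dom_in[OF dom] r by blast
    qed
    have real: "of_real t *s \<nu> = t *\<^sub>R \<nu>" for t by (rule smult_of_real)
    define w' where "w' = w + (- a) *\<^sub>R \<nu>"
    have w': "w' \<in> X" "1 / (4 * b) \<le> - \<rho> w'"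
    proof -
      have k: "w' \<in> X \<and> \<rho> w' \<le> - \<sigma> - a + b * a\<^sup>2"
        using key[of "of_real (- a)"] R0 a unfolding w'_def real[symmetric] by simp
      then show "w' \<in> X" by blast
      have "b * a\<^sup>2 = a / 2" using b by (simp add: a_def power2_eq_square)
      moreover have "a / 2 = 1 / (4 * b)" by (simp add: a_def)
      ultimately show "1 / (4 * b) \<le> - \<rho> w'" using k \<sigma> by linarith
    qed
    have inX: "w + t *\<^sub>R \<nu> \<in> X" if "- a \<le> t" "t \<le> 0" for t
    proof -
      have "norm (complex_of_real t + of_real a) < R" using that R0 unfolding of_real_add[symmetric] norm_of_real by simp
      from key[OF this] show ?thesis by (simp add: real)
    qed
    define H where "H = (\<lambda>t. (ln (R + (t + a)) - ln (R - (t + a))) / 2)"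
    define h where "h = (\<lambda>t. R / (R\<^sup>2 - (t + a)\<^sup>2))"
    have "norm (\<Lambda> (w + 0 *\<^sub>R \<nu>) - \<Lambda> (w + (- a) *\<^sub>R \<nu>)) \<le> H 0 - H (- a)"
    proof (rule segment_bound[where h = h])
      show "- a < 0" using a by simp
      show "isCont \<Lambda> (w + t *\<^sub>R \<nu>)" if "- a \<le> t" "t \<le> 0" for t
        using \<Lambda> inX[OF that] has_derivative_continuous unfolding kobayashi_lipschitz_def by blast
      have HD: "(H has_real_derivative h t) (at t)" if "- a \<le> t" "t \<le> 0" for t
      proof -
        have p: "R + (t + a) > 0" "R - (t + a) > 0" using that R0 a by auto
        have d1: "((\<lambda>t. ln (R + (t + a))) has_real_derivative 1 / (R + (t + a))) (at t)"
          using p(1) by (auto intro!: derivative_eq_intros)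
        have d2: "((\<lambda>t. ln (R - (t + a))) has_real_derivative - (1 / (R - (t + a)))) (at t)"
          using p(2) by (auto intro!: derivative_eq_intros)
        have "(H has_real_derivative (1 / (R + (t + a)) - - (1 / (R - (t + a)))) / 2) (at t)"
          unfolding H_def by (rule DERIV_cdivide[OF DERIV_diff[OF d1 d2]])
        also have "(1 / (R + (t + a)) - - (1 / (R - (t + a)))) / 2 = h t"
        proof -
          have "R\<^sup>2 - (t + a)\<^sup>2 = (R + (t + a)) * (R - (t + a))" by algebra
          then show ?thesis using p by (simp add: h_def add_frac_eq)
        qed
        finally show ?thesis .
      qed
      show "(H has_real_derivative h t) (at t)" if "- a < t" "t < 0" for t using HD that by simp
      show "continuous_on {- a..0} H"
        by (intro continuous_at_imp_continuous_on ballI DERIV_isCont[OF HD]) auto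
      show "\<exists>f'. (\<Lambda> has_derivative f') (at (w + t *\<^sub>R \<nu>)) \<and> norm (f' \<nu>) \<le> h t" if t: "- a < t" "t < 0" for t
      proof -
        obtain \<Lambda>' where \<Lambda>': "(\<Lambda> has_derivative \<Lambda>') (at (w + t *\<^sub>R \<nu>))" "\<bar>\<Lambda>' \<nu>\<bar> \<le> kobayashi_metric X (w + t *\<^sub>R \<nu>) \<nu>"
          using \<Lambda> inX[of t] t unfolding kobayashi_lipschitz_def by auto
        define x where "x = (t + a) / R"
        have x: "0 \<le> x" "x < 1" "R * x - a = t" using t R0 a by (auto simp: x_def)
        have "kobayashi_metric X (w + (R * x - a) *\<^sub>R \<nu>) \<nu> \<le> 1 / (R * (1 - x\<^sup>2))"
          using x R0 a key by (intro moebius_disc) auto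
        also have "1 / (R * (1 - x\<^sup>2)) = h t"
        proof -
          have "R * (1 - x\<^sup>2) = (R\<^sup>2 - (t + a)\<^sup>2) / R" using R0 a by (simp add: x_def power2_eq_square field_simps)
          then show ?thesis by (simp add: h_def)
        qed
        finally show ?thesis using \<Lambda>' x(3) by auto
      qed
    qed
    also have "H 0 - H (- a) = (ln (R + a) - ln (R - a)) / 2" by (simp add: H_def)
    also have "ln (R + a) - ln (R - a) = ln ((R + a)\<^sup>2 * b) + ln (1 / \<sigma>)"
    proof -
      have "(R + a) * (R - a) = \<sigma> / b" using R2 by (simp add: power2_eq_square algebra_simps)
      moreover have "(R + a) / (R - a) = (R + a)\<^sup>2 / ((R + a) * (R - a))"
        using R0 a by (simp add: power2_eq_square)
      ultimately have "(R + a) / (R - a) = (R + a)\<^sup>2 * b * (1 / \<sigma>)" by simp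
      then have "ln ((R + a) / (R - a)) = ln ((R + a)\<^sup>2 * b * (1 / \<sigma>))" by simp
      then show ?thesis using R0 a \<sigma> b by (simp add: ln_div ln_mult)
    qed
    also have "(ln ((R + a)\<^sup>2 * b) + ln (1 / \<sigma>)) / 2 \<le> C + ln (1 / \<sigma>) / 2"
    proof -
      have "(R + a)\<^sup>2 * b \<le> (g * \<eta>)\<^sup>2 * b" using Rle R0 a b by (intro mult_right_mono power_mono) auto
      then have "ln ((R + a)\<^sup>2 * b) \<le> ln ((g * \<eta>)\<^sup>2 * b)" using R0 a b pos by (subst ln_le_cancel_iff) auto
      then show ?thesis by (simp add: C_def)
    qed
    finally have "\<bar>\<Lambda> w - \<Lambda> w'\<bar> \<le> C + ln (1 / \<sigma>) / 2" by (simp add: w'_def)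
    with w' show "\<exists>w'\<in>X. 1 / (4 * b) \<le> - \<rho> w' \<and> \<bar>\<Lambda> w - \<Lambda> w'\<bar> \<le> C + ln (1 / (- \<rho> w)) / 2"
      by (auto simp: \<sigma>_def)
  qed
qed

section \<open>From a gradient bound to a Hoelder bound\<close>

text \<open>
  Along the path \<open>-\<rho>\<close> is at least \<open>t/2\<close>, and \<open>1 / sqrt t\<close> is integrable at \<open>0\<close>. The bound is the same for
  all depths \<open>m\<close>, so that \<open>m\<close> can depend on the endpoints.
\<close>
lemma inward_path_bound:
  fixes F :: "complex ^ 'n \<Rightarrow> complex ^ 'n"
  assumes T: "T \<ge> 0" and N: "norm \<nu> \<le> N" and M: "M \<ge> 0" and m: "m > 0" "m \<le> - \<rho> p"
    and path: "\<And>t. 0 \<le> t \<Longrightarrow> t \<le> T \<Longrightarrow> p + t *\<^sub>R \<nu> \<in> D \<and> - \<rho> p + t / 2 \<le> - \<rho> (p + t *\<^sub>R \<nu>)"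
    and F: "\<And>z. z \<in> D \<Longrightarrow> m \<le> - \<rho> z \<Longrightarrow>
       \<exists>F'. (F has_derivative F') (at z) \<and> (\<forall>h. norm (F' h) \<le> M * norm h / sqrt (- \<rho> z))"
  shows "norm (F (p + T *\<^sub>R \<nu>) - F p) \<le> 2 * sqrt 2 * N * M * sqrt T"
proof (cases "T = 0")
  case False
  define H where "H = (\<lambda>t. 2 * sqrt 2 * N * M * sqrt t)"
  have N0: "N \<ge> 0" using N norm_ge_zero order_trans by blast
  have "norm (F (p + T *\<^sub>R \<nu>) - F (p + 0 *\<^sub>R \<nu>)) \<le> H T - H 0"
  proof (rule segment_bound[where h = "\<lambda>t. sqrt 2 * N * M / sqrt t"])
    show "0 < T" using False T by simp
    show "isCont F (p + t *\<^sub>R \<nu>)" if "0 \<le> t" "t \<le> T" for t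
    proof -
      have "p + t *\<^sub>R \<nu> \<in> D" "m \<le> - \<rho> (p + t *\<^sub>R \<nu>)" using path[OF that] that m by auto
      from F[OF this] show ?thesis using has_derivative_continuous by blast
    qed
    show "continuous_on {0..T} H" unfolding H_def by (intro continuous_intros)
    show "(H has_real_derivative sqrt 2 * N * M / sqrt t) (at t)" if "0 < t" "t < T" for t
      unfolding H_def using that by (auto intro!: derivative_eq_intros simp: divide_simps)
    show "\<exists>F'. (F has_derivative F') (at (p + t *\<^sub>R \<nu>)) \<and> norm (F' \<nu>) \<le> sqrt 2 * N * M / sqrt t"
      if t: "0 < t" "t < T" for t
    proof -
      have pt: "p + t *\<^sub>R \<nu> \<in> D" "- \<rho> p + t / 2 \<le> - \<rho> (p + t *\<^sub>R \<nu>)" using path[of t] t by auto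
      then have "m \<le> - \<rho> (p + t *\<^sub>R \<nu>)" using m t by linarith
      from F[OF pt(1) this] obtain F' where F': "(F has_derivative F') (at (p + t *\<^sub>R \<nu>))"
        "norm (F' \<nu>) \<le> M * norm \<nu> / sqrt (- \<rho> (p + t *\<^sub>R \<nu>))" by blast
      have "t / 2 \<le> - \<rho> (p + t *\<^sub>R \<nu>)" using pt(2) m by linarith
      then have "sqrt (t / 2) \<le> sqrt (- \<rho> (p + t *\<^sub>R \<nu>))" by simp
      then have "M * norm \<nu> / sqrt (- \<rho> (p + t *\<^sub>R \<nu>)) \<le> M * N / sqrt (t / 2)"
        using M N N0 t by (intro frac_le mult_left_mono mult_nonneg_nonneg) auto
      also have "\<dots> = sqrt 2 * N * M / sqrt t" using t by (simp add: real_sqrt_divide)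
      finally show ?thesis using F' order_trans by blast
    qed
  qed
  then show ?thesis by (simp add: H_def)
qed simp

text \<open>
  With \<open>d = \<bar>p - q\<bar>\<close>, both points are moved by \<open>2(B + 1)d\<close> times the same inward vector, and the
  endpoints are joined by a segment of length \<open>d\<close> on which \<open>-\<rho> \<ge> d\<close>. All three pieces contribute
  \<open>O(sqrt d)\<close>. If \<open>p\<close> is far from the boundary, the segment from \<open>p\<close> to \<open>q\<close> suffices.

  The gradient is controlled on the part \<open>-\<rho> \<ge> m\<close> of \<open>D\<close>, where \<open>m\<close> may depend on \<open>p\<close> and \<open>q\<close> but the
  constants do not. This suits a sequence of maps each of which is defined on most of \<open>D\<close>.
\<close>
lemma hoelder_from_gradient:
  fixes D :: "(complex ^ 'n) set"
  assumes dom: "C2_domain W \<eta> B \<epsilon> g D \<rho>" and pos: "\<eta> > 0" "B > 0" "\<epsilon> > 0" "g > 0"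
  obtains d0 C where "d0 > 0" "C \<ge> 0"
    "\<And>p q m M F. p \<in> D \<Longrightarrow> q \<in> D \<Longrightarrow> 0 < norm (p - q) \<Longrightarrow> norm (p - q) < d0 \<Longrightarrow> 0 < m \<Longrightarrow>
       m \<le> - \<rho> p \<Longrightarrow> m \<le> - \<rho> q \<Longrightarrow> m \<le> norm (p - q) \<Longrightarrow> M \<ge> 0 \<Longrightarrow>
       (\<And>z. z \<in> D \<Longrightarrow> m \<le> - \<rho> z \<Longrightarrow>
         \<exists>F'. (F has_derivative F') (at z) \<and> (\<forall>h. norm (F' h) \<le> M * norm h / sqrt (- \<rho> z))) \<Longrightarrow>
       norm (F p - F q :: complex ^ 'n) \<le> C * M * sqrt (norm (p - q))"
proof -
  define N where "N = 1 / g"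
  define k where "k = 2 * (B + 1)"
  have N: "N > 0" and k: "k > 0" using pos by (auto simp: N_def k_def)
  \<comment> \<open>The entries keep the whole path within the range \<open>\<eta>\<close> of the Taylor expansion, keep the segment away from
      the boundary when \<open>p\<close> is far from it, and make the second order term and the change of the
      derivative between \<open>p\<close> and \<open>q\<close> small.\<close>
  define d0 where "d0 = min (min (\<eta> / 2) (\<epsilon> / 2)) (min (\<epsilon> / (2 * B)) (min (\<eta> / (2 * N * k)) (min (1 / (2 * B * N\<^sup>2 * k)) (1 / (4 * B * N)))))"
  have d0: "d0 > 0" using pos N k by (simp add: d0_def)
  define C where "C = 1 + 4 * sqrt 2 * N * sqrt k"
  show ?thesis
  proof (rule that[OF d0, of C])
    show "C \<ge> 0" using N k by (simp add: C_def)
    fix p q m M and F :: "complex ^ 'n \<Rightarrow> complex ^ 'n"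
    assume p: "p \<in> D" and q: "q \<in> D" and pq: "0 < norm (p - q)" "norm (p - q) < d0"
      and m: "0 < m" "m \<le> - \<rho> p" "m \<le> - \<rho> q" "m \<le> norm (p - q)" and M: "M \<ge> 0"
      and F: "\<And>z. z \<in> D \<Longrightarrow> m \<le> - \<rho> z \<Longrightarrow>
         \<exists>F'. (F has_derivative F') (at z) \<and> (\<forall>h. norm (F' h) \<le> M * norm h / sqrt (- \<rho> z))"
    define d where "d = norm (p - q)"
    have d: "d > 0" "d < d0" using pq by (auto simp: d_def)
    have dl: "d < \<eta>" "d < \<epsilon> / 2" "B * d < \<epsilon> / 2" "2 * (N * (k * d)) < \<eta>" "2 * (B * N\<^sup>2 * (k * d)) < 1" "4 * (B * N * d) < 1"
    proof -
      have "d < \<epsilon> / (2 * B)" "d < \<eta> / (2 * N * k)" "d < 1 / (2 * B * N\<^sup>2 * k)" "d < 1 / (4 * B * N)"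
        using d by (auto simp: d0_def)
      then show "B * d < \<epsilon> / 2" "2 * (N * (k * d)) < \<eta>" "2 * (B * N\<^sup>2 * (k * d)) < 1" "4 * (B * N * d) < 1"
        using pos N k by (simp_all add: pos_less_divide_eq mult_ac)
      show "d < \<eta>" "d < \<epsilon> / 2" using d pos by (auto simp: d0_def)
    qed
    have middle: "norm (F x - F y) \<le> M * sqrt d"
      if x: "x \<in> D" "norm (x - y) = d" and far: "d + B * d \<le> - \<rho> x" for x y
    proof -
      have seg: "x + t *\<^sub>R (y - x) \<in> D \<and> d \<le> - \<rho> (x + t *\<^sub>R (y - x))" if "0 \<le> t" "t \<le> 1" for t
      proof -
        have le: "norm (t *\<^sub>R (y - x)) \<le> d" using x that d by (simp add: norm_minus_commute mult_left_le_one_le)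
        then have lt: "norm (t *\<^sub>R (y - x)) < \<eta>" using dl by simp
        have "B * norm (t *\<^sub>R (y - x)) \<le> B * d" using le pos by (intro mult_left_mono) auto
        with dom_lipschitz[OF dom x(1) lt] far have r: "d \<le> - \<rho> (x + t *\<^sub>R (y - x))" by linarith
        moreover have "x + t *\<^sub>R (y - x) \<in> W" using dom_ball[OF dom x(1)] lt by (auto simp: dist_norm)
        ultimately show ?thesis using dom_in[OF dom, of "x + t *\<^sub>R (y - x)"] d by simp
      qed
      have der: "\<exists>F'. (F has_derivative F') (at (x + t *\<^sub>R (y - x))) \<and> norm (F' (y - x)) \<le> M * sqrt d" if "0 \<le> t" "t \<le> 1" for t
      proof -
        have z: "x + t *\<^sub>R (y - x) \<in> D" "d \<le> - \<rho> (x + t *\<^sub>R (y - x))" using seg[OF that] by auto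
        then have "m \<le> - \<rho> (x + t *\<^sub>R (y - x))" using m(4) by (simp add: d_def)
        from F[OF z(1) this] obtain F' where F': "(F has_derivative F') (at (x + t *\<^sub>R (y - x)))"
          "norm (F' (y - x)) \<le> M * norm (y - x) / sqrt (- \<rho> (x + t *\<^sub>R (y - x)))" by blast
        have "M * norm (y - x) / sqrt (- \<rho> (x + t *\<^sub>R (y - x))) \<le> M * d / sqrt d"
          using x(2) z(2) M d by (intro frac_le) (auto simp: norm_minus_commute)
        also have "M * d / sqrt d = M * (d / sqrt d)" by simp
        also have "d / sqrt d = sqrt d" using d by (simp add: real_div_sqrt)
        finally show ?thesis using F' order_trans by blast
      qed
      have "norm (F (x + 1 *\<^sub>R (y - x)) - F (x + 0 *\<^sub>R (y - x))) \<le> M * sqrt d * 1 - M * sqrt d * 0"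
      proof (rule segment_bound[where h = "\<lambda>t. M * sqrt d" and H = "\<lambda>t. M * sqrt d * t"])
        show "isCont F (x + t *\<^sub>R (y - x))" if "0 \<le> t" "t \<le> 1" for t
          using der[OF that] has_derivative_continuous by blast
      qed (use der in \<open>auto intro!: continuous_intros derivative_eq_intros\<close>)
      then show ?thesis by (simp add: norm_minus_commute)
    qed
    have Csq: "C * M * sqrt d = M * sqrt d + 2 * (2 * sqrt 2 * N * M * sqrt (k * d))"
      by (simp add: C_def real_sqrt_mult algebra_simps)
    show "norm (F p - F q) \<le> C * M * sqrt (norm (p - q))"
    proof (cases "- \<rho> p < \<epsilon>")
      case False
      then have "d + B * d \<le> - \<rho> p" using dl by linarith
      then have "norm (F p - F q) \<le> M * sqrt d" by (intro middle p) (simp_all add: d_def)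
      also have "\<dots> \<le> C * M * sqrt d" using Csq N M k d by simp
      finally show ?thesis by (simp add: d_def)
    next
      case True
      then have "g \<le> norm (total_deriv \<rho> p)" using dom p unfolding C2_domain_def by auto
      from complex_gradient[OF pos(4) this] obtain \<nu>0 where \<nu>0: "norm \<nu>0 \<le> N" "\<And>c. deriv1 \<rho> p (c *s \<nu>0) = Re c"
        unfolding N_def by blast
      define \<nu> where "\<nu> = - \<nu>0"
      have \<nu>: "norm \<nu> \<le> N" "deriv1 \<rho> p \<nu> = - 1" using \<nu>0(1) \<nu>0(2)[of 1] by (auto simp: \<nu>_def blinfun.minus_right)
      have Dq: "deriv1 \<rho> q \<nu> \<le> - (3 / 4)"
      proof -
        have n: "norm (q - p) < \<eta>" using dl by (simp add: d_def norm_minus_commute)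
        have "norm (deriv1 \<rho> (p + 1 *\<^sub>R (q - p)) \<nu> - deriv1 \<rho> (p + 0 *\<^sub>R (q - p)) \<nu>) \<le> (B * d * N) * 1 - (B * d * N) * 0"
        proof (rule segment_bound[where h = "\<lambda>t. B * d * N" and H = "\<lambda>t. B * d * N * t"])
          have W: "p + t *\<^sub>R (q - p) \<in> W" if "0 \<le> t" "t \<le> 1" for t using dom_segment[OF dom p n that] .
          show "isCont (\<lambda>z. deriv1 \<rho> z \<nu>) (p + t *\<^sub>R (q - p))" if "0 \<le> t" "t \<le> 1" for t
            using has_derivative_continuous[OF C2_on_has_derivative(2)[OF dom_C2[OF dom] W[OF that]]] .
          show "\<exists>f'. ((\<lambda>z. deriv1 \<rho> z \<nu>) has_derivative f') (at (p + t *\<^sub>R (q - p))) \<and> norm (f' (q - p)) \<le> B * d * N"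
            if "0 < t" "t < 1" for t
          proof -
            have Wt: "p + t *\<^sub>R (q - p) \<in> W" using W that by simp
            have "\<bar>deriv2 \<rho> (p + t *\<^sub>R (q - p)) (q - p) \<nu>\<bar> \<le> norm (total_deriv (total_deriv \<rho>) (p + t *\<^sub>R (q - p))) * norm (q - p) * norm \<nu>"
              by (rule blinfun2_bound)
            also have "\<dots> \<le> B * d * N" using dom_D2[OF dom Wt] \<nu>(1) pos d N
              by (intro mult_mono) (auto simp: d_def norm_minus_commute)
            finally show ?thesis using C2_on_has_derivative(2)[OF dom_C2[OF dom] Wt, of \<nu>] by auto
          qed
        qed (auto intro!: continuous_intros derivative_eq_intros)
        then have "\<bar>deriv1 \<rho> q \<nu> - deriv1 \<rho> p \<nu>\<bar> \<le> B * N * d" by (simp add: mult_ac)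
        then show ?thesis using dl(6) \<nu>(2) by linarith
      qed
      define T where "T = k * d"
      have T: "T > 0" using k d by (simp add: T_def)
      have path: "x + t *\<^sub>R \<nu> \<in> D \<and> - \<rho> x + t / 2 \<le> - \<rho> (x + t *\<^sub>R \<nu>)"
        if x: "x \<in> D" "deriv1 \<rho> x \<nu> \<le> - (3 / 4)" and t: "0 \<le> t" "t \<le> T" for x t
      proof -
        have n: "norm (t *\<^sub>R \<nu>) \<le> t * N" using t \<nu>(1) by (simp add: mult_left_mono)
        also have "t * N \<le> T * N" using t N by (intro mult_right_mono) auto
        also have "\<dots> < \<eta>"
        proof -
          have "0 \<le> N * (k * d)" using N k d by simp
          then show ?thesis using dl(4) by (simp add: T_def mult.commute)
        qed
        finally have lt: "norm (t *\<^sub>R \<nu>) < \<eta>" .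
        have "(norm (t *\<^sub>R \<nu>))\<^sup>2 \<le> (t * N)\<^sup>2" using n by (intro power_mono) auto
        then have "B / 2 * (norm (t *\<^sub>R \<nu>))\<^sup>2 \<le> B / 2 * (t * N)\<^sup>2" using pos by (intro mult_left_mono) auto
        also have "\<dots> = (B * N\<^sup>2 * t) * t / 2" by (simp add: power2_eq_square)
        also have "\<dots> \<le> (1 / 2) * t / 2"
        proof -
          have "B * N\<^sup>2 * t \<le> B * N\<^sup>2 * (k * d)" using t pos N by (intro mult_left_mono) (auto simp: T_def)
          then have "B * N\<^sup>2 * t \<le> 1 / 2" using dl(5) by linarith
          then show ?thesis using t by (intro divide_right_mono mult_right_mono) auto
        qed
        finally have q: "B / 2 * (norm (t *\<^sub>R \<nu>))\<^sup>2 \<le> t / 4" by simp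
        have "deriv1 \<rho> x (t *\<^sub>R \<nu>) \<le> t * (- (3 / 4))" unfolding blinfun.scaleR_right real_scaleR_def using x(2) t by (intro mult_left_mono) auto
        with q dom_taylor_bound[OF dom x(1) lt] have r: "- \<rho> x + t / 2 \<le> - \<rho> (x + t *\<^sub>R \<nu>)" by linarith
        moreover have "x + t *\<^sub>R \<nu> \<in> W" using dom_ball[OF dom x(1)] lt by (auto simp: dist_norm)
        ultimately show ?thesis using dom_in[OF dom, of "x + t *\<^sub>R \<nu>"] dom_neg[OF dom x(1)] t by auto
      qed
      have Dp: "deriv1 \<rho> p \<nu> \<le> - (3 / 4)" using \<nu>(2) by simp
      let ?p = "p + T *\<^sub>R \<nu>" and ?q = "q + T *\<^sub>R \<nu>"
      have a: "norm (F ?p - F p) \<le> 2 * sqrt 2 * N * M * sqrt T"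
        using T path[OF p Dp] by (intro inward_path_bound[OF _ \<nu>(1) M m(1,2) _ F]) auto
      have b: "norm (F ?q - F q) \<le> 2 * sqrt 2 * N * M * sqrt T"
        using T path[OF q Dq] by (intro inward_path_bound[OF _ \<nu>(1) M m(1,3) _ F]) auto
      have c: "norm (F ?p - F ?q) \<le> M * sqrt d"
      proof (rule middle)
        show "?p \<in> D" using path[OF p Dp, of T] T by simp
        show "norm (?p - ?q) = d" by (simp add: d_def)
        have "T / 2 = d + B * d" by (simp add: T_def k_def algebra_simps)
        moreover have "- \<rho> p + T / 2 \<le> - \<rho> ?p" using path[OF p Dp, of T] T by auto
        ultimately show "d + B * d \<le> - \<rho> ?p" using dom_neg[OF dom p] by linarith
      qed
      have "norm (F p - F q) = norm ((F ?p - F ?q) - (F ?p - F p) + (F ?q - F q))" by simp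
      also have "\<dots> \<le> norm (F ?p - F ?q) + norm (F ?p - F p) + norm (F ?q - F q)"
        by (intro norm_triangle_le add_right_mono norm_triangle_ineq4)
      also have "\<dots> \<le> M * sqrt d + 2 * (2 * sqrt 2 * N * M * sqrt T)" using a b c by linarith
      finally show ?thesis using Csq by (simp add: T_def d_def)
    qed
  qed
qed

section \<open>Isometries\<close>

lemma C1_isometry_inverse:
  assumes iso: "C1_isometry X Y f" and op: "open X" "open Y" and w: "w \<in> Y"
  shows "inv_into X f w \<in> X" "f (inv_into X f w) = w"
    "(inv_into X f has_derivative blinfun_apply (total_deriv (inv_into X f) w)) (at w)"
    "kobayashi_metric X (inv_into X f w) (blinfun_apply (total_deriv (inv_into X f) w) \<eta>) = kobayashi_metric Y w \<eta>"
proof -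
  define h where "h = inv_into X f"
  have bij: "bij_betw f X Y" and f: "C1_on X f" and h: "C1_on Y h"
    and F: "\<And>z \<xi>. z \<in> X \<Longrightarrow> kobayashi_metric Y (f z) (blinfun_apply (total_deriv f z) \<xi>) = kobayashi_metric X z \<xi>"
    using iso by (auto simp: C1_isometry_def C1_diffeomorphism_def h_def)
  have hX: "h v \<in> X" and fh: "f (h v) = v" if "v \<in> Y" for v
    using that bij by (auto simp: h_def bij_betw_def inv_into_into f_inv_into_f)
  show "inv_into X f w \<in> X" "f (inv_into X f w) = w" using hX[OF w] fh[OF w] by (auto simp: h_def)
  have dh: "(h has_derivative blinfun_apply (total_deriv h w)) (at w)"
    using h w by (intro total_deriv_has_derivative) (auto simp: C1_on_def)
  then show "(inv_into X f has_derivative blinfun_apply (total_deriv (inv_into X f) w)) (at w)" by (simp add: h_def)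
  have df: "(f has_derivative blinfun_apply (total_deriv f (h w))) (at (h w))"
    using f hX[OF w] by (intro total_deriv_has_derivative) (auto simp: C1_on_def)
  have "((\<lambda>x. f (h x)) has_derivative (\<lambda>v. blinfun_apply (total_deriv f (h w)) (blinfun_apply (total_deriv h w) v))) (at w)"
    using has_derivative_compose[OF dh df] .
  then have "((\<lambda>x. x) has_derivative (\<lambda>v. blinfun_apply (total_deriv f (h w)) (blinfun_apply (total_deriv h w) v))) (at w)"
    by (rule has_derivative_transform_within_open[OF _ op(2) w]) (simp add: fh)
  then have "(\<lambda>v. blinfun_apply (total_deriv f (h w)) (blinfun_apply (total_deriv h w) v)) = (\<lambda>v. v)"
    using has_derivative_unique has_derivative_ident by blast
  then have "blinfun_apply (total_deriv f (h w)) (blinfun_apply (total_deriv h w) \<eta>) = \<eta>" by meson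
  with F[OF hX[OF w], of "blinfun_apply (total_deriv h w) \<eta>"]
  show "kobayashi_metric X (inv_into X f w) (blinfun_apply (total_deriv (inv_into X f) w) \<eta>) = kobayashi_metric Y w \<eta>"
    by (simp add: fh w h_def[symmetric])
qed

text \<open>
  The function \<open>l(s) = 1/2 log (s/(1 + Cs))\<close> is a primitive of \<open>1/(2s(1 + Cs))\<close>, so the bound for
  \<open>deriv1\<close> says that \<open>l(-\<rho>)\<close> is 1-Lipschitz on \<open>X\<close>. The isometry transports it to \<open>Y\<close>.
\<close>
lemma isometry_pullback_lipschitz:
  assumes iso: "C1_isometry X Y f" and dX: "C2_domain W \<eta> B \<epsilon> g X \<rho>" and op: "open Y" and C: "C > 0"
    and bd: "\<And>z \<xi>. z \<in> X \<Longrightarrow> \<bar>deriv1 \<rho> z \<xi>\<bar> \<le> 2 * (- \<rho> z) * (1 + C * (- \<rho> z)) * kobayashi_metric X z \<xi>"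
  shows "kobayashi_lipschitz Y (\<lambda>w. (ln (- \<rho> (inv_into X f w)) - ln (1 + C * (- \<rho> (inv_into X f w)))) / 2)"
  unfolding kobayashi_lipschitz_def
proof
  fix w assume w: "w \<in> Y"
  let ?h = "inv_into X f"
  let ?H = "blinfun_apply (total_deriv ?h w)"
  note I = C1_isometry_inverse[OF iso dom_open[OF dX] op w]
  define s where "s = - \<rho> (?h w)"
  have s: "s > 0" using dom_neg[OF dX I(1)] by (simp add: s_def)
  have hW: "?h w \<in> W" using I(1) dom_sub[OF dX] by blast
  define l where "l = (\<lambda>x. (ln x - ln (1 + C * x)) / 2)"
  have cs: "1 + C * s > 0" using C s by (simp add: add_pos_pos)
  have "(l has_real_derivative (1 / s - C / (1 + C * s)) / 2) (at s)"
    unfolding l_def using s cs by (auto intro!: derivative_eq_intros)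
  moreover have "(1 / s - C / (1 + C * s)) / 2 = 1 / (2 * s * (1 + C * s))"
    using s cs by (simp add: field_simps)
  ultimately have "(l has_derivative (\<lambda>x. 1 / (2 * s * (1 + C * s)) * x)) (at s)"
    by (metis has_field_derivative_def)
  then have dl: "(l has_derivative (\<lambda>x. 1 / (2 * s * (1 + C * s)) * x)) (at (- \<rho> (?h w)))"
    by (simp only: s_def[symmetric])
  have dr: "((\<lambda>w. - \<rho> (?h w)) has_derivative (\<lambda>v. - deriv1 \<rho> (?h w) (?H v))) (at w)"
    by (intro has_derivative_minus has_derivative_compose[OF I(3) C2_on_has_derivative(1)[OF dom_C2[OF dX] hW]])
  have "((\<lambda>w. l (- \<rho> (?h w))) has_derivative (\<lambda>v. 1 / (2 * s * (1 + C * s)) * (- deriv1 \<rho> (?h w) (?H v)))) (at w)"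
    by (rule has_derivative_compose[OF dr dl])
  moreover have "\<bar>1 / (2 * s * (1 + C * s)) * (- deriv1 \<rho> (?h w) (?H v))\<bar> \<le> kobayashi_metric Y w v" for v
  proof -
    have q: "2 * s * (1 + C * s) > 0" using s cs by simp
    have "\<bar>deriv1 \<rho> (?h w) (?H v)\<bar> \<le> 2 * s * (1 + C * s) * kobayashi_metric Y w v"
      using bd[OF I(1), of "?H v"] I(4)[of v] by (simp add: s_def)
    then have "\<bar>deriv1 \<rho> (?h w) (?H v)\<bar> / (2 * s * (1 + C * s)) \<le> kobayashi_metric Y w v"
      using q by (simp add: pos_divide_le_eq mult.commute)
    moreover have "\<bar>1 / (2 * s * (1 + C * s)) * (- deriv1 \<rho> (?h w) (?H v))\<bar> = \<bar>deriv1 \<rho> (?h w) (?H v)\<bar> / (2 * s * (1 + C * s))"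
    proof -
      have "\<bar>1 / a * (- x)\<bar> = \<bar>x\<bar> / a" if "a > 0" for a x :: real using that by (simp add: abs_mult)
      from this[OF q] show ?thesis .
    qed
    ultimately show ?thesis by linarith
  qed
  ultimately show "\<exists>\<Lambda>'. ((\<lambda>w. (ln (- \<rho> (?h w)) - ln (1 + C * (- \<rho> (?h w)))) / 2) has_derivative \<Lambda>') (at w)
      \<and> (\<forall>\<xi>. \<bar>\<Lambda>' \<xi>\<bar> \<le> kobayashi_metric Y w \<xi>)"
    unfolding l_def by blast
qed

section \<open>The boundary distance under the isometries\<close>

lemma ln_reciprocal: "x > 0 \<Longrightarrow> ln (1 / x) = - ln (x :: real)"
  by (simp add: ln_div)

lemma compact_sublevel:
  assumes dom: "C2_domain W \<eta> B \<epsilon> g D \<rho>" and cl: "closure D \<subseteq> W" and t: "t > 0" and bd: "bounded D"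
  shows "compact {w \<in> closure D. \<rho> w \<le> - t}" "{w \<in> closure D. \<rho> w \<le> - t} \<subseteq> D"
proof -
  have "closedin (top_of_set (closure D)) (closure D \<inter> \<rho> -` {..- t})"
    by (rule continuous_closedin_preimage[OF continuous_on_subset[OF dom_cont[OF dom] cl]]) auto
  then have "compact (closure D \<inter> \<rho> -` {..- t})"
    using bd closedin_compact by (metis compact_closure)
  moreover have "closure D \<inter> \<rho> -` {..- t} = {w \<in> closure D. \<rho> w \<le> - t}" by auto
  ultimately show "compact {w \<in> closure D. \<rho> w \<le> - t}" by simp
  show "{w \<in> closure D. \<rho> w \<le> - t} \<subseteq> D"
    using cl t dom_in[OF dom] by force
qed

lemma compact_inside_uniformly:
  fixes D :: "(complex ^ 'n) set"
  assumes dom: "C2_domain W \<eta> B \<epsilon> g D \<rho>0" and L: "compact L" "L \<subseteq> D" 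
    and ev: "\<forall>\<^sub>F k in sequentially. C2_domain W \<eta> B \<epsilon> g (Dk k) (\<rho> k)"
    and close: "\<forall>e>0. \<forall>\<^sub>F k in sequentially. \<forall>z\<in>W. \<bar>\<rho> k z - \<rho>0 z\<bar> < e"
  obtains d where "d > 0" "\<forall>\<^sub>F k in sequentially. \<forall>x\<in>L. ball x d \<subseteq> Dk k"
proof (cases "L = {}")
  case True
  show ?thesis by (rule that[of 1]) (use True in auto)
next
  case False
  obtain d where d: "d > 0" "{x. infdist x L \<le> d} \<subseteq> D"
    using compact_in_open_separated[OF False L(1) dom_open[OF dom] L(2)] by blast
  have comp: "compact {x. infdist x L \<le> d}"
    using compact_infdist_le[OF False L(1) d(1)] .
  have cont: "continuous_on {x. infdist x L \<le> d} \<rho>0"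
    using d(2) dom_sub[OF dom] by (intro continuous_on_subset[OF dom_cont[OF dom]]) auto
  have "{x. infdist x L \<le> d} \<noteq> {}"
  proof -
    obtain x where "x \<in> L" using False by blast
    then have "infdist x L \<le> d" using d(1) by simp
    then show ?thesis by blast
  qed
  from continuous_attains_sup[OF comp this cont] obtain y where y: "infdist y L \<le> d"
    "\<And>x. infdist x L \<le> d \<Longrightarrow> \<rho>0 x \<le> \<rho>0 y" by auto
  have ry: "\<rho>0 y < 0" using y(1) d(2) dom_neg[OF dom] by auto
  show ?thesis
  proof (rule that[OF d(1)])
    have "- \<rho>0 y > 0" using ry by simp
    from close[rule_format, OF this] ev show "\<forall>\<^sub>F k in sequentially. \<forall>x\<in>L. ball x d \<subseteq> Dk k"
    proof eventually_elim
      case (elim k)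
      show ?case
      proof (intro ballI subsetI)
        fix x z assume x: "x \<in> L" "z \<in> ball x d"
        then have "infdist z L \<le> d" using infdist_le[OF x(1), of z] by (simp add: dist_commute)
        then have z: "z \<in> D" "\<rho>0 z \<le> \<rho>0 y" using d(2) y(2) by auto
        then have "z \<in> W" using dom_sub[OF dom] by blast
        then have "\<rho> k z < 0" using elim(1) z(2) by fastforce
        then show "z \<in> Dk k" using dom_in[OF elim(2)] \<open>z \<in> W\<close> by blast
      qed
    qed
  qed
qed

text \<open>
  An upper bound for the Kobayashi distance from \<open>pk k\<close> to \<open>w\<close> in dual form. A point close to the boundary
  is first moved along its normal to a definite depth. The points at such a depth lie in a compact
  subset of the limit domain, as does \<open>pk k\<close>, and there \<open>chain_bound\<close> applies.
\<close>
lemma boundary_distance_comparison: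
  fixes D :: "(complex ^ 'n) set" and f :: "nat \<Rightarrow> complex ^ 'n \<Rightarrow> complex ^ 'n"
  assumes pos: "\<eta> > 0" "B > 0" "\<epsilon> > 0" "g > 0" and D: "connected D" "bounded D" "closure D \<subseteq> W"
    and dom: "C2_domain W \<eta> B \<epsilon> g D \<rho>0"
    and ev: "\<forall>\<^sub>F k in sequentially. C2_domain W \<eta> B \<epsilon> g (Y k) (\<rho> k)"
    and close: "\<forall>e>0. \<forall>\<^sub>F k in sequentially. \<forall>z\<in>W. \<bar>\<rho> k z - \<rho>0 z\<bar> < e"
    and p: "p \<in> D" "pk \<longlonglongrightarrow> p"
  obtains C where "C \<ge> 0"
    "\<forall>\<^sub>F k in sequentially. \<forall>\<Lambda>. kobayashi_lipschitz (Y k) \<Lambda> \<longrightarrow> (\<forall>w\<in>Y k. \<Lambda> (pk k) - \<Lambda> w \<le> C + ln (1 / (- \<rho> k w)) / 2)"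
proof -
  obtain s1 C1 where s1: "s1 > 0" "C1 \<ge> 0" and seg:
    "\<And>X \<rho> w \<Lambda>. C2_domain W \<eta> B \<epsilon> g X \<rho> \<Longrightarrow> w \<in> X \<Longrightarrow> - \<rho> w < \<epsilon> \<Longrightarrow> kobayashi_lipschitz X \<Lambda> \<Longrightarrow>
       \<exists>w'\<in>X. s1 \<le> - \<rho> w' \<and> \<bar>\<Lambda> w - \<Lambda> w'\<bar> \<le> C1 + ln (1 / (- \<rho> w)) / 2"
    by (rule normal_segment_bound[OF pos(1,2,4), where W = W and \<epsilon> = \<epsilon>]) blast
  define sl where "sl = min s1 \<epsilon>"
  have sl: "sl > 0" using s1 pos by (simp add: sl_def)
  have opD: "open D" by (rule dom_open[OF dom])
  obtain e where e: "e > 0" "cball p e \<subseteq> D" using opD p(1) open_contains_cball by blast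
  define K where "K = {w \<in> closure D. \<rho>0 w \<le> - (sl / 2)} \<union> cball p e"
  have sl2: "sl / 2 > 0" using sl by simp
  note cs = compact_sublevel[OF dom D(3) sl2 D(2)]
  have K: "compact K" "K \<subseteq> D" using cs e by (auto simp: K_def)
  obtain L C2 where L: "compact L" "L \<subseteq> D" "C2 \<ge> 0"
    "\<And>\<Lambda> :: complex ^ 'n \<Rightarrow> real. \<And>M x y. M \<ge> 0 \<Longrightarrow>
       (\<And>x. x \<in> L \<Longrightarrow> \<exists>\<Lambda>'. (\<Lambda> has_derivative \<Lambda>') (at x) \<and> (\<forall>h. \<bar>\<Lambda>' h\<bar> \<le> M * norm h)) \<Longrightarrow>
       x \<in> K \<Longrightarrow> y \<in> K \<Longrightarrow> \<bar>\<Lambda> x - \<Lambda> y\<bar> \<le> C2 * M"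
    by (rule chain_bound[OF opD D(1) K]) blast
  obtain d where d: "d > 0" "\<forall>\<^sub>F k in sequentially. \<forall>x\<in>L. ball x d \<subseteq> Y k"
    by (rule compact_inside_uniformly[OF dom L(1,2) ev close])
  define C where "C = C1 + C2 * (1 / d) + \<bar>ln B\<bar> / 2"
  show ?thesis
  proof (rule that[of C])
    show "C \<ge> 0" using s1 L(3) d(1) by (simp add: C_def)
    have "\<forall>\<^sub>F k in sequentially. dist (pk k) p < e" using p(2) e(1) by (rule tendstoD)
    with ev close[rule_format, OF sl2] d(2)
    show "\<forall>\<^sub>F k in sequentially. \<forall>\<Lambda>. kobayashi_lipschitz (Y k) \<Lambda> \<longrightarrow> (\<forall>w\<in>Y k. \<Lambda> (pk k) - \<Lambda> w \<le> C + ln (1 / (- \<rho> k w)) / 2)"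
    proof eventually_elim
      case (elim k)
      show ?case
      proof (intro allI impI ballI)
        fix \<Lambda> w assume \<Lambda>: "kobayashi_lipschitz (Y k) \<Lambda>" and w: "w \<in> Y k"
        have wW: "w \<in> W" using w dom_sub[OF elim(1)] by blast
        have good: "\<exists>\<Lambda>'. (\<Lambda> has_derivative \<Lambda>') (at x) \<and> (\<forall>h. \<bar>\<Lambda>' h\<bar> \<le> 1 / d * norm h)" if "x \<in> L" for x
        proof -
          have b: "ball x d \<subseteq> Y k" using elim(3) that by blast
          then have "x \<in> Y k" using d(1) by auto
          then obtain \<Lambda>' where \<Lambda>': "(\<Lambda> has_derivative \<Lambda>') (at x)" "\<And>h. \<bar>\<Lambda>' h\<bar> \<le> kobayashi_metric (Y k) x h"
            using \<Lambda> unfolding kobayashi_lipschitz_def by blast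
          have "\<bar>\<Lambda>' h\<bar> \<le> 1 / d * norm h" for h
            using \<Lambda>'(2)[of h] kobayashi_metric_le_ball[OF b d(1), of h] by simp
          with \<Lambda>'(1) show ?thesis by blast
        qed
        have inK: "v \<in> K" if "v \<in> Y k" "sl \<le> - \<rho> k v" for v
        proof -
          have vW: "v \<in> W" using that dom_sub[OF elim(1)] by blast
          then have "\<bar>\<rho> k v - \<rho>0 v\<bar> < sl / 2" using elim(2) by blast
          then have r: "\<rho>0 v \<le> - (sl / 2)" using that(2) by linarith
          then have "v \<in> D" using dom_in[OF dom vW] sl by linarith
          then show ?thesis using r closure_subset[of D] by (auto simp: K_def)
        qed
        have pkK: "pk k \<in> K" using elim(4) by (simp add: K_def dist_commute)
        have far: "\<bar>\<Lambda> (pk k) - \<Lambda> v\<bar> \<le> C2 * (1 / d)" if "v \<in> Y k" "sl \<le> - \<rho> k v" for v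
          using L(4)[OF _ good pkK inK[OF that]] d(1) by simp
        have s: "0 < - \<rho> k w" "- \<rho> k w \<le> B" using dom_neg[OF elim(1) w] dom_abs[OF elim(1) wW] by auto
        show "\<Lambda> (pk k) - \<Lambda> w \<le> C + ln (1 / (- \<rho> k w)) / 2"
        proof (cases "sl \<le> - \<rho> k w")
          case True
          have "ln (- \<rho> k w) \<le> ln B" using s by (subst ln_le_cancel_iff) auto
          then have "- \<bar>ln B\<bar> \<le> ln (1 / (- \<rho> k w))" using ln_reciprocal[OF s(1)] by linarith
          then show ?thesis using far[OF w True] s1 unfolding C_def by linarith
        next
          case False
          then have "- \<rho> k w < \<epsilon>" by (simp add: sl_def)
          from seg[OF elim(1) w this \<Lambda>] obtain w' where w': "w' \<in> Y k" "s1 \<le> - \<rho> k w'"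
            "\<bar>\<Lambda> w - \<Lambda> w'\<bar> \<le> C1 + ln (1 / (- \<rho> k w)) / 2" by blast
          have "sl \<le> - \<rho> k w'" using w'(2) by (simp add: sl_def)
          from far[OF w'(1) this] w'(3) show ?thesis unfolding C_def by linarith
        qed
      qed
    qed
  qed
qed

theorem theorem1p2:
  fixes D1 D2 :: "(complex ^ 'n) set"
    and D1k D2k :: "nat \<Rightarrow> (complex ^ 'n) set"
    and f :: "nat \<Rightarrow> complex ^ 'n \<Rightarrow> complex ^ 'n"
    and \<kappa> :: "nat \<Rightarrow> nat"
    and p1 p2 :: "complex ^ 'n"
  assumes "strongly_pseudoconvex_domain D1" and "strongly_pseudoconvex_domain D2"
    and "\<And>k. k \<ge> 1 \<Longrightarrow> is_domain (D1k k)" and "\<And>k. k \<ge> 1 \<Longrightarrow> is_domain (D2k k)"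
    and "C2_converges D1k D1" and "C2_converges D2k D2"
    and "\<And>k. k \<ge> 1 \<Longrightarrow> C1_isometry (D1k k) (D2k k) (f k)"
    and "strict_mono \<kappa>" and "\<And>j. \<kappa> j \<ge> 1"
    and "p1 \<in> D1" and "p2 \<in> D2"
    and "(\<lambda>j. f (\<kappa> j) p1) \<longlonglongrightarrow> p2"
  shows "\<exists>C>0. \<forall>p\<in>D1. \<forall>q\<in>D1. \<forall>\<^sub>F j in sequentially.
           p \<in> D1k (\<kappa> j) \<and> q \<in> D1k (\<kappa> j) \<and>
           norm (f (\<kappa> j) p - f (\<kappa> j) q) \<le> C * norm (p - q) powr (1/2)"
proof -
  have is_dom: "\<forall>k\<ge>1. is_domain (D1k k)" "\<forall>k\<ge>1. is_domain (D2k k)" using assms(3,4) by auto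
  obtain W \<eta> B \<epsilon> g A c \<tau> \<rho>0 \<rho> where pos1: "\<eta> > 0" "B > 0" "\<epsilon> > 0" "g > 0" "A > 0" "c > 0" "\<tau> > 0"
    and "closure D1 \<subseteq> W" and dom10: "C2_domain W \<eta> B \<epsilon> g D1 \<rho>0"
    and ev1: "\<forall>\<^sub>F k in sequentially. C2_domain W \<eta> B \<epsilon> g (D1k k) (\<rho> k) \<and> strongly_psc_domain W A c \<tau> (D1k k) (\<rho> k) \<epsilon>"
    and close1: "\<forall>e>0. \<forall>\<^sub>F k in sequentially. \<forall>z\<in>W. \<bar>\<rho> k z - \<rho>0 z\<bar> < e"
    by (rule uniform_domains[OF assms(1) is_dom(1) assms(5)])
  obtain W' \<eta>' B' \<epsilon>' g' A' c' \<tau>' \<sigma>0 \<sigma> where pos2: "\<eta>' > 0" "B' > 0" "\<epsilon>' > 0" "g' > 0" "A' > 0" "c' > 0" "\<tau>' > 0"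
    and cl2: "closure D2 \<subseteq> W'"
    and dom20: "C2_domain W' \<eta>' B' \<epsilon>' g' D2 \<sigma>0"
    and ev2: "\<forall>\<^sub>F k in sequentially. C2_domain W' \<eta>' B' \<epsilon>' g' (D2k k) (\<sigma> k) \<and> strongly_psc_domain W' A' c' \<tau>' (D2k k) (\<sigma> k) \<epsilon>'"
    and close2: "\<forall>e>0. \<forall>\<^sub>F k in sequentially. \<forall>z\<in>W'. \<bar>\<sigma> k z - \<sigma>0 z\<bar> < e"
    by (rule uniform_domains[OF assms(2) is_dom(2) assms(6)])
  obtain C1 where C1: "C1 > 0"
    and "\<And>X \<rho> g z \<xi>. C2_domain W \<eta> B \<epsilon> g X \<rho> \<Longrightarrow> strongly_psc_domain W A c \<tau> X \<rho> \<epsilon> \<Longrightarrow> z \<in> X \<Longrightarrow>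
       norm \<xi> \<le> C1 * sqrt (- \<rho> z) * kobayashi_metric X z \<xi>"
    and low1: "\<And>X \<rho> g z \<xi>. C2_domain W \<eta> B \<epsilon> g X \<rho> \<Longrightarrow> strongly_psc_domain W A c \<tau> X \<rho> \<epsilon> \<Longrightarrow> z \<in> X \<Longrightarrow>
       \<bar>deriv1 \<rho> z \<xi>\<bar> \<le> 2 * (- \<rho> z) * (1 + C1 * (- \<rho> z)) * kobayashi_metric X z \<xi>"
    by (rule kobayashi_lower_bounds[OF pos1(1,2,3,5,6,7), where W = W]) (rule that, assumption, blast, blast)
  obtain C2 where C2: "C2 > 0"
    and low2: "\<And>X \<rho> g z \<xi>. C2_domain W' \<eta>' B' \<epsilon>' g X \<rho> \<Longrightarrow> strongly_psc_domain W' A' c' \<tau>' X \<rho> \<epsilon>' \<Longrightarrow> z \<in> X \<Longrightarrow>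
       norm \<xi> \<le> C2 * sqrt (- \<rho> z) * kobayashi_metric X z \<xi>"
    and "\<And>X \<rho> g z \<xi>. C2_domain W' \<eta>' B' \<epsilon>' g X \<rho> \<Longrightarrow> strongly_psc_domain W' A' c' \<tau>' X \<rho> \<epsilon>' \<Longrightarrow> z \<in> X \<Longrightarrow>
       \<bar>deriv1 \<rho> z \<xi>\<bar> \<le> 2 * (- \<rho> z) * (1 + C2 * (- \<rho> z)) * kobayashi_metric X z \<xi>"
    by (rule kobayashi_lower_bounds[OF pos2(1,2,3,5,6,7), where W = W']) (rule that, assumption, blast, blast)
  note sub = eventually_compose_filterlim[OF _ filterlim_subseq[OF assms(8)]]
  have D2: "connected D2" "bounded D2"
    using assms(2) by (auto simp: strongly_pseudoconvex_domain_def is_domain_def)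
  have ev2': "\<forall>\<^sub>F j in sequentially. C2_domain W' \<eta>' B' \<epsilon>' g' (D2k (\<kappa> j)) (\<sigma> (\<kappa> j))"
    using sub[OF ev2] by eventually_elim blast
  have close2': "\<forall>e>0. \<forall>\<^sub>F j in sequentially. \<forall>z\<in>W'. \<bar>\<sigma> (\<kappa> j) z - \<sigma>0 z\<bar> < e"
    using sub[OF close2[rule_format]] by blast
  obtain C3 where C3: "C3 \<ge> 0" and cmp:
    "\<forall>\<^sub>F j in sequentially. \<forall>\<Lambda>. kobayashi_lipschitz (D2k (\<kappa> j)) \<Lambda> \<longrightarrow>
       (\<forall>w\<in>D2k (\<kappa> j). \<Lambda> (f (\<kappa> j) p1) - \<Lambda> w \<le> C3 + ln (1 / (- \<sigma> (\<kappa> j) w)) / 2)"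
    by (rule boundary_distance_comparison[OF pos2(1-4) D2 cl2 dom20 ev2' close2' assms(11,12)])
  define s0 where "s0 = - \<rho>0 p1 / 2"
  have s0: "s0 > 0" using dom_neg[OF dom10 assms(10)] by (simp add: s0_def)
  \<comment> \<open>The base point stays at depth at least \<open>s0\<close>, so \<open>1/2 log m\<close> is a lower bound for \<open>\<Lambda>\<close> at its image.\<close>
  define m where "m = s0 / (1 + C1 * B)"
  have CB: "1 + C1 * B > 0" using C1 pos1 by (simp add: add_pos_pos)
  have m: "m > 0" using s0 CB by (simp add: m_def)
  define C4 where "C4 = exp (2 * C3) / m"
  have C4: "C4 > 0" using m by (simp add: C4_def)
  define M where "M = C2 * sqrt C4 * (B / \<eta> + B)"
  have k: "B / \<eta> + B > 0" using pos1 by (simp add: add_pos_pos)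
  have M: "M > 0" using C2 C4 k by (simp add: M_def)
  have grad: "\<forall>\<^sub>F j in sequentially. \<forall>z\<in>D1k (\<kappa> j).
      \<exists>F'. (f (\<kappa> j) has_derivative F') (at z) \<and> (\<forall>h. norm (F' h) \<le> M * norm h / sqrt (- \<rho> (\<kappa> j) z))"
    using sub[OF ev1] sub[OF ev2] sub[OF close1[rule_format, OF s0]] cmp
  proof eventually_elim
    case (elim j)
    let ?X = "D1k (\<kappa> j)" and ?Y = "D2k (\<kappa> j)" and ?f = "f (\<kappa> j)"
    define r where "r = \<rho> (\<kappa> j)"
    define s where "s = \<sigma> (\<kappa> j)"
    have dX: "C2_domain W \<eta> B \<epsilon> g ?X r" and sX: "strongly_psc_domain W A c \<tau> ?X r \<epsilon>" using elim(1) by (auto simp: r_def)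
    have dY: "C2_domain W' \<eta>' B' \<epsilon>' g' ?Y s" and sY: "strongly_psc_domain W' A' c' \<tau>' ?Y s \<epsilon>'" using elim(2) by (auto simp: s_def)
    have iso: "C1_isometry ?X ?Y ?f" by (rule assms(7)[OF assms(9)])
    have bij: "bij_betw ?f ?X ?Y" and C1f: "C1_on ?X ?f" and F: "\<And>z \<xi>. z \<in> ?X \<Longrightarrow>
        kobayashi_metric ?Y (?f z) (blinfun_apply (total_deriv ?f z) \<xi>) = kobayashi_metric ?X z \<xi>"
      using iso by (auto simp: C1_isometry_def C1_diffeomorphism_def)
    have inv: "inv_into ?X ?f (?f z) = z" and fY: "?f z \<in> ?Y" if "z \<in> ?X" for z
      using that bij by (auto simp: bij_betw_def)
    have p1W: "p1 \<in> W" using assms(10) dom_sub[OF dom10] by blast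
    then have "\<bar>r p1 - \<rho>0 p1\<bar> < s0" using elim(3) by (simp add: r_def)
    then have rp1: "s0 \<le> - r p1" by (simp add: s0_def abs_less_iff)
    then have p1X: "p1 \<in> ?X" using dom_in[OF dX p1W] s0 by simp
    \<comment> \<open>Comparing \<open>\<Lambda>\<close> at the images of \<open>p1\<close> and \<open>z\<close> turns the sharp conormal bound on the first domain and
        the sharp distance bound on the second one into a comparison of the boundary distances.\<close>
    define \<Lambda> where "\<Lambda> = (\<lambda>w. (ln (- r (inv_into ?X ?f w)) - ln (1 + C1 * (- r (inv_into ?X ?f w)))) / 2)"
    have "kobayashi_lipschitz ?Y \<Lambda>"
      unfolding \<Lambda>_def using isometry_pullback_lipschitz[OF iso dX dom_open[OF dY] C1 low1[OF dX sX]] .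
    then have cmp': "\<Lambda> (?f p1) - \<Lambda> w \<le> C3 + ln (1 / (- s w)) / 2" if "w \<in> ?Y" for w
      using elim(4) that by (auto simp: s_def)
    have pres: "- s (?f z) \<le> C4 * (- r z)" if z: "z \<in> ?X" for z
    proof -
      have rz: "- r z > 0" and sz: "- s (?f z) > 0" using dom_neg[OF dX z] dom_neg[OF dY fY[OF z]] by auto
      have Lz: "\<Lambda> (?f z) \<le> ln (- r z) / 2"
      proof -
        have "1 \<le> 1 + C1 * (- r z)" using mult_pos_pos[OF C1 rz] by linarith
        then have "0 \<le> ln (1 + C1 * (- r z))" by (rule ln_ge_zero)
        then show ?thesis by (simp add: \<Lambda>_def inv[OF z])
      qed
      have Lp: "ln m / 2 \<le> \<Lambda> (?f p1)"
      proof -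
        have rB: "- r p1 \<le> B" using dom_abs[OF dX p1W] by auto
        have "C1 * (- r p1) \<le> C1 * B" using rB C1 by (intro mult_left_mono) auto
        moreover have "C1 * (- r p1) > 0" using rp1 s0 C1 by (intro mult_pos_pos) auto
        ultimately have "ln (1 + C1 * (- r p1)) \<le> ln (1 + C1 * B)" by (subst ln_le_cancel_iff) auto
        moreover have "ln s0 \<le> ln (- r p1)" using rp1 s0 by (subst ln_le_cancel_iff) auto
        ultimately show ?thesis using s0 CB by (simp add: \<Lambda>_def inv[OF p1X] m_def ln_div)
      qed
      have "ln m / 2 - ln (- r z) / 2 \<le> C3 + ln (1 / (- s (?f z))) / 2"
        using cmp'[OF fY[OF z]] Lz Lp by linarith
      then have "ln (- s (?f z)) \<le> 2 * C3 - ln m + ln (- r z)" using ln_reciprocal[OF sz] by linarith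
      also have "\<dots> = ln (C4 * (- r z))"
        unfolding ln_mult_pos[OF C4 rz] using m by (simp add: C4_def ln_div)
      finally show ?thesis using ln_le_cancel_iff[OF sz mult_pos_pos[OF C4 rz]] by blast
    qed
    show ?case
    proof
      fix z assume z: "z \<in> ?X"
      let ?T = "blinfun_apply (total_deriv ?f z)"
      have rz: "- r z > 0" and sz: "- s (?f z) > 0" using dom_neg[OF dX z] dom_neg[OF dY fY[OF z]] by auto
      have "norm (?T h) \<le> M * norm h / sqrt (- r z)" for h
      proof -
        let ?F = "kobayashi_metric ?X z h"
        have F0: "?F \<ge> 0" by (rule kobayashi_metric_nonneg[OF dom_open[OF dX] z])
        have "norm (?T h) \<le> C2 * sqrt (- s (?f z)) * ?F"
          using low2[OF dY sY fY[OF z], of "?T h"] F[OF z, of h] by simp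
        also have "\<dots> \<le> C2 * sqrt (C4 * (- r z)) * ?F"
          using pres[OF z] C2 F0 by (intro mult_right_mono mult_left_mono real_sqrt_le_mono) auto
        also have "\<dots> \<le> C2 * sqrt (C4 * (- r z)) * ((B / \<eta> + B) * norm h / (- r z))"
        proof (rule mult_left_mono)
          show "?F \<le> (B / \<eta> + B) * norm h / (- r z)" by (rule dom_kobayashi_upper[OF dX pos1(1,2) z])
          have "0 \<le> sqrt (C4 * (- r z))" using C4 rz by (intro real_sqrt_ge_zero mult_nonneg_nonneg) auto
          then show "0 \<le> C2 * sqrt (C4 * (- r z))" using C2 by simp
        qed
        also have "\<dots> = M * norm h * (sqrt (- r z) / (- r z))"
          unfolding M_def real_sqrt_mult by simp
        also have "sqrt (- r z) / (- r z) = 1 / sqrt (- r z)"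
          using sqrt_divide_self_eq[of "- r z"] rz by (simp add: inverse_eq_divide)
        finally show ?thesis by simp
      qed
      moreover have "(?f has_derivative ?T) (at z)"
        using C1f z by (intro total_deriv_has_derivative) (auto simp: C1_on_def)
      ultimately show "\<exists>F'. (?f has_derivative F') (at z) \<and> (\<forall>h. norm (F' h) \<le> M * norm h / sqrt (- \<rho> (\<kappa> j) z))"
        unfolding r_def by blast
    qed
  qed
  obtain d0 C5 where d0: "d0 > 0" and C5: "C5 \<ge> 0" and hl:
    "\<And>p q m M F. p \<in> D1 \<Longrightarrow> q \<in> D1 \<Longrightarrow> 0 < norm (p - q) \<Longrightarrow> norm (p - q) < d0 \<Longrightarrow> 0 < m \<Longrightarrow>
       m \<le> - \<rho>0 p \<Longrightarrow> m \<le> - \<rho>0 q \<Longrightarrow> m \<le> norm (p - q) \<Longrightarrow> M \<ge> 0 \<Longrightarrow>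
       (\<And>z. z \<in> D1 \<Longrightarrow> m \<le> - \<rho>0 z \<Longrightarrow>
         \<exists>F'. (F has_derivative F') (at z) \<and> (\<forall>h. norm (F' h) \<le> M * norm h / sqrt (- \<rho>0 z))) \<Longrightarrow>
       norm (F p - F q :: complex ^ 'n) \<le> C5 * M * sqrt (norm (p - q))"
    by (rule hoelder_from_gradient[OF dom10 pos1(1-4)]) blast
  define C where "C = C5 * (sqrt 2 * M) + B' / sqrt d0"
  have C0: "C5 * (sqrt 2 * M) \<ge> 0" "B' / sqrt d0 > 0" using C5 M pos2 d0 by auto
  show ?thesis
  proof (intro exI[of _ C] conjI ballI)
    show "C > 0" using C0 by (simp add: C_def)
    fix p q assume p: "p \<in> D1" and q: "q \<in> D1"
    have pqW: "p \<in> W" "q \<in> W" using p q dom_sub[OF dom10] by auto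
    define d where "d = norm (p - q)"
    \<comment> \<open>The depth of the path that joins \<open>p\<close> and \<open>q\<close>; it decides which indices are large enough.\<close>
    define m' where "m' = min (min (- \<rho>0 p) (- \<rho>0 q)) (if d = 0 then 1 else d)"
    have m': "m' > 0" "m' \<le> - \<rho>0 p" "m' \<le> - \<rho>0 q" "d \<noteq> 0 \<Longrightarrow> m' \<le> d"
      using dom_neg[OF dom10 p] dom_neg[OF dom10 q] by (auto simp: m'_def d_def)
    then have m'2: "m' / 2 > 0" by simp
    show "\<forall>\<^sub>F j in sequentially. p \<in> D1k (\<kappa> j) \<and> q \<in> D1k (\<kappa> j) \<and>
           norm (f (\<kappa> j) p - f (\<kappa> j) q) \<le> C * norm (p - q) powr (1/2)"
      using sub[OF ev1] sub[OF ev2] sub[OF close1[rule_format, OF m'2]] grad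
    proof eventually_elim
      case (elim j)
      let ?X = "D1k (\<kappa> j)" and ?Y = "D2k (\<kappa> j)" and ?f = "f (\<kappa> j)"
      define r where "r = \<rho> (\<kappa> j)"
      have dX: "C2_domain W \<eta> B \<epsilon> g ?X r" using elim(1) by (auto simp: r_def)
      have dY: "C2_domain W' \<eta>' B' \<epsilon>' g' ?Y (\<sigma> (\<kappa> j))" using elim(2) by auto
      have fY: "?f z \<in> ?Y" if "z \<in> ?X" for z
        using that assms(7)[OF assms(9), of j] by (auto simp: C1_isometry_def C1_diffeomorphism_def bij_betw_def)
      have near: "z \<in> ?X \<and> - \<rho>0 z / 2 \<le> - r z" if "z \<in> W" "m' \<le> - \<rho>0 z" for z
      proof -
        have "\<bar>r z - \<rho>0 z\<bar> < m' / 2" using elim(3) that(1) by (simp add: r_def)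
        then have "- \<rho>0 z / 2 \<le> - r z" using that(2) by linarith
        moreover have "r z < 0" using calculation that(2) m'(1) by linarith
        ultimately show ?thesis using dom_in[OF dX that(1)] by blast
      qed
      have pX: "p \<in> ?X" and qX: "q \<in> ?X" using near pqW m' by blast+
      have sq: "norm (p - q) powr (1/2) = sqrt d" by (simp add: d_def powr_half_sqrt)
      have "norm (?f p - ?f q) \<le> C * sqrt d"
      proof (cases "d = 0")
        case True
        then show ?thesis by (simp add: d_def)
      next
        case False
        then have d: "d > 0" by (simp add: d_def)
        show ?thesis
        proof (cases "d < d0")
          case True
          have "norm (?f p - ?f q) \<le> C5 * (sqrt 2 * M) * sqrt (norm (p - q))"
          proof (rule hl[OF p q _ _ m'(1-3)])
            show "0 < norm (p - q)" "norm (p - q) < d0" "m' \<le> norm (p - q)" "0 \<le> sqrt 2 * M"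
              using d True m'(4) False M by (auto simp: d_def)
            fix z assume z: "z \<in> D1" "m' \<le> - \<rho>0 z"
            have zW: "z \<in> W" using z dom_sub[OF dom10] by blast
            note nz = near[OF zW z(2)]
            then obtain F' where F': "(?f has_derivative F') (at z)" "\<And>h. norm (F' h) \<le> M * norm h / sqrt (- r z)"
              using elim(4) unfolding r_def by blast
            have "M * norm h / sqrt (- r z) \<le> sqrt 2 * M * norm h / sqrt (- \<rho>0 z)" for h
            proof -
              have "sqrt (- \<rho>0 z / 2) \<le> sqrt (- r z)" using nz by (intro real_sqrt_le_mono) blast
              then have "M * norm h / sqrt (- r z) \<le> M * norm h / sqrt (- \<rho>0 z / 2)"
                using M z(2) m'(1) by (intro frac_le) auto
              also have "\<dots> = sqrt 2 * M * norm h / sqrt (- \<rho>0 z)" by (simp only: real_sqrt_divide) simp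
              finally show ?thesis .
            qed
            with F' show "\<exists>F'. (?f has_derivative F') (at z) \<and> (\<forall>h. norm (F' h) \<le> sqrt 2 * M * norm h / sqrt (- \<rho>0 z))"
              by (meson order_trans)
          qed
          also have "\<dots> \<le> C * sqrt d" unfolding d_def[symmetric]
            by (rule mult_right_mono) (use C0(2) d in \<open>simp_all add: C_def\<close>)
          finally show ?thesis .
        next
          case False
          have "norm (?f p - ?f q) \<le> B'" using dom_diam[OF dY fY[OF pX] fY[OF qX]] .
          also have "B' = B' / sqrt d0 * sqrt d0" using d0 by simp
          also have "\<dots> \<le> B' / sqrt d0 * sqrt d" using False C0(2) by (intro mult_left_mono) auto
          also have "\<dots> \<le> C * sqrt d"
            by (rule mult_right_mono) (use C0(1) d in \<open>simp_all add: C_def\<close>)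
          finally show ?thesis .
        qed
      qed
      with pX qX sq show ?case by simp
    qed
  qed
qed

end
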